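(* Let $G=(V,E)$ be a ribbon graph and let $n$ be a non-negative integer. Then (1) $D_{\leq n}(G)=(E,\mathcal{F}_{\leq n}(G))$ is a delta-matroid; and (2) $D_1(G)=(E,\mathcal{F}_1(G))$ is a delta-matroid, if $E\neq\emptyset$ and $G$ is orientable.
   Context: A ribbon graph $G=(V,E)$ is a surface with boundary, represented as the union of two finite sets of discs, the vertices $V$ and the edges $E$, such that: the vertices and edges intersect in disjoint line segments; each such line segment lies on the boundary of precisely one vertex and precisely one edge; every edge contains exactly two such line segments. $G$ is orientable if it is orientable as a surface. For $A\subseteq E$, $f(A)$ denotes the number of boundary components of the spanning ribbon subgraph $(V,A)$, and $k(G)$ denotes the number of connected components of $G$. For a non-negative integer $n$, $\mathcal{F}_{\leq n}(G)=\{A\subseteq E \mid f(A)\leq k(G)+n\}$ and $\mathcal{F}_n(G)=\{A\subseteq E\mid f(A)=k(G)+n\}$. A set system is a pair $D=(E,\mathcal{F})$ with $E$ a finite set and $\mathcal{F}$ a collection of subsets of $E$, called feasible sets; it is proper if $\mathcal{F}\neq\emptyset$. A delta-matroid is a proper set system satisfying the Symmetric Exchange Axiom: for all $X,Y\in\mathcal{F}$ and $u\in X\bigtriangleup Y$ there is $v\in X\bigtriangleup Y$ (possibly $v=u$) such that $X\bigtriangleup\{u,v\}\in\mathcal{F}$. *)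

theory Defs
  imports "HOL-Analysis.Analysis"
begin

section \<open>Surfaces with boundary\<close>

definition surface_with_boundary :: "'a topology \<Rightarrow> bool" where
  "surface_with_boundary X \<longleftrightarrow>
     Hausdorff_space X \<and> second_countable X \<and>
     (\<forall>x\<in>topspace X. \<exists>U W. openin X U \<and> x \<in> U \<and>
        openin (top_of_set {z::complex. 0 \<le> Im z}) W \<and>
        subtopology X U homeomorphic_space top_of_set W)"

text \<open>The boundary in the sense of manifolds: the points without a neighbourhood homeomorphic
  to an open subset of the plane. It is intrinsic to the topology, unlike the frontier of a
  subset.\<close>

definition surface_boundary :: "'a topology \<Rightarrow> 'a set" where
  "surface_boundary X =
     {x \<in> topspace X. \<nexists>U W. openin X U \<and> x \<in> U \<and> open (W :: complex set) \<and>
        subtopology X U homeomorphic_space top_of_set W}"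

definition boundary_components :: "'a topology \<Rightarrow> 'a set set" where
  "boundary_components X = connected_components_of (subtopology X (surface_boundary X))"

text \<open>A map as below is a Moebius band in \<open>X\<close>: it factors through an injective continuous map
  on the quotient of the unit square identifying \<open>(0, t)\<close> with \<open>(1, 1 - t)\<close>. As this quotient is
  compact, the injection is an embedding whenever \<open>X\<close> is Hausdorff.\<close>

definition moebius_band_in :: "'a topology \<Rightarrow> (real \<times> real \<Rightarrow> 'a) \<Rightarrow> bool" where
  "moebius_band_in X h \<longleftrightarrow>
     continuous_map (top_of_set ({0..1} \<times> {0..1})) X h \<and>
     (\<forall>s\<in>{0..1}. \<forall>t\<in>{0..1}. \<forall>s'\<in>{0..1}. \<forall>t'\<in>{0..1}.
        h (s, t) = h (s', t') \<longleftrightarrow>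
          (s = s' \<and> t = t') \<or> ({s, s'} = {0, 1} \<and> t' = 1 - t))"

text \<open>A surface is orientable if it contains no Moebius band.\<close>

definition orientable_surface :: "'a topology \<Rightarrow> bool" where
  "orientable_surface X \<longleftrightarrow> (\<nexists>h. moebius_band_in X h)"


section \<open>Ribbon graphs\<close>

definition closed_disc_in :: "'a topology \<Rightarrow> 'a set \<Rightarrow> bool" where
  "closed_disc_in X d \<longleftrightarrow>
     d \<subseteq> topspace X \<and> subtopology X d homeomorphic_space top_of_set (cball (0::complex) 1)"

definition line_segment_in :: "'a topology \<Rightarrow> 'a set \<Rightarrow> bool" where
  "line_segment_in X s \<longleftrightarrow>
     s \<subseteq> topspace X \<and> subtopology X s homeomorphic_space top_of_set {0..1::real}"

text \<open>The sets in which the vertices and the edges intersect. A decomposition of the intersection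
  into finitely many disjoint line segments is necessarily the one into connected components.\<close>

definition attaching_segments :: "'a topology \<Rightarrow> 'a set set \<Rightarrow> 'a set set \<Rightarrow> 'a set set" where
  "attaching_segments X V E = connected_components_of (subtopology X (\<Union>V \<inter> \<Union>E))"

text \<open>The surface is \<open>X\<close>; the vertices and the edges are closed discs in it. Distinct vertices
  do not meet, nor do distinct edges.\<close>

locale ribbon_graph =
  fixes X :: "'a topology" and V E :: "'a set set"
  assumes surface: "surface_with_boundary X"
    and finite_V: "finite V" and finite_E: "finite E"
    and disc_V: "\<And>v. v \<in> V \<Longrightarrow> closed_disc_in X v"
    and disc_E: "\<And>e. e \<in> E \<Longrightarrow> closed_disc_in X e"
    and cover: "topspace X = \<Union>V \<union> \<Union>E"
    and disjoint_V: "pairwise disjnt V" and disjoint_E: "pairwise disjnt E"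
    and segment: "\<And>s. s \<in> attaching_segments X V E \<Longrightarrow> line_segment_in X s"
    and segment_vertex: "\<And>s. s \<in> attaching_segments X V E \<Longrightarrow>
          \<exists>!v. v \<in> V \<and> s \<subseteq> surface_boundary (subtopology X v)"
    and segment_edge: "\<And>s. s \<in> attaching_segments X V E \<Longrightarrow>
          \<exists>!e. e \<in> E \<and> s \<subseteq> surface_boundary (subtopology X e)"
    and two_segments: "\<And>e. e \<in> E \<Longrightarrow> card {s \<in> attaching_segments X V E. s \<subseteq> e} = 2"

definition num_components :: "'a topology \<Rightarrow> nat" where
  "num_components X = card (connected_components_of X)"

definition spanning_subsurface :: "'a topology \<Rightarrow> 'a set set \<Rightarrow> 'a set set \<Rightarrow> 'a topology" where
  "spanning_subsurface X V A = subtopology X (\<Union>V \<union> \<Union>A)"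

definition num_boundary_components :: "'a topology \<Rightarrow> 'a set set \<Rightarrow> 'a set set \<Rightarrow> nat" where
  "num_boundary_components X V A = card (boundary_components (spanning_subsurface X V A))"

definition feasible_le :: "'a topology \<Rightarrow> 'a set set \<Rightarrow> 'a set set \<Rightarrow> nat \<Rightarrow> 'a set set set" where
  "feasible_le X V E n = {A. A \<subseteq> E \<and> num_boundary_components X V A \<le> num_components X + n}"

definition feasible_eq :: "'a topology \<Rightarrow> 'a set set \<Rightarrow> 'a set set \<Rightarrow> nat \<Rightarrow> 'a set set set" where
  "feasible_eq X V E n = {A. A \<subseteq> E \<and> num_boundary_components X V A = num_components X + n}"


section \<open>Delta-matroids\<close>

type_synonym 'e set_system = "'e set \<times> 'e set set"

definition is_set_system :: "'e set_system \<Rightarrow> bool" where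
  "is_set_system D \<longleftrightarrow> finite (fst D) \<and> snd D \<subseteq> Pow (fst D)"

definition proper :: "'e set_system \<Rightarrow> bool" where
  "proper D \<longleftrightarrow> snd D \<noteq> {}"

definition symmetric_exchange :: "'e set set \<Rightarrow> bool" where
  "symmetric_exchange F \<longleftrightarrow>
     (\<forall>P\<in>F. \<forall>Q\<in>F. \<forall>u\<in>sym_diff P Q. \<exists>v\<in>sym_diff P Q. sym_diff P {u, v} \<in> F)"

definition delta_matroid :: "'e set_system \<Rightarrow> bool" where
  "delta_matroid D \<longleftrightarrow> is_set_system D \<and> proper D \<and> symmetric_exchange (snd D)"

definition D_le :: "'a topology \<Rightarrow> 'a set set \<Rightarrow> 'a set set \<Rightarrow> nat \<Rightarrow> 'a set set_system" where
  "D_le X V E n = (E, feasible_le X V E n)"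

definition D_eq :: "'a topology \<Rightarrow> 'a set set \<Rightarrow> 'a set set \<Rightarrow> nat \<Rightarrow> 'a set set_system" where
  "D_eq X V E n = (E, feasible_eq X V E n)"

end

theory Submission
  imports Defs
begin

text \<open>Cut the boundary circles of all vertices and edges at the ends of the attaching segments, four ends for
each edge. Three fixed-point-free involutions act on the set \<open>H\<close> of ends: \<open>\<tau>\<close> exchanges the ends of
an arc of a vertex circle between consecutive segments, \<open>\<alpha>\<close> the ends of a segment, and \<open>\<beta>\<close> the ends of
a free side of an edge. The boundary of \<open>(V, A)\<close> runs alternately along an arc of a vertex and, at each edge,
along the segment if the edge is missing from \<open>A\<close> or along the free side if it belongs to \<open>A\<close>.
Up to the number of isolated vertices, \<open>f(A)\<close> is therefore the number of orbits of \<open>\<tau>\<close>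
together with a matching chosen from \<open>\<alpha>\<close> and \<open>\<beta>\<close> edge by edge, and \<open>k(G)\<close> is the number of orbits of
all three involutions (\<open>num_boundary_components_eq\<close>, \<open>num_components_eq\<close>).

Toggling one edge replaces two matched pairs among its four ends by two other pairs. If the ends lie
on two different boundary cycles, these cycles merge and \<open>f\<close> drops. If for every edge of a set \<open>S\<close> the four
ends lie on one cycle of \<open>A\<close>, toggling all of \<open>S\<close> only refines the partition into cycles, so \<open>f\<close> cannot
drop. Hence \<open>f(B) < f(A)\<close> forces an edge of the symmetric difference of \<open>A\<close> and \<open>B\<close> whose toggling lowers \<open>f(A)\<close>
(\<open>descent_towards\<close>). As toggling raises \<open>f\<close> by at most one, this is the exchange axiom for the sets with \<open>f(A)\<close> at
most \<open>k(G) + n\<close>; comparing with the orbits of all three involutions instead of \<open>B\<close> gives a set with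
\<open>f(A) = k(G)\<close>. In an orientable ribbon graph the ends have a 2-colouring alternating along \<open>\<tau>\<close>, \<open>\<alpha>\<close>
and \<open>\<beta>\<close>, and then toggling an edge never preserves \<open>f\<close>. So \<open>f\<close> changes by exactly one, and the exchange axiom
follows for \<open>f(A) = k(G) + 1\<close> as well (\<open>exchange_eq\<close>).

The topological part translates the surface into these involutions. The boundary of a surface is closed,
so only the interior points of discs, of free arcs and of glued segments have to be classified:
the first and the last are planar (\<open>planar_at_disc\<close>, \<open>seam_point_planar\<close>), the second are not, by invariance of
domain. Orientability enters by way of bands: two disjoint
arcs of a circle that are traversed in opposite senses are joined by a band of disjoint chords of the disc
(\<open>band_of_arcs\<close>). Adding the edges one at a time, either the colouring extends, or bands
across the vertices and edges added before close up with the new edge to a Moebius band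
(\<open>oriented_blocks_insert\<close>).\<close>

section \<open>Classes of a symmetric relation\<close>

definition classes :: "('p \<times> 'p) set \<Rightarrow> 'p set \<Rightarrow> 'p set set" where
  "classes R G = (\<lambda>p. R\<^sup>* `` {p}) ` G"

lemma finite_classes: "finite G \<Longrightarrow> finite (classes R G)"
  by (simp add: classes_def)

lemma classes_coarsen:
  assumes "R' \<subseteq> R\<^sup>*"
  shows "classes R G = (\<lambda>C. R\<^sup>* `` C) ` classes R' G"
proof -
  have "R'\<^sup>* \<subseteq> R\<^sup>*" using assms rtrancl_subset_rtrancl by blast
  then have "R\<^sup>* `` (R'\<^sup>* `` {p}) = R\<^sup>* `` {p}" for p
    by (auto intro: rtrancl_trans)
  then show ?thesis by (simp add: classes_def image_image)
qed

lemma card_classes_antimono: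
  assumes "finite G" "R' \<subseteq> R\<^sup>*"
  shows "card (classes R G) \<le> card (classes R' G)"
  unfolding classes_coarsen[OF assms(2), of G] by (rule card_image_le[OF finite_classes[OF assms(1)]])

lemma rtrancl_join:
  assumes "sym R" "(p, q) \<in> (R \<union> {(x, y), (y, x)})\<^sup>*"
  shows "(p, q) \<in> R\<^sup>* \<or> (p, x) \<in> R\<^sup>* \<and> (y, q) \<in> R\<^sup>* \<or> (p, y) \<in> R\<^sup>* \<and> (x, q) \<in> R\<^sup>*"
  using assms(2)
proof (induction rule: rtrancl_induct)
  case base
  then show ?case by simp
next
  case (step r s)
  have s: "(u, w) \<in> R\<^sup>* \<Longrightarrow> (w, u) \<in> R\<^sup>*" for u w
    using sym_rtrancl[OF \<open>sym R\<close>] by (meson symD)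
  show ?case
  proof (cases "(r, s) \<in> R")
    case True
    then show ?thesis using step.IH by (meson rtrancl.rtrancl_into_rtrancl)
  next
    case False
    then have "r = x \<and> s = y \<or> r = y \<and> s = x" using step.hyps by auto
    then show ?thesis using step.IH by (meson rtrancl.rtrancl_refl rtrancl_trans s)
  qed
qed

text \<open>Joining two points merges the class of the one with that of the other and leaves all further classes
alone, so the map induced on classes is injective once the class of \<open>x\<close> is left out.\<close>

lemma card_classes_join_ge:
  assumes "finite G" "sym R"
  shows "card (classes R G) \<le> card (classes (R \<union> {(x, y), (y, x)}) G) + 1"
proof -
  define J where "J = R \<union> {(x, y), (y, x)}"
  have sy: "(u, w) \<in> R\<^sup>* \<Longrightarrow> (w, u) \<in> R\<^sup>*" for u w
    using sym_rtrancl[OF \<open>sym R\<close>] by (meson symD)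
  have RJ: "R \<subseteq> J\<^sup>*" by (auto simp: J_def)
  have eq: "R\<^sup>* `` {u} = R\<^sup>* `` {w}" if "(u, w) \<in> R\<^sup>*" for u w
    using that sy by (auto intro: rtrancl_trans)
  have RJs: "R\<^sup>* \<subseteq> J\<^sup>*" using RJ rtrancl_subset_rtrancl by blast
  have "inj_on (\<lambda>C. J\<^sup>* `` C) (classes R G - {R\<^sup>* `` {x}})"
  proof (rule inj_onI)
    fix C C' assume C: "C \<in> classes R G - {R\<^sup>* `` {x}}" "C' \<in> classes R G - {R\<^sup>* `` {x}}"
      and e: "J\<^sup>* `` C = J\<^sup>* `` C'"
    obtain p q where p: "C = R\<^sup>* `` {p}" "C' = R\<^sup>* `` {q}" using C by (auto simp: classes_def)
    have "q \<in> J\<^sup>* `` C" unfolding e p(2) by auto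
    then have "(p, q) \<in> J\<^sup>*" unfolding p using RJs by (auto intro: rtrancl_trans)
    then consider "(p, q) \<in> R\<^sup>*" | "(p, x) \<in> R\<^sup>*" | "(x, q) \<in> R\<^sup>*"
      using rtrancl_join[OF assms(2)] unfolding J_def by blast
    then show "C = C'" using C eq p sy by (metis Diff_iff singletonI)
  qed
  moreover have "(\<lambda>C. J\<^sup>* `` C) ` (classes R G - {R\<^sup>* `` {x}}) \<subseteq> classes J G"
    using classes_coarsen[OF RJ, of G] by auto
  ultimately have "card (classes R G - {R\<^sup>* `` {x}}) \<le> card (classes J G)"
    by (rule card_inj_on_le[OF _ _ finite_classes[OF assms(1)]])
  then show ?thesis unfolding J_def[symmetric]
    by (simp add: card_Diff_singleton_if split: if_splits)
qed

lemma card_classes_join_less: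
  assumes "finite G" "x \<in> G" "y \<in> G" "(x, y) \<notin> R\<^sup>*"
  shows "card (classes (R \<union> {(x, y), (y, x)}) G) < card (classes R G)"
proof -
  define J where "J = R \<union> {(x, y), (y, x)}"
  have RJ: "R \<subseteq> J\<^sup>*" by (auto simp: J_def)
  have RJs: "R\<^sup>* \<subseteq> J\<^sup>*" using RJ rtrancl_subset_rtrancl by blast
  have xy: "(x, y) \<in> J\<^sup>*" "(y, x) \<in> J\<^sup>*" by (auto simp: J_def)
  have cl: "J\<^sup>* `` (R\<^sup>* `` {u}) = J\<^sup>* `` {u}" for u using RJs by (auto intro: rtrancl_trans)
  have "J\<^sup>* `` (R\<^sup>* `` {x}) = J\<^sup>* `` (R\<^sup>* `` {y})"
    unfolding cl using xy by (auto intro: rtrancl_trans)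
  moreover have "R\<^sup>* `` {x} \<noteq> R\<^sup>* `` {y}" using assms(4) by auto
  ultimately have "\<not> inj_on (\<lambda>C. J\<^sup>* `` C) (classes R G)"
    using assms(2,3) unfolding classes_def inj_on_def by blast
  then have "card ((\<lambda>C. J\<^sup>* `` C) ` classes R G) \<noteq> card (classes R G)"
    using eq_card_imp_inj_on[OF finite_classes[OF assms(1)]] by blast
  then show ?thesis unfolding J_def[symmetric] classes_coarsen[OF RJ, of G]
    using card_image_le[OF finite_classes[OF assms(1)]] le_neq_implies_less by blast
qed

lemma even_card_involution:
  assumes "finite C" "\<And>x. x \<in> C \<Longrightarrow> f x \<in> C \<and> f (f x) = x \<and> f x \<noteq> x"
  shows "even (card C)"
  using assms
proof (induction C rule: finite_psubset_induct)
  case (psubset C)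
  show ?case
  proof (cases "C = {}")
    case False
    then obtain x where x: "x \<in> C" by auto
    let ?D = "C - {x, f x}"
    have "f y \<in> ?D \<and> f (f y) = y \<and> f y \<noteq> y" if "y \<in> ?D" for y
    proof -
      have y: "f y \<in> C" "f (f y) = y" "f y \<noteq> y" "y \<noteq> x" "y \<noteq> f x"
        using that psubset.prems[of y] by auto
      then have "f y \<noteq> x" "f y \<noteq> f x" using psubset.prems[OF x] by metis+
      then show ?thesis using y by simp
    qed
    moreover have "?D \<subset> C" using x by auto
    ultimately have "even (card ?D)" using psubset.IH by blast
    moreover have "card C = card ?D + 2"
      using psubset.prems[OF x] x card_Diff_subset[of "{x, f x}" C] psubset.hyps
        card_mono[of C "{x, f x}"] by (auto simp: card_insert_if)
    ultimately show ?thesis by simp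
  qed simp
qed

text \<open>In an orbit of the group generated by two involutions, at most two points are fixed by a given one of
them. With \<open>s = t \<circ> m\<close> and \<open>m x = x\<close> the orbit consists of the iterates \<open>s\<^sup>k x\<close>, and \<open>m\<close> maps \<open>s\<^sup>k x\<close> to the
iterate with exponent \<open>-k\<close>; if that is the same point, then \<open>2 k\<close> is a multiple of the period, so \<open>k\<close> is \<open>0\<close> or half
the period.\<close>

lemma dihedral_orbit_fixed:
  assumes fin: "finite H"
    and t: "\<And>x. x \<in> H \<Longrightarrow> t x \<in> H \<and> t (t x) = x"
    and m: "\<And>x. x \<in> H \<Longrightarrow> m x \<in> H \<and> m (m x) = x"
    and x: "x \<in> H" "m x = x"
    and y: "(x, y) \<in> ({(p, t p) |p. p \<in> H} \<union> {(p, m p) |p. p \<in> H})\<^sup>*" "m y = y" "y \<noteq> x"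
    and z: "(x, z) \<in> ({(p, t p) |p. p \<in> H} \<union> {(p, m p) |p. p \<in> H})\<^sup>*" "m z = z" "z \<noteq> x"
  shows "y = z"
proof -
  define s where "s = (\<lambda>p. t (m p))"
  have sH: "(s ^^ k) p \<in> H" if "p \<in> H" for k p
    by (induction k) (use that t m in \<open>auto simp: s_def\<close>)
  have inj: "inj_on s H" by (rule inj_onI) (metis s_def t m)
  have injk: "inj_on (s ^^ k) H" for k
  proof (induction k)
    case (Suc k)
    have "(s ^^ k) ` H \<subseteq> H" using sH by blast
    then have "inj_on (s \<circ> (s ^^ k)) H" by (intro comp_inj_on Suc.IH inj_on_subset[OF inj])
    then show ?case by (simp add: comp_def)
  qed simp
  obtain n where n: "n > 0" "(s ^^ n) x = x"
  proof -
    have "\<not> inj (\<lambda>k::nat. (s ^^ k) x)"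
    proof
      assume "inj (\<lambda>k::nat. (s ^^ k) x)"
      then have "infinite (range (\<lambda>k::nat. (s ^^ k) x))" using finite_imageD infinite_UNIV_nat by blast
      moreover have "range (\<lambda>k::nat. (s ^^ k) x) \<subseteq> H" using sH[OF x(1)] by blast
      ultimately show False using fin finite_subset by blast
    qed
    then obtain i j where ij: "i < j" "(s ^^ i) x = (s ^^ j) x"
      unfolding inj_on_def by (metis linorder_neqE_nat)
    have "(s ^^ i) ((s ^^ (j - i)) x) = (s ^^ j) x"
      using ij by (metis add_diff_inverse_nat comp_apply funpow_add less_imp_le_nat not_less)
    then have "(s ^^ (j - i)) x = x"
      using injk[of i] sH[OF x(1)] ij x(1) unfolding inj_on_def by metis
    then show ?thesis using that[of "j - i"] ij by simp
  qed
  define N where "N = (LEAST n. n > 0 \<and> (s ^^ n) x = x)"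
  have N: "N > 0" "(s ^^ N) x = x"
    unfolding N_def using LeastI[of "\<lambda>n. n > 0 \<and> (s ^^ n) x = x" n] n by auto
  have Nmin: "N \<le> k" if "k > 0" "(s ^^ k) x = x" for k
    unfolding N_def using Least_le[of "\<lambda>n. n > 0 \<and> (s ^^ n) x = x" k] that by auto
  \<comment> \<open>\<open>m\<close> conjugates \<open>s\<close> into its inverse and fixes \<open>x\<close>.\<close>
  have conj: "(s ^^ k) (m ((s ^^ k) x)) = x" for k
  proof (induction k)
    case (Suc k)
    have "(s ^^ Suc k) (m ((s ^^ Suc k) x)) = (s ^^ k) (s (m (s ((s ^^ k) x))))"
      by (metis comp_apply funpow_Suc_right funpow.simps(2))
    also have "s (m (s ((s ^^ k) x))) = m ((s ^^ k) x)"
      unfolding s_def using t m sH[OF x(1), of k] s_def by metis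
    finally show ?case using Suc by simp
  qed (use x in simp)
  have orb: "\<exists>k<N. w = (s ^^ k) x"
    if "(x, w) \<in> ({(p, t p) |p. p \<in> H} \<union> {(p, m p) |p. p \<in> H})\<^sup>*" for w
    using that
  proof (induction rule: rtrancl_induct)
    case base
    then show ?case using N by (intro exI[of _ 0]) auto
  next
    case (step a b)
    then obtain k where k: "k < N" "a = (s ^^ k) x" by auto
    have inv: "\<exists>l<N. m ((s ^^ k) x) = (s ^^ l) x" if "k < N" for k
    proof -
      have "(s ^^ k) ((s ^^ (N - k)) x) = x"
        using N that by (metis add_diff_inverse_nat comp_apply funpow_add less_imp_le_nat not_less)
      then have *: "m ((s ^^ k) x) = (s ^^ (N - k)) x"
        using conj[of k] injk[of k] sH[OF x(1)] m unfolding inj_on_def by metis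
      show ?thesis
      proof (cases "k = 0")
        case True
        then show ?thesis using N x by auto
      next
        case False
        then show ?thesis using * N that by (intro exI[of _ "N - k"]) auto
      qed
    qed
    have nx: "\<exists>l<N. s ((s ^^ k) x) = (s ^^ l) x" if "k < N" for k
    proof (cases "Suc k = N")
      case True
      then have "s ((s ^^ k) x) = (s ^^ 0) x" using N(2) by auto
      then show ?thesis using N by blast
    next
      case False
      then show ?thesis using that by (intro exI[of _ "Suc k"]) auto
    qed
    from step.hyps consider "b = t a" "a \<in> H" | "b = m a" by auto
    then show ?case
    proof cases
      case 1
      then have "b = s (m a)" unfolding s_def using m by auto
      then show ?thesis using inv[OF k(1)] nx k(2) by metis
    next
      case 2
      then show ?thesis using inv[OF k(1)] k(2) by metis
    qed
  qed
  have half: "2 * k = N" if "k < N" "m ((s ^^ k) x) = (s ^^ k) x" "(s ^^ k) x \<noteq> x" for k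
  proof -
    have k0: "k > 0" using that(3) by (cases k) auto
    have d: "(s ^^ (2 * k)) x = x"
      using conj[of k] that(2) by (metis comp_apply funpow_add mult_2)
    then have "N \<le> 2 * k" using Nmin k0 by simp
    moreover have "\<not> N < 2 * k"
    proof
      assume l: "N < 2 * k"
      have "(s ^^ (2 * k - N)) ((s ^^ N) x) = (s ^^ (2 * k)) x"
        using l by (metis comp_apply funpow_add le_add_diff_inverse2 less_imp_le_nat)
      then have "(s ^^ (2 * k - N)) x = x" using d N by simp
      then show False using Nmin[of "2 * k - N"] l that(1) by simp
    qed
    ultimately show ?thesis by simp
  qed
  obtain k l where "k < N" "y = (s ^^ k) x" "l < N" "z = (s ^^ l) x" using orb y(1) z(1) by blast
  then have "2 * k = N" "2 * l = N" using half y z by auto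
  then show ?thesis using \<open>y = _\<close> \<open>z = _\<close> by auto
qed


section \<open>Switching two pairs of a matching\<close>

definition matched :: "'p set \<Rightarrow> ('p \<Rightarrow> 'p) \<Rightarrow> ('p \<times> 'p) set" where
  "matched H m = {(x, m x) |x. x \<in> H}"

definition matching_on :: "'p set \<Rightarrow> ('p \<Rightarrow> 'p) \<Rightarrow> bool" where
  "matching_on H m \<longleftrightarrow> (\<forall>x\<in>H. m x \<in> H \<and> m (m x) = x \<and> m x \<noteq> x)"

lemma matching_onD:
  assumes "matching_on H m" "x \<in> H"
  shows "m x \<in> H" "m (m x) = x" "m x \<noteq> x"
  using assms by (auto simp: matching_on_def)

lemma sym_matched: "matching_on H m \<Longrightarrow> sym (matched H m)"
  by (rule symI) (auto simp: matching_on_def matched_def)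

lemma sym_rtranclD: "sym R \<Longrightarrow> (x, y) \<in> R\<^sup>* \<Longrightarrow> (y, x) \<in> R\<^sup>*"
  by (meson sym_rtrancl symD)

lemma rtrancl_stays:
  assumes "(x, y) \<in> R\<^sup>*" "x \<in> H" "R \<subseteq> H \<times> H" shows "y \<in> H"
  using assms by (induction rule: rtrancl_induct) auto

text \<open>The pairs \<open>x1 x2\<close> and \<open>y1 y2\<close> of the matching \<open>m\<close> are replaced in \<open>m'\<close> by \<open>x1 y1\<close> and \<open>x2 y2\<close>. Together
with \<open>t\<close>, each matching cuts \<open>H\<close> into cycles. The set \<open>G\<close> may have further points, which are classes of their own. The
situation is symmetric in \<open>m\<close> and \<open>m'\<close>, with \<open>x2\<close> and \<open>y1\<close> exchanged.\<close>

locale matching_switch =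
  fixes H G :: "'p set" and t m m' :: "'p \<Rightarrow> 'p" and x1 x2 y1 y2 :: 'p
  assumes fin: "finite G" and HG: "H \<subseteq> G"
    and t: "matching_on H t" and m: "matching_on H m" and m': "matching_on H m'"
    and x1: "x1 \<in> H" and y: "x2 = m x1" "y1 = m' x1" "y2 = m y1" "y2 = m' x2"
    and ne: "x2 \<noteq> y1"
    and agree: "\<And>x. x \<in> H \<Longrightarrow> x \<notin> {x1, x2, y1, y2} \<Longrightarrow> m x = m' x"
begin

lemma inH: "x1 \<in> H" "x2 \<in> H" "y1 \<in> H" "y2 \<in> H"
  using x1 y matching_onD[OF m] matching_onD[OF m'] by auto

lemma dist: "distinct [x1, x2, y1, y2]"
  using x1 y ne matching_onD[OF m] matching_onD[OF m'] inH by (metis distinct_length_2_or_more distinct_singleton)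

lemma vals: "m x1 = x2" "m x2 = x1" "m y1 = y2" "m y2 = y1"
  "m' x1 = y1" "m' y1 = x1" "m' x2 = y2" "m' y2 = x2"
  using y matching_onD[OF m] matching_onD[OF m'] inH by metis+

lemma swapped: "matching_switch H G t m' m x1 y1 x2 y2"
  using fin HG t m m' x1 vals ne agree by unfold_locales auto

definition "R = matched H t \<union> matched H m"
definition "R' = matched H t \<union> matched H m'"
definition "R0 = matched H t \<union> matched (H - {x1, x2, y1, y2}) m"

lemma symR': "sym R'" using sym_matched t m' by (auto simp: R'_def intro: sym_Un)

lemma stable: "x \<in> H - {x1, x2, y1, y2} \<Longrightarrow> m x \<in> H - {x1, x2, y1, y2}"
  using vals matching_onD[OF m] by (metis Diff_iff empty_iff insert_iff)

lemma symR0: "sym R0"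
proof -
  have "matching_on (H - {x1, x2, y1, y2}) m"
    using stable matching_onD[OF m] by (auto simp: matching_on_def)
  then show ?thesis using sym_matched t by (auto simp: R0_def intro: sym_Un)
qed

lemma R_eq: "R = R0 \<union> {(x1, x2), (x2, x1), (y1, y2), (y2, y1)}"
  using inH vals by (auto simp: R_def R0_def matched_def)

lemma R'_eq: "R' = R0 \<union> {(x1, y1), (y1, x1), (x2, y2), (y2, x2)}"
proof -
  have *: "matched (H - {x1, x2, y1, y2}) m = matched (H - {x1, x2, y1, y2}) m'"
    unfolding matched_def using agree by auto
  show ?thesis
    unfolding R'_def R0_def * using inH vals by (auto simp: matched_def)
qed

text \<open>Once \<open>x1\<close> and \<open>x2\<close> are joined, \<open>R'\<close> connects all four points and so is coarser than \<open>R\<close>.\<close>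

lemma card_le_Suc: "card (classes R' G) \<le> card (classes R G) + 1"
proof -
  let ?J = "R' \<union> {(x1, x2), (x2, x1)}"
  have "(y1, x1) \<in> ?J" "(x1, x2) \<in> ?J" "(x2, y2) \<in> ?J" by (auto simp: R'_eq)
  then have a: "(y1, y2) \<in> ?J\<^sup>*" by (meson r_into_rtrancl rtrancl_trans)
  have "sym ?J" using symR' by (auto simp: sym_def)
  then have "(y2, y1) \<in> ?J\<^sup>*" using a sym_rtranclD by fast
  then have "R \<subseteq> ?J\<^sup>*" using a by (auto simp: R_eq R'_eq)
  then have "card (classes ?J G) \<le> card (classes R G)"
    by (rule card_classes_antimono[OF fin])
  then show ?thesis using card_classes_join_ge[OF fin symR', of x1 x2] by linarith
qed

text \<open>What is left of a cycle when the pairs at the four points are removed: the strands ending in these points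
are paths.\<close>

definition "strand x = R0\<^sup>* `` {x}"

lemma strand_sub: "x \<in> H \<Longrightarrow> strand x \<subseteq> H"
proof -
  have "R0 \<subseteq> H \<times> H" using t stable by (auto simp: R0_def matched_def matching_on_def)
  then show "x \<in> H \<Longrightarrow> strand x \<subseteq> H" using rtrancl_stays by (fastforce simp: strand_def)
qed

lemma fin_strand: "x \<in> H \<Longrightarrow> finite (strand x)"
  using strand_sub finite_subset[OF HG fin] finite_subset by blast

lemma strand_t: "x \<in> H \<Longrightarrow> z \<in> strand x \<Longrightarrow> t z \<in> strand x"
  using strand_sub[of x] by (auto simp: strand_def R0_def matched_def intro: rtrancl.rtrancl_into_rtrancl)

lemma strand_m: "x \<in> H \<Longrightarrow> z \<in> strand x - {x1, x2, y1, y2} \<Longrightarrow> m z \<in> strand x - {x1, x2, y1, y2}"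
  using strand_sub[of x] stable[of z]
  by (auto simp: strand_def R0_def matched_def intro: rtrancl.rtrancl_into_rtrancl)

text \<open>The matching \<open>t\<close> pairs all points of a strand and \<open>m\<close> all but those among the four.\<close>

lemma even_ends:
  assumes "x \<in> H" shows "even (card (strand x \<inter> {x1, x2, y1, y2}))"
proof -
  let ?Q = "{x1, x2, y1, y2}"
  have "even (card (strand x))"
    using strand_t[OF assms] matching_onD[OF t] strand_sub[OF assms]
    by (intro even_card_involution[of _ t] fin_strand assms) auto
  moreover have "even (card (strand x - ?Q))"
    using strand_m[OF assms] matching_onD[OF m] strand_sub[OF assms]
    by (intro even_card_involution[of _ m] finite_Diff fin_strand assms) blast
  moreover have "card (strand x) = card (strand x - ?Q) + card (strand x \<inter> ?Q)"
    using fin_strand[OF assms] by (metis add.commute card_Int_Diff)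
  ultimately show ?thesis by simp
qed

lemma self_strand: "x \<in> strand x" by (simp add: strand_def)

lemma R0_sub: "R0 \<subseteq> R" "R0 \<subseteq> R'" by (auto simp: R_eq R'_eq)

lemma R0_subs: "R0\<^sup>* \<subseteq> R\<^sup>*" "R0\<^sup>* \<subseteq> R'\<^sup>*"
  using R0_sub rtrancl_mono by blast+

lemma strand_sym: "x \<in> strand z \<longleftrightarrow> z \<in> strand x"
  using symR0 sym_rtranclD by (fastforce simp: strand_def)

lemma strand_trans: "x \<in> strand z \<Longrightarrow> z \<in> strand w \<Longrightarrow> x \<in> strand w"
  by (auto simp: strand_def)

lemma another_end:
  assumes "x \<in> {x1, x2, y1, y2}" shows "\<exists>y\<in>{x1, x2, y1, y2} - {x}. y \<in> strand x"
proof (rule ccontr)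
  assume "\<not> ?thesis"
  then have "strand x \<inter> {x1, x2, y1, y2} = {x}" using assms self_strand by auto
  moreover have "x \<in> H" using assms inH by auto
  ultimately show False using even_ends[of x] by simp
qed

lemma pair_of_not_joined:
  assumes "(x1, y1) \<notin> R\<^sup>*"
  shows "(x1, x2) \<in> R0\<^sup>*" "(y1, y2) \<in> R0\<^sup>*"
proof -
  have s: "(x1, x2) \<in> R" "(y1, y2) \<in> R" "(x2, x1) \<in> R" "(y2, y1) \<in> R" by (auto simp: R_eq)
  have n: "(u, w) \<notin> R0\<^sup>*" "(w, u) \<notin> R0\<^sup>*" if "u \<in> {x1, x2}" "w \<in> {y1, y2}" for u w
  proof -
    show "(u, w) \<notin> R0\<^sup>*"
    proof
      assume "(u, w) \<in> R0\<^sup>*"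
      then have "(u, w) \<in> R\<^sup>*" using R0_subs by auto
      moreover have "(x1, u) \<in> R\<^sup>*" "(w, y1) \<in> R\<^sup>*" using that s by auto
      ultimately show False using assms by (meson rtrancl_trans)
    qed
    then show "(w, u) \<notin> R0\<^sup>*" using symR0 sym_rtranclD by fast
  qed
  show "(x1, x2) \<in> R0\<^sup>*" using another_end[of x1] n[of x1 y1] n[of x1 y2] by (auto simp: strand_def)
  show "(y1, y2) \<in> R0\<^sup>*" using another_end[of y1] n[of x1 y1] n[of x2 y1] by (auto simp: strand_def)
qed

text \<open>If \<open>x1\<close> and \<open>y1\<close> lie on different cycles, then by parity the strand from \<open>x1\<close> must end in \<open>x2\<close> and that
from \<open>y1\<close> in \<open>y2\<close>. The new pairs join these strands to one cycle.\<close>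

lemma card_less:
  assumes "(x1, y1) \<notin> R\<^sup>*"
  shows "card (classes R' G) < card (classes R G)"
proof -
  note p = pair_of_not_joined[OF assms]
  have "(x2, x1) \<in> R0\<^sup>*" "(y2, y1) \<in> R0\<^sup>*" using p symR0 sym_rtranclD by fast+
  then have "{(x1, x2), (x2, x1), (y1, y2), (y2, y1)} \<subseteq> R'\<^sup>*"
    using p R0_subs(2) by blast
  moreover have "R0 \<subseteq> R'\<^sup>*" using R0_sub by blast
  moreover have "{(x1, y1), (y1, x1)} \<subseteq> R'\<^sup>*" by (auto simp: R'_eq)
  ultimately have "R \<union> {(x1, y1), (y1, x1)} \<subseteq> R'\<^sup>*" unfolding R_eq by blast
  then have "card (classes R' G) \<le> card (classes (R \<union> {(x1, y1), (y1, x1)}) G)"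
    by (rule card_classes_antimono[OF fin])
  also have "\<dots> < card (classes R G)"
    using card_classes_join_less[OF fin _ _ assms] inH HG by blast
  finally show ?thesis .
qed

lemma at_most_two_ends:
  assumes "x \<in> {x1, x2, y1, y2}" "y \<in> {x1, x2, y1, y2} - {x}" "z \<in> {x1, x2, y1, y2} - {x}"
    "y \<in> strand x" "z \<in> strand x"
  shows "y = z"
proof -
  define m0 where "m0 = (\<lambda>z. if z \<in> {x1, x2, y1, y2} then z else m z)"
  have "R0 \<subseteq> {(p, t p) |p. p \<in> H} \<union> {(p, m0 p) |p. p \<in> H}"
    by (auto simp: R0_def matched_def m0_def)
  then have "R0\<^sup>* \<subseteq> ({(p, t p) |p. p \<in> H} \<union> {(p, m0 p) |p. p \<in> H})\<^sup>*" by (rule rtrancl_mono)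
  then have "(x, y) \<in> ({(p, t p) |p. p \<in> H} \<union> {(p, m0 p) |p. p \<in> H})\<^sup>*"
    "(x, z) \<in> ({(p, t p) |p. p \<in> H} \<union> {(p, m0 p) |p. p \<in> H})\<^sup>*"
    using assms(4,5) by (auto simp only: strand_def)
  moreover have "m0 z \<in> H \<and> m0 (m0 z) = z" if "z \<in> H" for z
  proof (cases "z \<in> {x1, x2, y1, y2}")
    case False
    then have "m z \<in> H - {x1, x2, y1, y2}" using stable[of z] that by blast
    then show ?thesis using False matching_onD[OF m that] unfolding m0_def by auto
  qed (use that in \<open>auto simp: m0_def\<close>)
  moreover have "m0 x = x" "m0 y = y" "m0 z = z" "x \<in> H" "y \<noteq> x" "z \<noteq> x"
    using assms inH by (auto simp: m0_def)
  ultimately show ?thesis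
    using dihedral_orbit_fixed[of H t m0 x y z] finite_subset[OF HG fin] matching_onD[OF t] by blast
qed

text \<open>Both matchings exchange the colours, on the strand and on the strand without its ends respectively.\<close>

lemma balanced_ends:
  fixes c :: "'p \<Rightarrow> bool"
  assumes "x \<in> H" and ct: "\<And>z. z \<in> H \<Longrightarrow> c (t z) \<noteq> c z" and cm: "\<And>z. z \<in> H \<Longrightarrow> c (m z) \<noteq> c z"
  shows "card {z \<in> strand x \<inter> {x1, x2, y1, y2}. c z} = card {z \<in> strand x \<inter> {x1, x2, y1, y2}. \<not> c z}"
proof -
  let ?Q = "{x1, x2, y1, y2}" and ?C = "strand x"
  note sub = strand_sub[OF assms(1)] and fc = fin_strand[OF assms(1)]
  have "bij_betw t {z \<in> ?C. c z} {z \<in> ?C. \<not> c z}"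
    using strand_t[OF assms(1)] matching_onD[OF t] sub ct
    by (intro bij_betw_byWitness[where f' = t]) (auto simp: subset_iff)
  then have 1: "card {z \<in> ?C. c z} = card {z \<in> ?C. \<not> c z}" by (rule bij_betw_same_card)
  have "bij_betw m {z \<in> ?C - ?Q. c z} {z \<in> ?C - ?Q. \<not> c z}"
  proof (intro bij_betw_byWitness[where f' = m])
    show "\<forall>a\<in>{z \<in> ?C - ?Q. c z}. m (m a) = a" "\<forall>a\<in>{z \<in> ?C - ?Q. \<not> c z}. m (m a) = a"
      using matching_onD[OF m] sub by blast+
    show "m ` {z \<in> ?C - ?Q. c z} \<subseteq> {z \<in> ?C - ?Q. \<not> c z}"
      "m ` {z \<in> ?C - ?Q. \<not> c z} \<subseteq> {z \<in> ?C - ?Q. c z}"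
      using strand_m[OF assms(1)] cm sub by blast+
  qed
  then have 2: "card {z \<in> ?C - ?Q. c z} = card {z \<in> ?C - ?Q. \<not> c z}" by (rule bij_betw_same_card)
  have split: "card {z \<in> ?C. P z} = card {z \<in> ?C - ?Q. P z} + card {z \<in> ?C \<inter> ?Q. P z}" for P
  proof -
    have eq: "{z \<in> ?C. P z} = {z \<in> ?C - ?Q. P z} \<union> {z \<in> ?C \<inter> ?Q. P z}" by blast
    show ?thesis unfolding eq using fc by (intro card_Un_disjoint) auto
  qed
  show ?thesis using 1 2 split[of c] split[of "\<lambda>z. \<not> c z"] by linarith
qed

text \<open>The only way for the number of cycles to stay the same is that all four points lie on one cycle before
and after the switch. The strands then cannot join \<open>x1\<close> to \<open>x2\<close> or to \<open>y1\<close>, so one of them joins \<open>x1\<close> to \<open>y2\<close>; but these points have the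
same colour, whereas the two ends of a strand are coloured differently.\<close>

lemma card_neq:
  fixes c :: "'p \<Rightarrow> bool"
  assumes ct: "\<And>z. z \<in> H \<Longrightarrow> c (t z) \<noteq> c z"
    and cm: "\<And>z. z \<in> H \<Longrightarrow> c (m z) \<noteq> c z" and cm': "\<And>z. z \<in> H \<Longrightarrow> c (m' z) \<noteq> c z"
  shows "card (classes R' G) \<noteq> card (classes R G)"
proof (cases "(x1, y1) \<in> R\<^sup>* \<and> (x1, x2) \<in> R'\<^sup>*")
  case False
  interpret S: matching_switch H G t m' m x1 y1 x2 y2 by (rule swapped)
  have "S.R = R'" "S.R' = R" by (auto simp: S.R_def S.R'_def R_def R'_def)
  then show ?thesis using False card_less S.card_less by (metis less_irrefl)
next
  case True
  obtain z where z: "z \<in> {x2, y1, y2}" "z \<in> strand x1" using another_end[of x1] dist by auto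
  have only: "w = z" if "w \<in> {x2, y1, y2}" "w \<in> strand x1" for w
    using at_most_two_ends[of x1 w z] that z dist by auto
  have col: "c x1 \<noteq> c x2" "c y1 \<noteq> c y2" "c x1 \<noteq> c y1" "c x2 \<noteq> c y2"
    using cm cm' vals inH by metis+
  have "z \<noteq> y2"
  proof
    assume "z = y2"
    then have "strand x1 \<inter> {x1, x2, y1, y2} = {x1, y2}" using only z self_strand dist by auto
    moreover have "c y2 = c x1" using col by auto
    ultimately have "{z \<in> strand x1 \<inter> {x1, x2, y1, y2}. c z} = (if c x1 then {x1, y2} else {})"
      "{z \<in> strand x1 \<inter> {x1, x2, y1, y2}. \<not> c z} = (if c x1 then {} else {x1, y2})"
      by auto
    then show False using balanced_ends[where c = c, OF inH(1) ct cm] dist by (auto split: if_splits)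
  qed
  then consider "z = x2" | "z = y1" using z by blast
  then have False
  proof cases
    case 1
    have 2: "(y1, y2) \<in> R0\<^sup>*"
    proof -
      obtain w where w: "w \<in> {x1, x2, y2}" "w \<in> strand y1" using another_end[of y1] dist by auto
      then have "w = y2" using 1 only[of y1] z strand_sym strand_trans dist
        by (metis insertE insertI1 insertI2 singletonD distinct_length_2_or_more)
      then show ?thesis using w by (simp add: strand_def)
    qed
    have "R \<subseteq> R0\<^sup>*"
    proof -
      have "(x1, x2) \<in> R0\<^sup>*" using 1 z by (simp add: strand_def)
      then show ?thesis unfolding R_eq using 2 symR0 sym_rtranclD by fastforce
    qed
    then have "(x1, y1) \<in> R0\<^sup>*" using True rtrancl_subset_rtrancl by blast
    then show False using 1 only[of y1] dist by (auto simp: strand_def)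
  next
    case 2
    have 3: "(x2, y2) \<in> R0\<^sup>*"
    proof -
      obtain w where w: "w \<in> {x1, y1, y2}" "w \<in> strand x2" using another_end[of x2] dist by auto
      then have "w = y2" using 2 only[of x2] z strand_sym strand_trans dist
        by (metis insertE insertI1 insertI2 singletonD distinct_length_2_or_more)
      then show ?thesis using w by (simp add: strand_def)
    qed
    have "R' \<subseteq> R0\<^sup>*"
    proof -
      have "(x1, y1) \<in> R0\<^sup>*" using 2 z by (simp add: strand_def)
      then show ?thesis unfolding R'_eq using 3 symR0 sym_rtranclD by fastforce
    qed
    then have "(x1, x2) \<in> R0\<^sup>*" using True rtrancl_subset_rtrancl by blast
    then show False using 2 only[of x2] dist by (auto simp: strand_def)
  qed
  then show ?thesis ..
qed

end

section \<open>Toggling edges in a system of three matchings\<close>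

locale edge_matchings =
  fixes H G :: "'p set" and t a b :: "'p \<Rightarrow> 'p" and \<epsilon> :: "'p \<Rightarrow> 'e"
  assumes fin: "finite G" and HG: "H \<subseteq> G"
    and t: "matching_on H t" and a: "matching_on H a" and b: "matching_on H b"
    and ends: "\<And>x. x \<in> H \<Longrightarrow> \<epsilon> (a x) = \<epsilon> x" "\<And>x. x \<in> H \<Longrightarrow> \<epsilon> (b x) = \<epsilon> x"
    and comm: "\<And>x. x \<in> H \<Longrightarrow> b (a x) = a (b x)"
    and ne: "\<And>x. x \<in> H \<Longrightarrow> a x \<noteq> b x"
    and four: "\<And>x y. x \<in> H \<Longrightarrow> y \<in> H \<Longrightarrow> \<epsilon> x = \<epsilon> y \<Longrightarrow> y \<in> {x, a x, b x, a (b x)}"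
begin

definition "mate A x = (if \<epsilon> x \<in> A then b x else a x)"
definition "link A = matched H t \<union> matched H (mate A)"
definition "full_link = matched H t \<union> matched H a \<union> matched H b"
definition "cycles A = card (classes (link A) G)"
definition "num_parts = card (classes full_link G)"

lemma mate: "matching_on H (mate A)"
  using matching_onD[OF a] matching_onD[OF b] ends by (auto simp: matching_on_def mate_def)

lemma toggle_switch:
  assumes p: "p \<in> H"
  shows "matching_switch H G t (mate A) (mate (sym_diff A {\<epsilon> p}))
     p (mate A p) (mate (sym_diff A {\<epsilon> p}) p) (mate A (mate (sym_diff A {\<epsilon> p}) p))"
proof (unfold_locales, goal_cases)
  case (12 x)
  then have "\<epsilon> x \<noteq> \<epsilon> p"
    using four[OF p 12(1)] ends[OF p] comm[OF p] ends(1)[OF matching_onD(1)[OF b p]]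
    by (auto simp: mate_def split: if_splits)
  then show ?case by (auto simp: mate_def)
next
  case 10
  then show ?case using ends p comm[OF p] matching_onD(1)[OF a p] matching_onD(1)[OF b p] by (auto simp: mate_def)
next
  case 11
  then show ?case using ends p ne[OF p] by (auto simp: mate_def)
qed (use fin HG t mate p ends in \<open>auto simp: mate_def\<close>)

lemma switch_links:
  assumes "p \<in> H"
  shows "matching_switch.R H t (mate A) = link A"
    "matching_switch.R' H t (mate (sym_diff A {\<epsilon> p})) = link (sym_diff A {\<epsilon> p})"
  using matching_switch.R_def[OF toggle_switch[OF assms, of A]]
    matching_switch.R'_def[OF toggle_switch[OF assms, of A]] by (auto simp: link_def)

lemma cycles_toggle_le: "e \<in> \<epsilon> ` H \<Longrightarrow> cycles (sym_diff A {e}) \<le> cycles A + 1"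
  using matching_switch.card_le_Suc[OF toggle_switch] by (auto simp: switch_links cycles_def)

lemma cycles_toggle_ge:
  assumes "e \<in> \<epsilon> ` H" shows "cycles A \<le> cycles (sym_diff A {e}) + 1"
proof -
  have "sym_diff (sym_diff A {e}) {e} = A" by auto
  then show ?thesis using cycles_toggle_le[OF assms, of "sym_diff A {e}"] by simp
qed

lemma cycles_toggle_neq:
  assumes "e \<in> \<epsilon> ` H"
    and "\<And>x. x \<in> H \<Longrightarrow> c (t x) \<noteq> c x" "\<And>x. x \<in> H \<Longrightarrow> c (a x) \<noteq> c x" "\<And>x. x \<in> H \<Longrightarrow> c (b x) \<noteq> (c x :: bool)"
  shows "cycles (sym_diff A {e}) \<noteq> cycles A"
proof -
  obtain p where p: "p \<in> H" "e = \<epsilon> p" using assms by auto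
  have "c (mate B x) \<noteq> c x" if "x \<in> H" for x B using that assms by (auto simp: mate_def)
  then show ?thesis
    using matching_switch.card_neq[OF toggle_switch[OF p(1), of A], of c] assms(2)
    by (auto simp: switch_links[OF p(1)] cycles_def p(2))
qed

text \<open>Ends of the edge on different cycles would be merged by the switch (\<open>card_less\<close>).\<close>

lemma joined_if_no_descent:
  assumes p: "p \<in> H" and "\<not> cycles (sym_diff A {\<epsilon> p}) < cycles A"
  shows "(p, a p) \<in> (link A)\<^sup>*" "(p, b p) \<in> (link A)\<^sup>*"
proof -
  have "(p, mate (sym_diff A {\<epsilon> p}) p) \<in> (link A)\<^sup>*"
    using matching_switch.card_less[OF toggle_switch[OF p, of A]] assms(2)
    by (auto simp: switch_links[OF p] cycles_def)
  moreover have "(p, mate A p) \<in> (link A)\<^sup>*" using p by (auto simp: link_def matched_def)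
  ultimately show "(p, a p) \<in> (link A)\<^sup>*" "(p, b p) \<in> (link A)\<^sup>*" by (auto simp: mate_def split: if_splits)
qed

lemma t_link: "x \<in> H \<Longrightarrow> (x, t x) \<in> (link A)\<^sup>*"
  by (auto simp: link_def matched_def)

text \<open>If no such edge existed, every pair of ends matched for \<open>B\<close> would lie on one cycle for \<open>A\<close>, so that
the partition for \<open>B\<close> would refine the one for \<open>A\<close>.\<close>

lemma descent_towards:
  assumes "cycles B < cycles A"
  shows "\<exists>v \<in> sym_diff A B \<inter> \<epsilon> ` H. cycles (sym_diff A {v}) < cycles A"
proof (rule ccontr)
  assume no: "\<not> ?thesis"
  have "(x, mate B x) \<in> (link A)\<^sup>*" if x: "x \<in> H" for x
  proof (cases "\<epsilon> x \<in> sym_diff A B")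
    case True
    then have "(x, a x) \<in> (link A)\<^sup>*" "(x, b x) \<in> (link A)\<^sup>*" using joined_if_no_descent[OF x] no x by blast+
    then show ?thesis by (auto simp: mate_def)
  next
    case False
    then have "mate B x = mate A x" by (auto simp: mate_def)
    then show ?thesis using x by (auto simp: link_def matched_def)
  qed
  then have "link B \<subseteq> (link A)\<^sup>*" using t_link by (auto simp: link_def[of B] matched_def)
  then show False using card_classes_antimono[OF fin, of "link B" "link A"] assms by (simp add: cycles_def)
qed

lemma num_parts_le: "num_parts \<le> cycles A"
proof -
  have "link A \<subseteq> full_link" by (auto simp: link_def full_link_def matched_def mate_def)
  then have "link A \<subseteq> full_link\<^sup>*" by auto
  then show ?thesis unfolding num_parts_def cycles_def by (rule card_classes_antimono[OF fin])
qed

lemma descent_to_num_parts: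
  assumes "num_parts < cycles A"
  shows "\<exists>v \<in> \<epsilon> ` H. cycles (sym_diff A {v}) < cycles A"
proof (rule ccontr)
  assume no: "\<not> ?thesis"
  have "(x, a x) \<in> (link A)\<^sup>* \<and> (x, b x) \<in> (link A)\<^sup>*" if x: "x \<in> H" for x
    using joined_if_no_descent[OF x, of A] no x by blast
  then have "full_link \<subseteq> (link A)\<^sup>*" using t_link by (auto simp: full_link_def matched_def)
  then show False using card_classes_antimono[OF fin, of full_link "link A"] assms by (simp add: cycles_def num_parts_def)
qed

lemma ex_quasi_tree: "\<exists>A \<subseteq> \<epsilon> ` H. cycles A = num_parts"
proof -
  have "\<exists>A \<subseteq> \<epsilon> ` H. cycles A = num_parts" if "cycles B = n" "B \<subseteq> \<epsilon> ` H" for B n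
    using that
  proof (induction n arbitrary: B rule: less_induct)
    case (less n)
    show ?case
    proof (cases "num_parts < cycles B")
      case True
      then obtain v where "v \<in> \<epsilon> ` H" "cycles (sym_diff B {v}) < cycles B" using descent_to_num_parts by blast
      then show ?thesis using less by blast
    next
      case False
      then show ?thesis using num_parts_le[of B] less.prems by (intro exI[of _ B]) auto
    qed
  qed
  then show ?thesis by blast
qed

text \<open>When toggling \<open>u\<close> exceeds the bound \<open>K\<close>, it does so by one, and any edge on which \<open>A\<close> with \<open>u\<close> toggled descends towards \<open>B\<close>
repairs it.\<close>

lemma exchange_le:
  assumes "A \<subseteq> \<epsilon> ` H" "B \<subseteq> \<epsilon> ` H" "cycles A \<le> K" "cycles B \<le> K" "u \<in> sym_diff A B"
  shows "\<exists>v \<in> sym_diff A B. cycles (sym_diff A {u, v}) \<le> K"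
proof (cases "cycles (sym_diff A {u}) \<le> K")
  case True
  then show ?thesis using assms(5) by (intro bexI[of _ u]) auto
next
  case False
  let ?A = "sym_diff A {u}"
  obtain v where v: "v \<in> sym_diff ?A B" "cycles (sym_diff ?A {v}) < cycles ?A"
    using descent_towards[of B ?A] False assms(4) by auto
  have "sym_diff ?A {v} = sym_diff A {u, v}" "v \<in> sym_diff A B" using v(1) assms(5) by auto
  moreover have "cycles ?A \<le> cycles A + 1" using cycles_toggle_le assms by blast
  ultimately show ?thesis using v(2) assms(3) by (intro bexI[of _ v]) auto
qed

text \<open>After \<open>u\<close> is toggled the number of cycles is \<open>num_parts\<close> or \<open>num_parts + 2\<close>. In the second case a descent
towards \<open>B\<close> goes back to \<open>num_parts + 1\<close>. In the first case any further edge of the symmetric difference will do,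
because the number has to change and cannot fall below \<open>num_parts\<close>; there is one, since otherwise \<open>B\<close> would
be \<open>A\<close> with \<open>u\<close> toggled.\<close>

lemma exchange_eq:
  assumes "A \<subseteq> \<epsilon> ` H" "B \<subseteq> \<epsilon> ` H" "cycles A = num_parts + 1" "cycles B = num_parts + 1" "u \<in> sym_diff A B"
    and c: "\<And>x. x \<in> H \<Longrightarrow> c (t x) \<noteq> c x" "\<And>x. x \<in> H \<Longrightarrow> c (a x) \<noteq> c x" "\<And>x. x \<in> H \<Longrightarrow> c (b x) \<noteq> (c x :: bool)"
  shows "\<exists>v \<in> sym_diff A B. cycles (sym_diff A {u, v}) = num_parts + 1"
proof -
  let ?A = "sym_diff A {u}"
  have E: "u \<in> \<epsilon> ` H" using assms by auto
  have neq: "cycles (sym_diff C {v}) \<noteq> cycles C" if "v \<in> \<epsilon> ` H" for C v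
    by (rule cycles_toggle_neq[where c = c, OF that c])
  obtain v where v: "v \<in> sym_diff ?A B" "cycles (sym_diff ?A {v}) = num_parts + 1"
  proof (cases "cycles ?A > num_parts + 1")
    case True
    then obtain v where v: "v \<in> sym_diff ?A B" "v \<in> \<epsilon> ` H" "cycles (sym_diff ?A {v}) < cycles ?A"
      using descent_towards[of B ?A] assms(4) by auto
    have "cycles ?A \<le> cycles A + 1" using cycles_toggle_le E by blast
    moreover have "cycles ?A \<le> cycles (sym_diff ?A {v}) + 1" using cycles_toggle_ge v(2) by blast
    ultimately have "cycles (sym_diff ?A {v}) = num_parts + 1" using v(3) True assms(3) by linarith
    then show ?thesis using that v by blast
  next
    case False
    then have A: "cycles ?A = num_parts" using neq[OF E, of A] num_parts_le[of ?A] assms(3) by linarith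
    then have "?A \<noteq> B" using assms(4) by auto
    then obtain v where v: "v \<in> sym_diff ?A B" by blast
    then have vE: "v \<in> \<epsilon> ` H" using assms E by blast
    have "cycles (sym_diff ?A {v}) = num_parts + 1"
      using neq[OF vE, of ?A] cycles_toggle_le[OF vE, of ?A] num_parts_le[of "sym_diff ?A {v}"] A by linarith
    then show ?thesis using that v by blast
  qed
  have "sym_diff ?A {v} = sym_diff A {u, v}" "v \<in> sym_diff A B" using v(1) assms(5) by auto
  then show ?thesis using v(2) by (intro bexI[of _ v]) auto
qed

lemma ex_next_to_quasi_tree:
  assumes "H \<noteq> {}"
    and c: "\<And>x. x \<in> H \<Longrightarrow> c (t x) \<noteq> c x" "\<And>x. x \<in> H \<Longrightarrow> c (a x) \<noteq> c x" "\<And>x. x \<in> H \<Longrightarrow> c (b x) \<noteq> (c x :: bool)"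
  shows "\<exists>A \<subseteq> \<epsilon> ` H. cycles A = num_parts + 1"
proof -
  obtain A where A: "A \<subseteq> \<epsilon> ` H" "cycles A = num_parts" using ex_quasi_tree by blast
  obtain e where e: "e \<in> \<epsilon> ` H" using assms(1) by blast
  have "cycles (sym_diff A {e}) = num_parts + 1"
    using cycles_toggle_neq[where c = c, OF e c, of A] cycles_toggle_le[OF e, of A] num_parts_le[of "sym_diff A {e}"] A(2)
    by linarith
  then show ?thesis using A(1) e by (intro exI[of _ "sym_diff A {e}"]) auto
qed

end

section \<open>Connected components of a union of pieces\<close>

lemma card_image_eq_if_same_fibres:
  assumes "\<And>i j. i \<in> J \<Longrightarrow> j \<in> J \<Longrightarrow> f i = f j \<longleftrightarrow> g i = g j"
  shows "card (f ` J) = card (g ` J)"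
proof -
  have r: "inj_on (\<lambda>y. g (SOME i. i \<in> J \<and> f i = y)) (f ` J)"
    "(\<lambda>y. g (SOME i. i \<in> J \<and> f i = y)) ` (f ` J) = g ` J"
  proof -
    have *: "g (SOME k. k \<in> J \<and> f k = f i) = g i" if "i \<in> J" for i
    proof -
      have "(SOME k. k \<in> J \<and> f k = f i) \<in> J \<and> f (SOME k. k \<in> J \<and> f k = f i) = f i"
        using that by (intro someI[of "\<lambda>k. k \<in> J \<and> f k = f i"]) auto
      then show ?thesis using assms that by blast
    qed
    show "inj_on (\<lambda>y. g (SOME i. i \<in> J \<and> f i = y)) (f ` J)"
      using assms * by (auto simp: inj_on_def)
    show "(\<lambda>y. g (SOME i. i \<in> J \<and> f i = y)) ` (f ` J) = g ` J"
      using * by (auto simp: image_image)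
  qed
  show ?thesis using card_image[OF r(1)] unfolding r(2) by simp
qed

text \<open>The union of the pieces in one class of \<open>R\<close> is connected, and it is open and closed, because the other
classes have a closed union too. So classes of pieces correspond to connected components.\<close>

lemma card_connected_components_of_pieces:
  assumes fin: "finite J"
    and cl: "\<And>i. i \<in> J \<Longrightarrow> closedin Y (P i)" and co: "\<And>i. i \<in> J \<Longrightarrow> connectedin Y (P i)"
    and ne: "\<And>i. i \<in> J \<Longrightarrow> P i \<noteq> {}"
    and cov: "topspace Y = (\<Union>i\<in>J. P i)"
    and R: "sym R" "\<And>i j. (i, j) \<in> R \<Longrightarrow> i \<in> J \<and> j \<in> J \<and> P i \<inter> P j \<noteq> {}"
    and meet: "\<And>i j. i \<in> J \<Longrightarrow> j \<in> J \<Longrightarrow> P i \<inter> P j \<noteq> {} \<Longrightarrow> (i, j) \<in> R\<^sup>*"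
  shows "card (connected_components_of Y) = card (classes R J)"
proof -
  define x where "x = (\<lambda>i. SOME y. y \<in> P i)"
  have x: "x i \<in> P i" if "i \<in> J" for i using ne[OF that] unfolding x_def by (simp add: some_in_eq)
  define c where "c = (\<lambda>i. connected_component_of_set Y (x i))"
  have sub: "P i \<subseteq> c i" if "i \<in> J" for i
    unfolding c_def by (rule connected_component_of_maximal[OF co[OF that] x[OF that]])
  have ceq: "connected_component_of_set Y y = c i" if "i \<in> J" "y \<in> P i" for i y
    using sub[OF that(1)] that(2) connected_component_of_equiv[of Y "x i" y] unfolding c_def by auto
  have step: "c i = c j" if "(i, j) \<in> R" for i j
  proof -
    have "i \<in> J \<and> j \<in> J \<and> P i \<inter> P j \<noteq> {}" by (rule R(2)[OF that])
    then obtain z where "z \<in> P i" "z \<in> P j" "i \<in> J" "j \<in> J" by auto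
    then show ?thesis using ceq by metis
  qed
  have steps: "c i = c j" if "(i, j) \<in> R\<^sup>*" for i j
    using that by (induction rule: rtrancl_induct) (auto dest: step)
  have RJ: "R \<subseteq> J \<times> J" using R(2) by auto
  define U where "U = (\<lambda>i. \<Union>j\<in>R\<^sup>* `` {i} \<inter> J. P j)"
  have conn: "(i, j) \<in> R\<^sup>*" if ij: "i \<in> J" "j \<in> J" and e: "c i = c j" for i j
  proof -
    have clU: "closedin Y (U i)" for i
      unfolding U_def using fin cl by (intro closedin_Union) auto
    have "topspace Y - U i = (\<Union>j\<in>J - R\<^sup>* `` {i}. P j)"
    proof -
      have "P j \<inter> P k = {}" if "j \<in> R\<^sup>* `` {i} \<inter> J" "k \<in> J - R\<^sup>* `` {i}" for j k
        using that meet[of j k] by (auto intro: rtrancl_trans)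
      then show ?thesis unfolding U_def cov by blast
    qed
    moreover have "closedin Y (\<Union>j\<in>J - R\<^sup>* `` {i}. P j)" using fin cl by (intro closedin_Union) auto
    ultimately have "openin Y (U i)"
      using clU[of i] by (metis closedin_def openin_closedin_eq)
    then have "c i \<subseteq> U i \<or> disjnt (c i) (U i)"
      using clU connectedin_clopen_cases connectedin_connected_component_of unfolding c_def by metis
    moreover have "x i \<in> c i" "x i \<in> U i" using ij x sub by (auto simp: U_def)
    ultimately have "c i \<subseteq> U i" by (auto simp: disjnt_iff)
    then have "x j \<in> U i" using e sub x ij by blast
    then obtain k where "(i, k) \<in> R\<^sup>*" "k \<in> J" "x j \<in> P k" by (auto simp: U_def)
    then show ?thesis using meet[of k j] x[of j] ij by (auto intro: rtrancl_trans)
  qed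
  have "connected_components_of Y = c ` J"
  proof
    show "connected_components_of Y \<subseteq> c ` J"
      unfolding connected_components_of_def cov using ceq by auto
    show "c ` J \<subseteq> connected_components_of Y"
      unfolding connected_components_of_def cov c_def using x by blast
  qed
  moreover have "card (c ` J) = card (classes R J)" unfolding classes_def
  proof (rule card_image_eq_if_same_fibres)
    fix i j assume ij: "i \<in> J" "j \<in> J"
    have "R\<^sup>* `` {i} = R\<^sup>* `` {j} \<longleftrightarrow> (i, j) \<in> R\<^sup>*"
      using sym_rtranclD[OF R(1)] by (auto intro: rtrancl_trans)
    then show "c i = c j \<longleftrightarrow> R\<^sup>* `` {i} = R\<^sup>* `` {j}" using conn ij steps by blast
  qed
  ultimately show ?thesis by simp
qed

section \<open>Planar points, discs and seams\<close>

definition planar_nbhd :: "'a topology \<Rightarrow> 'a set \<Rightarrow> bool" where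
  "planar_nbhd Y U \<longleftrightarrow> openin Y U \<and> (\<exists>W. open (W :: complex set) \<and> subtopology Y U homeomorphic_space top_of_set W)"

definition planar_at :: "'a topology \<Rightarrow> 'a \<Rightarrow> bool" where
  "planar_at Y x \<longleftrightarrow> (\<exists>U. x \<in> U \<and> planar_nbhd Y U)"

lemma surface_boundary_eq: "surface_boundary Y = {x \<in> topspace Y. \<not> planar_at Y x}"
  by (auto simp: surface_boundary_def planar_at_def planar_nbhd_def)

lemma closedin_surface_boundary: "closedin Y (surface_boundary Y)"
proof -
  have "topspace Y - surface_boundary Y = \<Union>{U. planar_nbhd Y U}"
    by (auto simp: surface_boundary_eq planar_at_def planar_nbhd_def dest: openin_subset)
  moreover have "openin Y (\<Union>{U. planar_nbhd Y U})" by (auto simp: planar_nbhd_def)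
  moreover have "surface_boundary Y \<subseteq> topspace Y" by (auto simp: surface_boundary_eq)
  ultimately show ?thesis unfolding closedin_def by metis
qed

lemma planar_nbhd_Int:
  assumes "planar_nbhd Y U" "openin Y T"
  shows "planar_nbhd Y (U \<inter> T)"
proof -
  obtain W :: "complex set" and f where W: "open W" and f: "homeomorphic_map (subtopology Y U) (top_of_set W) f"
    using assms(1) by (auto simp: planar_nbhd_def homeomorphic_space)
  have U: "openin Y U" using assms(1) by (simp add: planar_nbhd_def)
  then have tU: "topspace (subtopology Y U) = U" using openin_subset by fastforce
  have UT: "openin (subtopology Y U) (U \<inter> T)" using assms(2) by (simp add: openin_subtopology_Int2)
  then have "openin (top_of_set W) (f ` (U \<inter> T))"
    using homeomorphic_map_openness[OF f, of "U \<inter> T"] tU by auto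
  then have o: "open (f ` (U \<inter> T))" "f ` (U \<inter> T) \<subseteq> W" using W by (auto dest: openin_open_trans openin_imp_subset)
  then have "homeomorphic_map (subtopology (subtopology Y U) T) (subtopology (top_of_set W) (f ` (U \<inter> T))) f"
    using openin_subset[OF U] by (intro homeomorphic_map_subtopologies[OF f]) auto
  then have "homeomorphic_map (subtopology Y (U \<inter> T)) (top_of_set (f ` (U \<inter> T))) f"
    using o(2) by (simp add: subtopology_subtopology inf_absorb2)
  then show ?thesis using o(1) U assms(2)
    unfolding planar_nbhd_def homeomorphic_space by blast
qed

text \<open>Planar neighbourhoods may be shrunk, so whether a point has one can be decided in any subspace that
contains a neighbourhood of the point.\<close>

lemma planar_at_local:
  assumes "openin Y T" "T \<subseteq> D" "x \<in> T"
  shows "planar_at (subtopology Y D) x \<longleftrightarrow> planar_at Y x"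
proof
  assume "planar_at Y x"
  then obtain U where U: "x \<in> U" "planar_nbhd Y U" by (auto simp: planar_at_def)
  have "planar_nbhd Y (U \<inter> T)" by (rule planar_nbhd_Int[OF U(2) assms(1)])
  moreover have "D \<inter> (U \<inter> T) = U \<inter> T" using assms(2) by blast
  moreover have "openin (subtopology Y D) (U \<inter> T)"
    using \<open>planar_nbhd Y (U \<inter> T)\<close> \<open>D \<inter> (U \<inter> T) = U \<inter> T\<close> openin_subtopology_Int2[of Y "U \<inter> T" D]
    by (simp add: planar_nbhd_def)
  ultimately have "planar_nbhd (subtopology Y D) (U \<inter> T)"
    by (simp add: planar_nbhd_def subtopology_subtopology)
  then show "planar_at (subtopology Y D) x" using U assms(3) by (auto simp: planar_at_def)
next
  assume "planar_at (subtopology Y D) x"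
  then obtain U where U: "x \<in> U" "planar_nbhd (subtopology Y D) U" by (auto simp: planar_at_def)
  have "openin (subtopology Y D) T" using assms(1,2) by (metis inf.absorb1 openin_subtopology_Int)
  then have P: "planar_nbhd (subtopology Y D) (U \<inter> T)" by (rule planar_nbhd_Int[OF U(2)])
  then obtain Q where "openin Y Q" "U \<inter> T = Q \<inter> D"
    by (auto simp: planar_nbhd_def openin_subtopology)
  then have "U \<inter> T = Q \<inter> T" using assms(2) by blast
  then have "openin Y (U \<inter> T)" using \<open>openin Y Q\<close> assms(1) by (simp add: openin_Int)
  moreover have "D \<inter> (U \<inter> T) = U \<inter> T" using assms(2) by blast
  ultimately have "planar_nbhd Y (U \<inter> T)" using P by (auto simp: planar_nbhd_def subtopology_subtopology)
  then show "planar_at Y x" using U assms(3) by (auto simp: planar_at_def)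
qed

definition disc_param :: "'a topology \<Rightarrow> 'a set \<Rightarrow> (complex \<Rightarrow> 'a) \<Rightarrow> bool" where
  "disc_param X D g \<longleftrightarrow> continuous_map (top_of_set (cball 0 1)) X g \<and> inj_on g (cball 0 1) \<and> g ` cball 0 1 = D"

lemma ex_disc_param:
  assumes "closed_disc_in X D" shows "\<exists>g. disc_param X D g"
proof -
  have "top_of_set (cball (0::complex) 1) homeomorphic_space subtopology X D"
    using assms homeomorphic_space_sym by (auto simp: closed_disc_in_def)
  then obtain g where g: "homeomorphic_map (top_of_set (cball (0::complex) 1)) (subtopology X D) g"
    by (auto simp: homeomorphic_space)
  have "continuous_map (top_of_set (cball 0 1)) X g"
    using homeomorphic_imp_continuous_map[OF g] continuous_map_into_fulltopology by blast
  moreover have "inj_on g (cball 0 1)" using homeomorphic_imp_injective_map[OF g] by simp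
  moreover have "g ` cball 0 1 = D" using homeomorphic_imp_surjective_map[OF g] assms by (auto simp: closed_disc_in_def)
  ultimately show ?thesis by (auto simp: disc_param_def)
qed

lemma disc_param_homeomorphic_map:
  assumes "Hausdorff_space X" "disc_param X D g"
  shows "homeomorphic_map (top_of_set (cball 0 1)) (subtopology X D) g"
proof (rule continuous_imp_homeomorphic_map)
  have g: "continuous_map (top_of_set (cball 0 1)) X g" "inj_on g (cball 0 1)" "g ` cball 0 1 = D"
    using assms(2) by (auto simp: disc_param_def)
  then have "D \<subseteq> topspace X" using continuous_map_image_subset_topspace by fastforce
  then show "g ` topspace (top_of_set (cball 0 1)) = topspace (subtopology X D)" using g(3) by auto
  show "continuous_map (top_of_set (cball 0 1)) (subtopology X D) g"
    using g by (auto simp: continuous_map_in_subtopology)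
qed (use assms in \<open>auto simp: disc_param_def Hausdorff_space_subtopology compact_space_subtopology\<close>)

text \<open>A plane neighbourhood of a point of the circle would embed an open subset of the plane in the closed
disc, with an image that touches the circle. This contradicts invariance of domain.\<close>

lemma planar_at_disc:
  assumes X: "Hausdorff_space X" "disc_param X D g" and z: "norm z \<le> 1"
  shows "planar_at (subtopology X D) (g z) \<longleftrightarrow> norm z < 1"
proof
  note g = disc_param_homeomorphic_map[OF X]
  have im: "g ` cball 0 1 = D" and inj: "inj_on g (cball 0 1)" using X(2) by (auto simp: disc_param_def)
  have tD: "topspace (subtopology X D) = D" using homeomorphic_imp_surjective_map[OF g] im by simp
  {
    assume "norm z < 1"
    have "openin (subtopology X D) (g ` ball 0 1)"
      using homeomorphic_map_openness[OF g, of "ball 0 1"] open_subset[OF ball_subset_cball open_ball]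
      by auto
    moreover have "homeomorphic_map (top_of_set (ball 0 1)) (subtopology X (g ` ball 0 1)) g"
    proof -
      have "homeomorphic_map (subtopology (top_of_set (cball 0 1)) (ball 0 1)) (subtopology (subtopology X D) (g ` ball 0 1)) g"
        by (intro homeomorphic_map_subtopologies[OF g]) (use tD im in auto)
      moreover have "D \<inter> g ` ball 0 1 = g ` ball 0 1" "cball (0::complex) 1 \<inter> ball 0 1 = ball 0 1" using im by auto
      ultimately show ?thesis by (simp add: subtopology_subtopology)
    qed
    ultimately have "planar_nbhd (subtopology X D) (g ` ball 0 1)"
      using im unfolding planar_nbhd_def subtopology_subtopology
      by (metis ball_subset_cball homeomorphic_space homeomorphic_space_sym image_mono inf.absorb2 open_ball)
    then show "planar_at (subtopology X D) (g z)" using \<open>norm z < 1\<close> by (auto simp: planar_at_def intro!: exI[of _ "g ` ball 0 1"])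
  }
  assume "planar_at (subtopology X D) (g z)"
  then obtain U and W :: "complex set" where U: "g z \<in> U" "openin (subtopology X D) U" "open W"
      "top_of_set W homeomorphic_space subtopology (subtopology X D) U"
    unfolding planar_at_def planar_nbhd_def by (metis homeomorphic_space_sym)
  then obtain k where k: "homeomorphic_map (top_of_set W) (subtopology (subtopology X D) U) k"
    by (auto simp: homeomorphic_space)
  have UD: "U \<subseteq> D" using openin_subset[OF U(2)] tD by simp
  obtain f where f: "homeomorphic_maps (top_of_set (cball 0 1)) (subtopology X D) g f"
    using g homeomorphic_map_maps by blast
  have kW: "k ` W = U" using homeomorphic_imp_surjective_map[OF k] tD UD by auto
  have "continuous_map (top_of_set W) (top_of_set (cball 0 1)) (f \<circ> k)"
    using homeomorphic_imp_continuous_map[OF k] f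
    by (meson continuous_map_compose continuous_map_into_fulltopology homeomorphic_maps_def)
  then have con: "continuous_on W (f \<circ> k)" "(f \<circ> k) ` W \<subseteq> cball 0 1" by (auto simp: continuous_map_in_subtopology)
  have gf: "g (f y) = y" if "y \<in> D" for y using f that tD by (auto simp: homeomorphic_maps_def)
  have fg: "f (g y) = y" if "y \<in> cball 0 1" for y using f that by (auto simp: homeomorphic_maps_def)
  have "inj_on k W" using homeomorphic_imp_injective_map[OF k] by simp
  then have "inj_on (f \<circ> k) W"
    using gf kW UD by (intro comp_inj_on inj_on_inverseI[where g = g]) auto
  then have "open ((f \<circ> k) ` W)" using invariance_of_domain_gen[OF U(3) con(1)] by simp
  then have "(f \<circ> k) ` W \<subseteq> interior (cball 0 1)" using con(2) interior_maximal by blast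
  moreover have "z \<in> (f \<circ> k) ` W"
    unfolding image_comp[symmetric] kW using U(1) fg[of z] z by (intro image_eqI[of _ _ "g z"]) auto
  ultimately show "norm z < 1" by auto
qed

lemma surface_boundary_disc:
  assumes "Hausdorff_space X" "disc_param X D g"
  shows "surface_boundary (subtopology X D) = g ` sphere 0 1"
proof -
  have D: "g ` cball 0 1 = D" "D \<subseteq> topspace X" 
    using assms(2) continuous_map_image_subset_topspace unfolding disc_param_def by fastforce+
  then have "topspace (subtopology X D) = g ` cball 0 1" by auto
  then show ?thesis unfolding surface_boundary_eq
    using planar_at_disc[OF assms] by (auto simp: less_eq_real_def)
qed

text \<open>In a chart around \<open>x\<close> with values in the half-plane, \<open>h\<close> becomes an injective continuous map between subsets of the plane. By
invariance of domain its image is open in the plane, hence also open in the half-plane and in the surface. So it suffices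
to have an injection from a plane open set; neither its image has to be shown open nor its inverse continuous.\<close>

lemma planar_nbhd_in_injective_image:
  assumes X: "surface_with_boundary X" and S: "open (S :: complex set)"
    and h: "continuous_map (top_of_set S) X h" "inj_on h S" and x: "x \<in> h ` S"
  shows "\<exists>U. x \<in> U \<and> U \<subseteq> h ` S \<and> planar_nbhd X U"
proof -
  have "x \<in> topspace X" using h(1) x by (auto simp: continuous_map_def Pi_iff)
  then obtain U and W :: "complex set" where U: "openin X U" "x \<in> U"
      "subtopology X U homeomorphic_space top_of_set W"
    using X unfolding surface_with_boundary_def by blast
  then obtain k where k: "homeomorphic_map (subtopology X U) (top_of_set W) k" by (auto simp: homeomorphic_space)
  have tU: "topspace (subtopology X U) = U" using U(1) openin_subset by fastforce
  define Q where "Q = {z \<in> S. h z \<in> U}"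
  have "openin (top_of_set S) Q" unfolding Q_def using openin_continuous_map_preimage[OF h(1) U(1)] by simp
  then have Q: "open Q" using S openin_open_trans by blast
  have hQ: "continuous_map (top_of_set Q) (subtopology X U) h"
  proof -
    have "continuous_map (top_of_set Q) X h"
      using continuous_map_from_subtopology_mono[OF h(1)] by (auto simp: Q_def)
    then show ?thesis by (auto simp: continuous_map_in_subtopology Q_def)
  qed
  have "continuous_map (top_of_set Q) (top_of_set W) (k \<circ> h)"
    using continuous_map_compose[OF hQ homeomorphic_imp_continuous_map[OF k]] .
  then have c: "continuous_on Q (k \<circ> h)" "(k \<circ> h) ` Q \<subseteq> W" by (auto simp: continuous_map_in_subtopology)
  have "inj_on k U" using homeomorphic_imp_injective_map[OF k] tU by simp
  moreover have "h ` Q \<subseteq> U" by (auto simp: Q_def)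
  moreover have "inj_on h Q" using h(2) by (auto simp: Q_def inj_on_def)
  ultimately have "inj_on (k \<circ> h) Q" by (meson comp_inj_on inj_on_subset)
  then have o: "open ((k \<circ> h) ` Q)" using invariance_of_domain_gen[OF Q c(1)] by simp
  have "openin (top_of_set W) (k ` (h ` Q))"
    using o c(2) by (simp add: image_comp open_subset)
  then have oU: "openin (subtopology X U) (h ` Q)"
    using homeomorphic_map_openness[OF k, of "h ` Q"] \<open>h ` Q \<subseteq> U\<close> openin_subset[OF U(1)] by auto
  then have oX: "openin X (h ` Q)" using U(1) by (meson openin_open_subtopology)
  have "homeomorphic_map (subtopology (subtopology X U) (h ` Q)) (subtopology (top_of_set W) (k ` (h ` Q))) k"
    using \<open>h ` Q \<subseteq> U\<close> c(2) openin_subset[OF U(1)] by (intro homeomorphic_map_subtopologies[OF k]) auto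
  then have "homeomorphic_map (subtopology X (h ` Q)) (top_of_set ((k \<circ> h) ` Q)) k"
    using \<open>h ` Q \<subseteq> U\<close> c(2) by (simp add: subtopology_subtopology inf_absorb2 image_comp)
  then have "planar_nbhd X (h ` Q)" using o oX unfolding planar_nbhd_def homeomorphic_space by blast
  moreover have "x \<in> h ` Q" "h ` Q \<subseteq> h ` S" using x U(2) by (auto simp: Q_def)
  ultimately show ?thesis by blast
qed

lemma disc_lift:
  assumes X: "Hausdorff_space X" "disc_param X D g" and c: "continuous_map (top_of_set S) X f" "f ` S \<subseteq> D"
  shows "\<exists>u. continuous_on S u \<and> (\<forall>t\<in>S. norm (u t) \<le> 1 \<and> g (u t) = f t)"
proof -
  obtain k where k: "homeomorphic_maps (top_of_set (cball 0 1)) (subtopology X D) g k"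
    using disc_param_homeomorphic_map[OF X] homeomorphic_map_maps by blast
  have "continuous_map (top_of_set S) (subtopology X D) f" using c by (auto simp: continuous_map_in_subtopology)
  then have "continuous_map (top_of_set S) (top_of_set (cball 0 1)) (k \<circ> f)"
    using k continuous_map_compose unfolding homeomorphic_maps_def by blast
  then have "continuous_on S (k \<circ> f)" "(k \<circ> f) ` S \<subseteq> cball 0 1" by (auto simp: continuous_map_in_subtopology)
  moreover have "g (k (f t)) = f t" if "t \<in> S" for t
  proof -
    have "f t \<in> topspace (subtopology X D)" using c that by (auto simp: continuous_map_def Pi_iff)
    then show ?thesis using k by (auto simp: homeomorphic_maps_def)
  qed
  ultimately show ?thesis by (intro exI[of _ "k \<circ> f"]) auto
qed

lemma disc_paramD:
  assumes "disc_param X D g"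
  shows "continuous_map (top_of_set (cball 0 1)) X g" "inj_on g (cball 0 1)" "g ` cball 0 1 = D" "D \<subseteq> topspace X"
  using assms continuous_map_image_subset_topspace unfolding disc_param_def by fastforce+

lemma disc_param_eq_iff:
  assumes "disc_param X D g" "norm z \<le> 1" "norm w \<le> 1" shows "g z = g w \<longleftrightarrow> z = w"
  using disc_paramD(2)[OF assms(1)] assms(2,3) by (auto simp: inj_on_def)

lemma continuous_map_disc_compose:
  assumes "disc_param X D g" "continuous_on S f" "\<And>t. t \<in> S \<Longrightarrow> norm (f t) \<le> 1"
  shows "continuous_map (top_of_set S) X (\<lambda>t. g (f t))"
proof -
  have "continuous_map (top_of_set S) (top_of_set (cball 0 1)) f"
    using assms(2,3) by (auto simp: continuous_map_in_subtopology)
  from continuous_map_compose[OF this disc_paramD(1)[OF assms(1)]] show ?thesis by (simp add: comp_def)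
qed

text \<open>Near an interior point of a segment the two discs are parametrized by radial lines from their centres to
the points of the segment. The two parametrizations agree on the segment and together map an open rectangle injectively to the surface.\<close>

lemma seam_point_planar:
  assumes X: "surface_with_boundary X" and D: "disc_param X D gD" and F: "disc_param X F gF"
    and f: "continuous_map (top_of_set {0..1::real}) X f" "inj_on f {0..1}"
    and fD: "f ` {0..1} \<subseteq> gD ` sphere 0 1" and fF: "f ` {0..1} \<subseteq> gF ` sphere 0 1"
    and int: "gD ` ball 0 1 \<inter> F = {}" "gF ` ball 0 1 \<inter> D = {}" and t: "0 < t" "t < 1"
  shows "\<exists>U. f t \<in> U \<and> U \<subseteq> D \<union> F \<and> planar_nbhd X U"
proof -
  have H: "Hausdorff_space X" using X by (simp add: surface_with_boundary_def)
  have lift: "\<exists>u. continuous_on {0..1} u \<and> (\<forall>t\<in>{0..1}. norm (u t) = 1 \<and> g (u t) = f t)"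
    if "disc_param X B g" "f ` {0..1} \<subseteq> g ` sphere 0 1" for B g
  proof -
    have "g ` sphere 0 1 \<subseteq> B" using disc_paramD(3)[OF that(1)] by auto
    then have "f ` {0..1} \<subseteq> B" using that(2) by auto
    from disc_lift[OF H that(1) f(1) this]
    obtain u where u: "continuous_on {0..1} u" "\<forall>t\<in>{0..1}. norm (u t) \<le> 1 \<and> g (u t) = f t" by blast
    have "norm (u t) = 1" if t: "t \<in> {0..1}" for t
    proof -
      obtain z where "norm z = 1" "f t = g z" using \<open>f ` {0..1} \<subseteq> g ` sphere 0 1\<close> t by force
      then show ?thesis using u(2) t disc_param_eq_iff[OF \<open>disc_param X B g\<close>, of z "u t"] by auto
    qed
    then show ?thesis using u by blast
  qed
  obtain u where u: "continuous_on {0..1} u" "\<And>t. t \<in> {0..1} \<Longrightarrow> norm (u t) = 1 \<and> gD (u t) = f t"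
    using lift[OF D fD] by blast
  obtain w where w: "continuous_on {0..1} w" "\<And>t. t \<in> {0..1} \<Longrightarrow> norm (w t) = 1 \<and> gF (w t) = f t"
    using lift[OF F fF] by blast
  define S where "S = {z. -1 < Re z \<and> Re z < 1 \<and> 0 < Im z \<and> Im z < 1}"
  have S: "open S" unfolding S_def
    by (intro open_Collect_conj open_Collect_less continuous_intros)
  define hD where "hD = (\<lambda>z. gD (complex_of_real (1 - Re z) * u (Im z)))"
  define hF where "hF = (\<lambda>z. gF (complex_of_real (1 + Re z) * w (Im z)))"
  define h where "h = (\<lambda>z. if 0 \<le> Re z then hD z else hF z)"
  have uS: "norm (u (Im z)) = 1" "gD (u (Im z)) = f (Im z)" "norm (w (Im z)) = 1" "gF (w (Im z)) = f (Im z)"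
    if "z \<in> S" for z using that u(2) w(2) by (auto simp: S_def)
  have nD: "norm (complex_of_real (1 - Re z) * u (Im z)) = 1 - Re z" if "z \<in> S" for z
    unfolding norm_mult norm_of_real using uS[OF that] that by (simp add: S_def)
  have nF: "norm (complex_of_real (1 + Re z) * w (Im z)) = 1 + Re z" if "z \<in> S" for z
    unfolding norm_mult norm_of_real using uS[OF that] that by (simp add: S_def)
  have con: "continuous_map (top_of_set S) X h" unfolding h_def
  proof (rule continuous_map_cases_le)
    show "continuous_map (subtopology (top_of_set S) {x \<in> topspace (top_of_set S). 0 \<le> Re x}) X hD"
    proof -
      have "continuous_map (top_of_set {z \<in> S. 0 \<le> Re z}) X hD" unfolding hD_def
      proof (rule continuous_map_disc_compose[OF D])
        show "continuous_on {z \<in> S. 0 \<le> Re z} (\<lambda>z. complex_of_real (1 - Re z) * u (Im z))"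
          by (intro continuous_intros continuous_on_compose2[OF u(1)]) (auto simp: S_def)
      qed (use nD in auto)
      then show ?thesis by (simp add: subtopology_subtopology Collect_conj_eq Int_absorb1 inf_assoc)
    qed
    show "continuous_map (subtopology (top_of_set S) {x \<in> topspace (top_of_set S). Re x \<le> 0}) X hF"
    proof -
      have "continuous_map (top_of_set {z \<in> S. Re z \<le> 0}) X hF" unfolding hF_def
      proof (rule continuous_map_disc_compose[OF F])
        show "continuous_on {z \<in> S. Re z \<le> 0} (\<lambda>z. complex_of_real (1 + Re z) * w (Im z))"
          by (intro continuous_intros continuous_on_compose2[OF w(1)]) (auto simp: S_def)
      qed (use nF in auto)
      then show ?thesis by (simp add: subtopology_subtopology Collect_conj_eq Int_absorb1 inf_assoc)
    qed
    show "hD x = hF x" if "x \<in> topspace (top_of_set S)" "0 = Re x" for x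
      using that uS[of x] by (simp add: hD_def hF_def)
  qed (auto intro!: continuous_intros)
  have hDm: "hD z \<in> D" if "z \<in> S" "0 \<le> Re z" for z
    using nD[OF that(1)] that(2) unfolding disc_paramD(3)[OF D, symmetric] hD_def by (intro imageI) simp
  have hFm: "hF z \<in> F" if "z \<in> S" "Re z \<le> 0" for z
    using nF[OF that(1)] that(2) unfolding disc_paramD(3)[OF F, symmetric] hF_def by (intro imageI) simp
  have hDi: "hD z \<in> gD ` ball 0 1" if "z \<in> S" "0 < Re z" for z
    using nD[OF that(1)] that(2) unfolding hD_def by (intro imageI) simp
  have hFi: "hF z \<in> gF ` ball 0 1" if "z \<in> S" "Re z < 0" for z
    using nF[OF that(1)] that(2) unfolding hF_def by (intro imageI) simp
  have hD0: "hD z = f (Im z)" if "z \<in> S" "Re z = 0" for z using that uS by (simp add: hD_def)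
  have inj: "inj_on h S"
  proof (rule inj_onI)
    fix x y assume xy: "x \<in> S" "y \<in> S" and e: "h x = h y"
    have Im: "Im x \<in> {0..1}" "Im y \<in> {0..1}" using xy by (auto simp: S_def)
    have fi: "f s = f s' \<Longrightarrow> s = s'" if "s \<in> {0..1}" "s' \<in> {0..1}" for s s'
      using f(2) that by (auto simp: inj_on_def)
    consider "0 \<le> Re x" "0 \<le> Re y" | "Re x < 0" "Re y < 0" | "0 \<le> Re x" "Re y < 0" | "Re x < 0" "0 \<le> Re y"
      by linarith
    then show "x = y"
    proof cases
      case 1
      then have "complex_of_real (1 - Re x) * u (Im x) = complex_of_real (1 - Re y) * u (Im y)"
        using e disc_param_eq_iff[OF D] nD[OF xy(1)] nD[OF xy(2)] by (simp add: h_def hD_def)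
      moreover from this have R: "Re x = Re y" using nD[OF xy(1)] nD[OF xy(2)] by simp
      moreover have "Re x < 1" using xy by (simp add: S_def)
      ultimately have "u (Im x) = u (Im y)" by simp
      then have "f (Im x) = f (Im y)" using uS xy by metis
      then show ?thesis using fi[OF Im] R by (simp add: complex_eq_iff)
    next
      case 2
      then have "complex_of_real (1 + Re x) * w (Im x) = complex_of_real (1 + Re y) * w (Im y)"
        using e disc_param_eq_iff[OF F] nF[OF xy(1)] nF[OF xy(2)] by (simp add: h_def hF_def)
      moreover from this have R: "Re x = Re y" using nF[OF xy(1)] nF[OF xy(2)] by simp
      moreover have "1 + Re x \<noteq> 0" using xy by (simp add: S_def)
      ultimately have "w (Im x) = w (Im y)" by (metis mult_cancel_left of_real_eq_0_iff)
      then have "f (Im x) = f (Im y)" using uS xy by metis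
      then show ?thesis using fi[OF Im] R by (simp add: complex_eq_iff)
    next
      case 3
      then have "h x \<in> D" "h y \<in> gF ` ball 0 1" using hDm hFi xy by (auto simp: h_def)
      then show ?thesis using e int by auto
    next
      case 4
      then have "h y \<in> D" "h x \<in> gF ` ball 0 1" using hDm hFi xy by (auto simp: h_def)
      then show ?thesis using e int by auto
    qed
  qed
  have "Complex 0 t \<in> S" using t by (simp add: S_def)
  then have "f t \<in> h ` S" using hD0[of "Complex 0 t"] by (intro image_eqI[of _ _ "Complex 0 t"]) (auto simp: h_def)
  moreover have "h ` S \<subseteq> D \<union> F" using hDm hFm by (auto simp: h_def)
  ultimately show ?thesis
    using planar_nbhd_in_injective_image[OF X S con inj, of "f t"] by (meson order_trans)
qed

section \<open>Chords and arcs of a circle\<close>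

lemma sin_sum_product: "sin (2 * B) + sin (2 * A) - sin (2 * A + 2 * B) = 4 * sin A * sin B * sin (A + B)" for A B :: real
proof -
  have c: "cos (2 * B) = 1 - 2 * (sin B)\<^sup>2" "cos (2 * A) = 1 - 2 * (sin A)\<^sup>2" by (simp_all add: cos_double_sin)
  show ?thesis unfolding sin_add c unfolding sin_double by (simp add: algebra_simps power2_eq_square)
qed

text \<open>The expression is twice the signed area of the triangle with vertices at the angles \<open>\<alpha>\<close>, \<open>\<delta>\<close> and \<open>\<phi>\<close>, which is
\<open>4 sin((\<delta> - \<alpha>)/2) sin((\<phi> - \<delta>)/2) sin((\<phi> - \<alpha>)/2)\<close>.\<close>

lemma chord_side:
  assumes "\<alpha> < \<phi>" "\<phi> < \<delta>" "\<delta> < \<alpha> + 2 * pi"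
  shows "Im (cnj (cis \<delta> - cis \<alpha>) * (cis \<phi> - cis \<alpha>)) < 0"
proof -
  have "Im (cnj (cis \<delta> - cis \<alpha>) * (cis \<phi> - cis \<alpha>)) = sin (\<phi> - \<delta>) + sin (\<delta> - \<alpha>) - sin (\<phi> - \<alpha>)"
    by (simp add: sin_diff algebra_simps)
  also have "\<dots> = 4 * sin ((\<delta> - \<alpha>) / 2) * sin ((\<phi> - \<delta>) / 2) * sin ((\<phi> - \<alpha>) / 2)"
  proof -
    have h: "2 * ((\<phi> - \<delta>) / 2) = \<phi> - \<delta>" "2 * ((\<delta> - \<alpha>) / 2) = \<delta> - \<alpha>" "\<delta> - \<alpha> + (\<phi> - \<delta>) = \<phi> - \<alpha>"
      "(\<delta> - \<alpha>) / 2 + (\<phi> - \<delta>) / 2 = (\<phi> - \<alpha>) / 2"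
      by (simp_all add: field_simps)
    show ?thesis using sin_sum_product[of "(\<phi> - \<delta>) / 2" "(\<delta> - \<alpha>) / 2"] unfolding h by simp
  qed
  also have "\<dots> < 0"
  proof -
    have "0 < sin ((\<delta> - \<alpha>) / 2)" "0 < sin ((\<delta> - \<phi>) / 2)" "0 < sin ((\<phi> - \<alpha>) / 2)"
      using assms by (auto intro!: sin_gt_zero)
    moreover have "sin ((\<phi> - \<delta>) / 2) = - sin ((\<delta> - \<phi>) / 2)"
      by (metis minus_diff_eq minus_divide_left sin_minus)
    ultimately show ?thesis by (simp add: mult_pos_neg mult_neg_pos mult_less_0_iff zero_less_mult_iff)
  qed
  finally show ?thesis .
qed

text \<open>Both ends of the inner chord, and hence the whole chord, lie strictly on one side of the line through the
ends of the outer one.\<close>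

lemma nested_chords_disjoint:
  assumes "\<alpha> < \<beta>" "\<beta> < \<gamma>" "\<gamma> < \<delta>" "\<delta> < \<alpha> + 2 * pi"
  shows "closed_segment (cis \<alpha>) (cis \<delta>) \<inter> closed_segment (cis \<beta>) (cis \<gamma>) = {}"
proof -
  define F where "F = (\<lambda>z. Im (cnj (cis \<delta> - cis \<alpha>) * (z - cis \<alpha>)))"
  have "F z = 0" if "z \<in> closed_segment (cis \<alpha>) (cis \<delta>)" for z
  proof -
    obtain s where "z = (1 - s) *\<^sub>R cis \<alpha> + s *\<^sub>R cis \<delta>" using \<open>z \<in> _\<close> by (auto simp: closed_segment_def)
    then have "z - cis \<alpha> = s *\<^sub>R (cis \<delta> - cis \<alpha>)" by (simp add: algebra_simps)
    then show ?thesis unfolding F_def by (simp only: mult_scaleR_right complex_scaleR) (simp add: algebra_simps)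
  qed
  moreover have "F z < 0" if "z \<in> closed_segment (cis \<beta>) (cis \<gamma>)" for z
  proof -
    obtain r where r: "0 \<le> r" "r \<le> 1" "z = (1 - r) *\<^sub>R cis \<beta> + r *\<^sub>R cis \<gamma>"
      using \<open>z \<in> _\<close> by (auto simp: closed_segment_def)
    have "F z = (1 - r) * F (cis \<beta>) + r * F (cis \<gamma>)"
      unfolding F_def r(3) by (simp add: algebra_simps)
    moreover have "F (cis \<beta>) < 0" "F (cis \<gamma>) < 0" unfolding F_def by (rule chord_side; use assms in linarith)+
    ultimately show ?thesis using r(1,2)
      by (cases "r = 0") (auto intro!: add_nonpos_neg mult_nonneg_nonpos mult_pos_neg)
  qed
  ultimately show ?thesis by fastforce
qed


text \<open>A strip from the path \<open>\<gamma> p\<close> to the path \<open>\<gamma> q\<close> inside \<open>Z\<close>. Both ends have prescribed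
parametrizations, which makes strips composable.\<close>

definition band :: "'a topology \<Rightarrow> 'a set \<Rightarrow> ('a \<Rightarrow> real \<Rightarrow> 'a) \<Rightarrow> 'a \<Rightarrow> 'a \<Rightarrow> bool" where
  "band X Z \<gamma> p q \<longleftrightarrow> (\<exists>h :: real \<times> real \<Rightarrow> 'a. continuous_map (top_of_set ({0..1} \<times> {0..1})) X h \<and> inj_on h ({0..1} \<times> {0..1}) \<and>
     h ` ({0..1} \<times> {0..1}) \<subseteq> Z \<and> (\<forall>t\<in>{0..1}. h (0, t) = \<gamma> p t \<and> h (1, t) = \<gamma> q t))"

text \<open>Disjoint arcs on a circle \<open>C\<close>. They are indexed by their ends: the path \<open>\<gamma> p\<close> runs through the arc
from \<open>p\<close> to the other end \<open>\<alpha> p\<close>, so each arc comes with both directions.\<close>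

locale arcs_on_circle =
  fixes X :: "'a topology" and C :: "'a set" and H :: "'a set"
    and \<alpha> :: "'a \<Rightarrow> 'a" and \<gamma> :: "'a \<Rightarrow> real \<Rightarrow> 'a"
  assumes X: "Hausdorff_space X"
    and finH: "finite H" and neH: "H \<noteq> {}"
    and opp: "\<And>p. p \<in> H \<Longrightarrow> \<alpha> p \<in> H"
    and path_cont: "\<And>p. p \<in> H \<Longrightarrow> continuous_map (top_of_set {0..1}) X (\<gamma> p)"
    and path_inj: "\<And>p. p \<in> H \<Longrightarrow> inj_on (\<gamma> p) {0..1}"
    and path_0: "\<And>p. p \<in> H \<Longrightarrow> \<gamma> p 0 = p"
    and path_opp: "\<And>p t. p \<in> H \<Longrightarrow> t \<in> {0..1} \<Longrightarrow> \<gamma> (\<alpha> p) t = \<gamma> p (1 - t)"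
    and path_circle: "\<And>p. p \<in> H \<Longrightarrow> \<gamma> p ` {0..1} \<subseteq> C"
    and path_disjoint: "\<And>p q. p \<in> H \<Longrightarrow> q \<in> H \<Longrightarrow> q \<notin> {p, \<alpha> p} \<Longrightarrow> \<gamma> p ` {0..1} \<inter> \<gamma> q ` {0..1} = {}"
begin

abbreviation "seg p \<equiv> \<gamma> p ` {0..1}"

lemma path_1: "p \<in> H \<Longrightarrow> \<gamma> p 1 = \<alpha> p"
  using path_opp[of p 0] path_0[OF opp] by simp

lemma seg_opp: "p \<in> H \<Longrightarrow> seg (\<alpha> p) = seg p"
proof -
  assume p: "p \<in> H"
  have "seg (\<alpha> p) = (\<lambda>t. \<gamma> p (1 - t)) ` {0..1}" using path_opp[OF p] by (intro image_cong) auto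
  also have "\<dots> = \<gamma> p ` ((\<lambda>t. 1 - t) ` {0..1})" by (simp only: image_image)
  also have "(\<lambda>t::real. 1 - t) ` {0..1} = {0..1}" by simp
  finally show ?thesis .
qed

lemma opp_opp: "p \<in> H \<Longrightarrow> \<alpha> (\<alpha> p) = p"
  using path_1[OF opp, of p] path_opp[of p 1] path_0[of p] by simp

lemma opp_neq: "p \<in> H \<Longrightarrow> \<alpha> p \<noteq> p"
  using path_inj[of p] path_0[of p] path_1[of p] by (auto simp: inj_on_def) (metis atLeastAtMost_iff order_refl zero_le_one zero_neq_one)

end

text \<open>The circle is cut open at a point off the arcs, which lifts all arcs to intervals of angles between
\<open>0\<close> and \<open>2 \<pi>\<close>.\<close>

locale lifted_arcs = arcs_on_circle X C H \<alpha> \<gamma>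
  for X :: "'a topology" and C H \<alpha> \<gamma> +
  fixes D :: "'a set" and g :: "complex \<Rightarrow> 'a" and l :: "'a \<Rightarrow> real \<Rightarrow> real"
  assumes g: "disc_param X D g" and C: "C = g ` sphere 0 1"
    and l_cont: "\<And>p. p \<in> H \<Longrightarrow> continuous_on {0..1} (l p)"
    and l_range: "\<And>p t. p \<in> H \<Longrightarrow> t \<in> {0..1} \<Longrightarrow> 0 < l p t \<and> l p t < 2 * pi"
    and l_lift: "\<And>p t. p \<in> H \<Longrightarrow> t \<in> {0..1} \<Longrightarrow> g (cis (l p t)) = \<gamma> p t"
begin

definition "Q \<theta> = g (cis \<theta>)"

lemma Q_l: "p \<in> H \<Longrightarrow> t \<in> {0..1} \<Longrightarrow> Q (l p t) = \<gamma> p t"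
  by (simp add: Q_def l_lift)

lemma Q_eq_iff: "Q \<theta> = Q \<phi> \<longleftrightarrow> (\<exists>n::int. \<theta> = \<phi> + 2 * pi * n)"
  using disc_param_eq_iff[OF g, of "cis \<theta>" "cis \<phi>"] sin_cos_eq_iff[of \<theta> \<phi>]
  by (auto simp: Q_def complex_eq_iff)

lemma Q_period: "Q (\<theta> + 2 * pi) = Q \<theta>"
  by (simp add: Q_def cis_conv_exp[symmetric] flip: cis_mult)

lemma Q_inj:
  assumes "Q \<theta> = Q \<phi>" "\<bar>\<theta> - \<phi>\<bar> < 2 * pi" shows "\<theta> = \<phi>"
proof -
  obtain n :: int where n: "\<theta> = \<phi> + 2 * pi * n" using assms(1) Q_eq_iff by blast
  have "\<bar>2 * pi * n\<bar> < 2 * pi" using assms(2) n by simp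
  then have "2 * pi * \<bar>real_of_int n\<bar> < 2 * pi * 1" by (simp add: abs_mult)
  then have "\<bar>real_of_int n\<bar> < 1" by (simp only: mult_less_cancel_left_pos pi_gt_zero mult_pos_pos zero_less_numeral)
  then show ?thesis using n by simp
qed

lemma Q_circle: "Q \<theta> \<in> C" by (simp add: Q_def C)

lemma Q_onto:
  assumes "x \<in> C" shows "\<exists>\<theta>. a \<le> \<theta> \<and> \<theta> < a + 2 * pi \<and> x = Q \<theta>"
proof -
  obtain z where z: "norm z = 1" "x = g z" using assms C by auto
  define \<phi> where "\<phi> = Arg2pi (z / cis a)"
  have "norm (z / cis a) = 1" using z by (simp add: norm_divide)
  then have "exp (\<i> * of_real \<phi>) = z / cis a" unfolding \<phi>_def using complex_norm_eq_1_exp by blast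
  then have "cis \<phi> = z / cis a" by (simp add: cis_conv_exp)
  then have "cis (a + \<phi>) = z" by (simp flip: cis_mult)
  moreover have "0 \<le> \<phi>" "\<phi> < 2 * pi" using Arg2pi[of "z / cis a"] by (auto simp: \<phi>_def)
  ultimately show ?thesis using z by (intro exI[of _ "a + \<phi>"]) (auto simp: Q_def)
qed

lemma Q_cont: "continuous_map euclideanreal X Q"
proof -
  have "continuous_map (top_of_set UNIV) X (\<lambda>t. g (cis t))"
    by (rule continuous_map_disc_compose[OF g]) (auto intro!: continuous_intros)
  then show ?thesis by (simp add: Q_def[abs_def])
qed

lemma l_inj: "p \<in> H \<Longrightarrow> inj_on (l p) {0..1}"
  using path_inj[of p] Q_l[of p] by (metis (no_types, lifting) inj_on_def)

lemma l_opp: "p \<in> H \<Longrightarrow> t \<in> {0..1} \<Longrightarrow> l (\<alpha> p) t = l p (1 - t)"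
proof (rule Q_inj)
  assume p: "p \<in> H" "t \<in> {0..1}"
  then have t: "1 - t \<in> {0..1}" by auto
  show "Q (l (\<alpha> p) t) = Q (l p (1 - t))" using Q_l[OF p(1) t] Q_l[OF opp[OF p(1)] p(2)] path_opp p by simp
  show "\<bar>l (\<alpha> p) t - l p (1 - t)\<bar> < 2 * pi"
    using l_range[OF p(1) t] l_range[OF opp[OF p(1)] p(2)] by linarith
qed

text \<open>The ends of the arcs are coloured by whether the arc is entered clockwise from there.\<close>

definition "c p \<longleftrightarrow> l p 1 < l p 0"

lemma l_mono:
  assumes "p \<in> H"
  shows "c p \<Longrightarrow> s \<in> {0..1} \<Longrightarrow> t \<in> {0..1} \<Longrightarrow> s < t \<Longrightarrow> l p t < l p s"
    "\<not> c p \<Longrightarrow> s \<in> {0..1} \<Longrightarrow> t \<in> {0..1} \<Longrightarrow> s < t \<Longrightarrow> l p s < l p t"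
proof -
  have "strict_mono_on {0..1} (l p) \<or> strict_antimono_on {0..1} (l p)"
    using injective_eq_monotone_map[of "{0..1}" "l p"] l_inj[OF assms] l_cont[OF assms] by (auto simp: is_interval_cc)
  then have "(\<forall>s\<in>{0..1}. \<forall>t\<in>{0..1}. s < t \<longrightarrow> l p s < l p t) \<or> (\<forall>s\<in>{0..1}. \<forall>t\<in>{0..1}. s < t \<longrightarrow> l p t < l p s)"
    by (auto simp: monotone_on_def)
  moreover have "(0::real) \<in> {0..1}" "(1::real) \<in> {0..1}" "(0::real) < 1" by auto
  ultimately show "c p \<Longrightarrow> s \<in> {0..1} \<Longrightarrow> t \<in> {0..1} \<Longrightarrow> s < t \<Longrightarrow> l p t < l p s"
    "\<not> c p \<Longrightarrow> s \<in> {0..1} \<Longrightarrow> t \<in> {0..1} \<Longrightarrow> s < t \<Longrightarrow> l p s < l p t"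
    unfolding c_def by (meson less_asym)+
qed

lemma c_opp: "p \<in> H \<Longrightarrow> c (\<alpha> p) \<noteq> c p"
  using l_opp[of p 0] l_opp[of p 1] l_inj[of p] by (auto simp: c_def inj_on_def) (metis atLeastAtMost_iff order_refl zero_le_one zero_neq_one less_linear)

lemma l_image: "p \<in> H \<Longrightarrow> \<not> c p \<Longrightarrow> l p ` {0..1} = {l p 0..l p 1}"
proof (intro equalityI subsetI)
  fix y assume p: "p \<in> H" "\<not> c p" and "y \<in> l p ` {0..1}"
  then obtain t where t: "t \<in> {0..1}" "y = l p t" by auto
  have "l p 0 \<le> l p t" using l_mono(2)[OF p, of 0 t] t(1) by (cases "t = 0") auto
  moreover have "l p t \<le> l p 1" using l_mono(2)[OF p, of t 1] t(1) by (cases "t = 1") auto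
  ultimately show "y \<in> {l p 0..l p 1}" using t by simp
next
  fix y assume p: "p \<in> H" "\<not> c p" and "y \<in> {l p 0..l p 1}"
  then have "\<exists>t\<ge>0. t \<le> 1 \<and> l p t = y" using IVT'[of "l p" 0 y 1] l_cont by auto
  then show "y \<in> l p ` {0..1}" by auto
qed

lemma seg_Q: "p \<in> H \<Longrightarrow> \<not> c p \<Longrightarrow> seg p = Q ` {l p 0..l p 1}"
  using l_image[of p] Q_l[of p] by (metis (no_types, lifting) image_cong image_image)

lemma l_disjoint:
  assumes "p \<in> H" "q \<in> H" "q \<notin> {p, \<alpha> p}" shows "l p ` {0..1} \<inter> l q ` {0..1} = {}"
proof -
  have "Q ` (l p ` {0..1}) = seg p" "Q ` (l q ` {0..1}) = seg q" using Q_l assms by (auto simp: image_image)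
  then show ?thesis using path_disjoint[OF assms] by blast
qed

text \<open>As \<open>t\<close> grows, the ends of the chord at time \<open>t\<close> move along two disjoint intervals in opposite senses, so
the chords are nested.\<close>

lemma chords_of_arcs_disjoint:
  assumes p: "p \<in> H" and q: "q \<in> H" and pq: "q \<notin> {p, \<alpha> p}" and c: "\<not> c p" "c q" and s: "s \<in> {0..1}" and t: "t \<in> {0..1}" and st: "s < t"
  shows "closed_segment (cis (l p s)) (cis (l q s)) \<inter> closed_segment (cis (l p t)) (cis (l q t)) = {}"
proof -
  have m: "l p s < l p t" "l q t < l q s" using l_mono p q c s t st by auto
  have aq: "\<alpha> q \<in> H" "\<not> c (\<alpha> q)" using opp c_opp q c by auto
  have iq: "l q ` {0..1} = {l q 1..l q 0}"
  proof -
    have "l q ` {0..1} = (\<lambda>t. l (\<alpha> q) (1 - t)) ` {0..1}"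
      using l_opp[OF q] by (intro image_cong) auto
    also have "\<dots> = l (\<alpha> q) ` ((\<lambda>t. 1 - t) ` {0..1})" by (simp only: image_image)
    finally show ?thesis using l_image[OF aq] l_opp[OF q, of 0] l_opp[OF q, of 1] by simp
  qed
  have "{l p 0..l p 1} \<inter> {l q 1..l q 0} = {}"
    using l_disjoint[OF p q pq] l_image[OF p c(1)] iq by simp
  moreover have "l p 0 < l p 1" "l q 1 < l q 0" using l_mono(2)[OF p c(1), of 0 1] l_mono(1)[OF q c(2), of 0 1] by auto
  ultimately have "l p 1 < l q 1 \<or> l q 0 < l p 0"
    by (metis (no_types, opaque_lifting) Int_atLeastAtMost atLeastatMost_empty_iff2 less_le_not_le linorder_le_less_linear max_def min_def order_less_imp_le)
  then show ?thesis
  proof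
    have r: "l p s \<in> {l p 0..l p 1}" "l p t \<in> {l p 0..l p 1}" "l q s \<in> {l q 1..l q 0}" "l q t \<in> {l q 1..l q 0}"
      using s t l_image[OF p c(1)] iq by blast+
    have w: "l q s < l p s + 2 * pi" "l p t < l q t + 2 * pi"
      using l_range[OF p s] l_range[OF p t] l_range[OF q s] l_range[OF q t] by auto
    {
      assume "l p 1 < l q 1"
      then show ?thesis using r m w by (intro nested_chords_disjoint) auto
    next
      assume "l q 0 < l p 0"
      then show ?thesis using r m w nested_chords_disjoint[of "l q t" "l q s" "l p s" "l p t"]
        by (auto simp: closed_segment_commute)
    }
  qed
qed

text \<open>The strip is swept out by the chords that join the points of the two arcs with equal parameters.\<close>

lemma band_of_arcs:
  assumes p: "p \<in> H" and q: "q \<in> H" and pq: "q \<notin> {p, \<alpha> p}" and c: "c p \<noteq> c q"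
  shows "band X D \<gamma> p q"
proof -
  define e where "e = (\<lambda>(x, t). (1 - x) *\<^sub>R cis (l p t) + x *\<^sub>R cis (l q t))"
  have cd: "closed_segment (cis (l p s)) (cis (l q s)) \<inter> closed_segment (cis (l p t)) (cis (l q t)) = {}"
    if st: "s \<in> {0..1}" "t \<in> {0..1}" "s < t" for s t
  proof (cases "c p")
    case False
    then show ?thesis using chords_of_arcs_disjoint[OF p q pq _ _ st] c by auto
  next
    case True
    have "p \<notin> {q, \<alpha> q}" using pq opp_opp[OF q] by auto
    then show ?thesis using chords_of_arcs_disjoint[OF q p _ _ _ st] True c by (simp add: closed_segment_commute)
  qed
  have eseg: "e (x, t) \<in> closed_segment (cis (l p t)) (cis (l q t))" if "x \<in> {0..1}" for x t
    using that by (auto simp: e_def closed_segment_def)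
  have ne: "cis (l p t) \<noteq> cis (l q t)" if "t \<in> {0..1}" for t
  proof -
    have "\<gamma> p t \<noteq> \<gamma> q t" using path_disjoint[OF p q pq] that by blast
    then show ?thesis using l_lift p q that by metis
  qed
  have inj: "inj_on e ({0..1} \<times> {0..1})"
  proof (rule inj_onI, clarify)
    fix x t x' t' :: real assume b: "x \<in> {0..1}" "t \<in> {0..1}" "x' \<in> {0..1}" "t' \<in> {0..1}" and eq: "e (x, t) = e (x', t')"
    have "t = t'"
    proof (rule ccontr)
      assume "t \<noteq> t'"
      then consider "t < t'" | "t' < t" by linarith
      then show False using cd[of t t'] cd[of t' t] eseg[of x t] eseg[of x' t'] b eq by cases auto
    qed
    then have "(x - x') *\<^sub>R (cis (l q t) - cis (l p t)) = 0" using eq by (simp add: e_def algebra_simps)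
    then show "x = x' \<and> t = t'" using ne[OF b(2)] \<open>t = t'\<close> by auto
  qed
  have n1: "norm (e y) \<le> 1" if y01: "y \<in> {0..1} \<times> {0..1}" for y
  proof -
    obtain x t where y: "y = (x, t)" "x \<in> {0..1}" using y01 by (cases y) auto
    have "closed_segment (cis (l p t)) (cis (l q t)) \<subseteq> cball 0 1"
      by (rule closed_segment_subset) auto
    then show ?thesis using eseg[OF y(2), of t] y(1) by auto
  qed
  have ce: "continuous_on ({0..1} \<times> {0..1}) e"
    unfolding e_def split_def
    by (intro continuous_intros continuous_on_compose2[OF l_cont[OF p]] continuous_on_compose2[OF l_cont[OF q]]) auto
  have "inj_on (\<lambda>y. g (e y)) ({0..1} \<times> {0..1})"
  proof (rule inj_onI)
    fix y y' assume y: "y \<in> {0..1} \<times> {0..1}" "y' \<in> {0..1} \<times> {0..1}" and "g (e y) = g (e y')"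
    then have "e y = e y'" using disc_param_eq_iff[OF g n1 n1] by blast
    then show "y = y'" using inj_onD[OF inj] y by blast
  qed
  moreover have "(\<lambda>y. g (e y)) ` ({0..1} \<times> {0..1}) \<subseteq> D" using n1 disc_paramD(3)[OF g] by auto
  moreover have "\<forall>t\<in>{0..1}. g (e (0, t)) = \<gamma> p t \<and> g (e (1, t)) = \<gamma> q t"
    using l_lift p q by (auto simp: e_def)
  ultimately show ?thesis unfolding band_def
    using continuous_map_disc_compose[OF g ce n1] by blast
qed

end

text \<open>The circle \<open>C\<close> around the disc \<open>D\<close> is divided alternately into the given arcs and the complementary arcs in \<open>\<T>\<close>. Each of the latter joins
two ends of different colours. Points of the complementary arcs are limits of points off the given arcs. One comes from any end
to any other by crossing arcs of the two kinds alternately. The disc contains bands between arcs that are entered in opposite senses.\<close>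

definition disc_arcs :: "'a topology \<Rightarrow> 'a set \<Rightarrow> 'a set \<Rightarrow> 'a set \<Rightarrow> ('a \<Rightarrow> 'a) \<Rightarrow> ('a \<Rightarrow> real \<Rightarrow> 'a) \<Rightarrow> ('a \<Rightarrow> bool) \<Rightarrow> 'a set set \<Rightarrow> bool" where
  "disc_arcs X D C H \<alpha> \<gamma> c \<T> \<longleftrightarrow>
     finite \<T> \<and> pairwise disjnt \<T> \<and> H \<subseteq> \<Union>\<T> \<and>
     (\<forall>p\<in>H. c (\<alpha> p) \<noteq> c p) \<and>
     (\<forall>T\<in>\<T>. connectedin X T \<and> closedin X T) \<and>
     (\<forall>T\<in>\<T>. \<exists>p\<in>H. \<exists>q\<in>H. T \<inter> H = {p, q} \<and> c p \<noteq> c q) \<and>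
     (\<forall>T\<in>\<T>. \<forall>p\<in>H. T \<inter> \<gamma> p ` {0..1} \<subseteq> H) \<and>
     C = \<Union>\<T> \<union> (\<Union>p\<in>H. \<gamma> p ` {0..1}) \<and>
     (\<forall>T\<in>\<T>. T \<subseteq> X closure_of (C - (\<Union>p\<in>H. \<gamma> p ` {0..1}))) \<and>
     (\<forall>W. W \<subseteq> H \<longrightarrow> W \<noteq> {} \<longrightarrow> \<alpha> ` W \<subseteq> W \<longrightarrow> (\<forall>T\<in>\<T>. T \<inter> W \<noteq> {} \<longrightarrow> T \<inter> H \<subseteq> W) \<longrightarrow> W = H) \<and>
     (\<forall>p\<in>H. \<forall>q\<in>H. q \<notin> {p, \<alpha> p} \<longrightarrow> c p \<noteq> c q \<longrightarrow> band X D \<gamma> p q)"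

context lifted_arcs
begin

text \<open>One of the two directions of each arc is counterclockwise, so the paths with \<open>\<not> c p\<close> enumerate the arcs.\<close>

lemma ex_sorted_arcs:
  "\<exists>xs. set xs = {p \<in> H. \<not> c p} \<and> sorted_wrt (\<lambda>p q. l p 1 < l q 0) xs"
proof -
  let ?S = "{p \<in> H. \<not> c p}"
  have inj: "inj_on (\<lambda>p. l p 0) ?S"
  proof (rule inj_onI)
    fix p q assume p: "p \<in> ?S" "q \<in> ?S" "l p 0 = l q 0"
    have "Q (l r 0) = r" if "r \<in> H" for r using Q_l[OF that, of 0] path_0[OF that] by simp
    then have "Q (l p 0) = p" "Q (l q 0) = q" using p by blast+
    then show "p = q" using p(3) by metis
  qed
  define ys where "ys = sorted_list_of_set ((\<lambda>p. l p 0) ` ?S)"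
  define xs where "xs = map (inv_into ?S (\<lambda>p. l p 0)) ys"
  have ys: "set ys = (\<lambda>p. l p 0) ` ?S" "sorted_wrt (<) ys"
    using finH by (auto simp: ys_def)
  have xs: "set xs = ?S" unfolding xs_def set_map ys(1) using inj by (simp add: inv_into_image_cancel)
  have *: "l p 1 < l q 0" if "p \<in> ?S" "q \<in> ?S" "l p 0 < l q 0" for p q
  proof (rule ccontr)
    assume n: "\<not> l p 1 < l q 0"
    have "q \<noteq> \<alpha> p" using that c_opp by auto
    then have "l p ` {0..1} \<inter> l q ` {0..1} = {}" using l_disjoint[of p q] that by auto
    then have "{l p 0..l p 1} \<inter> {l q 0..l q 1} = {}" using l_image that by auto
    moreover have "l q 0 \<in> {l p 0..l p 1}" using n that by auto
    moreover have "l q 0 \<in> {l q 0..l q 1}" using that by (auto simp: c_def)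
    ultimately show False by blast
  qed
  have "sorted_wrt (\<lambda>p q. l p 1 < l q 0) xs"
    unfolding xs_def sorted_wrt_map
  proof (rule sorted_wrt_mono_rel[OF _ ys(2)])
    fix x y assume xy: "x \<in> set ys" "y \<in> set ys" "x < y"
    then show "l (inv_into ?S (\<lambda>p. l p 0) x) 1 < l (inv_into ?S (\<lambda>p. l p 0) y) 0"
      using *[of "inv_into ?S (\<lambda>p. l p 0) x" "inv_into ?S (\<lambda>p. l p 0) y"]
        inv_into_into[of _ "\<lambda>p. l p 0" ?S] f_inv_into_f[of _ "\<lambda>p. l p 0" ?S]
      unfolding ys(1) by force
  qed
  then show ?thesis using xs by blast
qed

text \<open>List the arcs counterclockwise as intervals \<open>[a i, b i]\<close> of angles, and let \<open>a m\<close> be \<open>a 0\<close> plus a full turn. The complementary arcs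
are then the images of the intervals \<open>[b i, a (i + 1)]\<close>.\<close>

lemma ex_disc_arcs: "\<exists>\<T>. disc_arcs X D C H \<alpha> \<gamma> c \<T>"
proof -
  obtain xs where xs: "set xs = {p \<in> H. \<not> c p}" "sorted_wrt (\<lambda>p q. l p 1 < l q 0) xs"
    using ex_sorted_arcs by blast
  define m where "m = length xs"
  define a where "a = (\<lambda>i. if i < m then l (xs ! i) 0 else l (xs ! 0) 0 + 2 * pi)"
  define b where "b = (\<lambda>i. l (xs ! i) 1)"
  have xsH: "xs ! i \<in> H" "\<not> c (xs ! i)" if "i < m" for i
    using nth_mem[of i xs] xs(1) that by (auto simp: m_def)
  have m0: "m > 0"
  proof -
    obtain p where "p \<in> H" using neH by blast
    then have "p \<in> set xs \<or> \<alpha> p \<in> set xs" using xs(1) opp c_opp by auto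
    then show ?thesis by (auto simp: m_def)
  qed
  have am: "a m = a 0 + 2 * pi" using m0 by (simp add: a_def)
  have ab: "a i < b i" if "i < m" for i using xsH[OF that] l_mono(2)[of "xs ! i" 0 1] that by (auto simp: a_def b_def)
  have ba: "b i < a j" if "i < j" "j \<le> m" for i j
  proof (cases "j < m")
    case True
    then show ?thesis using sorted_wrt_nth_less[OF xs(2), of i j] that by (auto simp: a_def b_def m_def)
  next
    case False
    then have "a j = l (xs ! 0) 0 + 2 * pi" by (simp add: a_def)
    then show ?thesis using l_range[OF xsH(1), of i 1] l_range[OF xsH(1)[OF m0], of 0] that by (auto simp: b_def)
  qed
  have a0: "a 0 \<le> a i" if "i \<le> m" for i using ab[OF m0] ba[of 0 i] that by (cases "i = 0") auto
  have a0b: "a 0 < b i" if "i < m" for i using a0[of i] ab[OF that] that by auto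
  have bam: "b i < a 0 + 2 * pi" if "i < m" for i using ba[of i m] that am by auto
  have aSm: "a (Suc i) \<le> a 0 + 2 * pi" if "i < m" for i
  proof (cases "Suc i = m")
    case False
    then show ?thesis using ab[of "Suc i"] bam[of "Suc i"] that by auto
  qed (use am in auto)
  have Qa: "Q (a i) = xs ! i" if "i < m" for i using Q_l[OF xsH(1), of i 0] path_0[OF xsH(1)] that by (auto simp: a_def)
  have Qb: "Q (b i) = \<alpha> (xs ! i)" if "i < m" for i using Q_l[OF xsH(1), of i 1] path_1[OF xsH(1)] that by (auto simp: b_def)
  have Qam: "Q (a m) = xs ! 0" using am Qa[OF m0] Q_period by simp
  have QaS: "Q (a (Suc i)) = xs ! (if Suc i = m then 0 else Suc i)" if "i < m" for i
    using that Qa[of "Suc i"] Qam by auto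
  have segi: "seg (xs ! i) = Q ` {a i..b i}" if "i < m" for i
    using seg_Q[OF xsH[OF that]] that by (simp add: a_def b_def)
  have segs: "\<exists>i<m. (p = xs ! i \<or> p = \<alpha> (xs ! i)) \<and> seg p = Q ` {a i..b i}" if p: "p \<in> H" for p
  proof (cases "c p")
    case False
    then obtain i where "i < m" "p = xs ! i" using xs(1) p by (metis (mono_tags, lifting) in_set_conv_nth m_def mem_Collect_eq)
    then show ?thesis using segi by blast
  next
    case True
    then have "\<alpha> p \<in> set xs" using xs(1) p opp c_opp by auto
    then obtain i where i: "i < m" "\<alpha> p = xs ! i" by (metis in_set_conv_nth m_def)
    then have "p = \<alpha> (xs ! i)" using opp_opp[OF p] by simp
    then show ?thesis using segi[OF i(1)] i seg_opp[OF p] by metis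
  qed
  define arc where "arc = (\<lambda>i. Q ` {b i..a (Suc i)})"
  define \<T> where "\<T> = arc ` {..<m}"
  have baS: "b i < a (Suc i)" if "i < m" for i using ba[of i "Suc i"] that by auto
  \<comment> \<open>All complementary arcs lie in one half-open period, on which \<open>Q\<close> is injective.\<close>
  have per: "a 0 < \<theta> \<and> \<theta> \<le> a 0 + 2 * pi" if "i < m" "\<theta> \<in> {b i..a (Suc i)}" for i \<theta>
    using that a0b[of i] aSm[of i] by auto
  have Qper: "\<theta> = \<phi>" if "a 0 < \<theta> \<and> \<theta> \<le> a 0 + 2 * pi" "a 0 < \<phi> \<and> \<phi> \<le> a 0 + 2 * pi" "Q \<theta> = Q \<phi>" for \<theta> \<phi>
    by (rule Q_inj[OF that(3)]) (use that in linarith)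
  \<comment> \<open>The angle \<open>a 0\<close> lies outside the period and has to be replaced by \<open>a m\<close>.\<close>
  have meet: "(\<theta> = b i \<and> j = i) \<or> (\<theta> = a (Suc i) \<and> j = (if Suc i = m then 0 else Suc i))"
    if ij: "i < m" "j < m" and th: "\<theta> \<in> {b i..a (Suc i)}" and ph: "\<phi> \<in> {a j..b j}" and Q: "Q \<theta> = Q \<phi>" for i j \<theta> \<phi>
  proof (cases "\<phi> = a 0")
    case True
    then have "\<theta> = a 0 + 2 * pi" using Qper[of \<theta> "a 0 + 2 * pi"] per[OF ij(1) th] Q Q_period by simp
    then have e: "\<theta> = a (Suc i)" using th aSm[OF ij(1)] by auto
    have "Suc i = m"
    proof (rule ccontr)
      assume "Suc i \<noteq> m"
      then show False using e \<open>\<theta> = a 0 + 2 * pi\<close> ab[of "Suc i"] bam[of "Suc i"] ij by auto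
    qed
    moreover have "j = 0" using True ph a0b[of "j - 1"] ba[of "j - 1" j] ij by (cases j) auto
    ultimately show ?thesis using e by auto
  next
    case False
    then have "a 0 < \<phi> \<and> \<phi> \<le> a 0 + 2 * pi" using ph a0[of j] bam[of j] ij by auto
    then have e: "\<theta> = \<phi>" using Qper[OF per[OF ij(1) th] _ Q] by simp
    consider "j < i" | "j = i" | "j = Suc i" | "Suc i < j" by linarith
    then show ?thesis
    proof cases
      case 1
      then have "b j < b i" using ba[of j i] ab[of i] ij by auto
      then show ?thesis using th ph e by auto
    next
      case 2
      then show ?thesis using th ph e by auto
    next
      case 3
      then show ?thesis using th ph e ij by auto
    next
      case 4
      then have "a (Suc i) < a j" using ab[of "Suc i"] ba[of "Suc i" j] ij by auto
      then show ?thesis using th ph e by auto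
    qed
  qed
  define nx where "nx = (\<lambda>i. if Suc i = m then 0 else Suc i)"
  have nx: "nx i < m" if "i < m" for i using that by (auto simp: nx_def)
  have ends: "\<alpha> (xs ! i) \<in> arc i" "xs ! nx i \<in> arc i" if "i < m" for i
    using Qb[OF that] QaS[OF that] baS[OF that] unfolding arc_def nx_def
    by (metis atLeastAtMost_iff image_eqI less_imp_le order_refl)+
  have arcseg: "arc i \<inter> seg p \<subseteq> {\<alpha> (xs ! i), xs ! nx i}" if ip: "i < m" "p \<in> H" for i p
  proof
    fix x assume x: "x \<in> arc i \<inter> seg p"
    obtain j where j: "j < m" "seg p = Q ` {a j..b j}" using segs[OF ip(2)] by blast
    obtain \<theta> \<phi> where *: "\<theta> \<in> {b i..a (Suc i)}" "x = Q \<theta>" "\<phi> \<in> {a j..b j}" "x = Q \<phi>"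
      using x j by (auto simp: arc_def)
    then have "\<theta> = b i \<or> \<theta> = a (Suc i)" using meet[OF ip(1) j(1) *(1,3)] by auto
    then show "x \<in> {\<alpha> (xs ! i), xs ! nx i}" using *(2) Qb[OF ip(1)] QaS[OF ip(1)] by (auto simp: nx_def)
  qed
  have segself: "p \<in> seg p" if "p \<in> H" for p using path_0[OF that] imageI[of 0 "{0..1}" "\<gamma> p"] by simp
  have arcH: "arc i \<inter> H = {\<alpha> (xs ! i), xs ! nx i}" if "i < m" for i
  proof
    show "{\<alpha> (xs ! i), xs ! nx i} \<subseteq> arc i \<inter> H"
      using ends[OF that] opp[OF xsH(1)[OF that]] xsH(1)[OF nx[OF that]] by simp
    show "arc i \<inter> H \<subseteq> {\<alpha> (xs ! i), xs ! nx i}"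
    proof
      fix x assume x: "x \<in> arc i \<inter> H"
      then have "x \<in> arc i \<inter> seg x" using segself[of x] by simp
      then show "x \<in> {\<alpha> (xs ! i), xs ! nx i}" using arcseg[OF that, of x] x by blast
    qed
  qed
  have col: "c (\<alpha> (xs ! i)) \<noteq> c (xs ! nx i)" if "i < m" for i
    using xsH[OF that] xsH[OF nx[OF that]] c_opp by auto
  have disj: "arc i \<inter> arc j = {}" if "i < m" "j < m" "i \<noteq> j" for i j
  proof -
    have *: "arc i \<inter> arc j = {}" if ij: "i < j" "j < m" for i j
    proof (rule ccontr)
      assume "arc i \<inter> arc j \<noteq> {}"
      then obtain x where x: "x \<in> arc i" "x \<in> arc j" by blast
      obtain \<theta> where th: "\<theta> \<in> {b i..a (Suc i)}" "x = Q \<theta>" using x(1) unfolding arc_def by blast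
      obtain \<phi> where ph: "\<phi> \<in> {b j..a (Suc j)}" "x = Q \<phi>" using x(2) unfolding arc_def by blast
      have "\<theta> = \<phi>" using Qper[OF per[of i \<theta>] per[of j \<phi>]] ij th ph by simp
      moreover have "a (Suc i) < b j"
        using ij ab[of "Suc i"] ba[of "Suc i" j] ab[of j] by (cases "Suc i = j") auto
      ultimately show False using th ph by auto
    qed
    show ?thesis using *[of i j] *[of j i] that by (metis Int_commute linorder_neqE_nat)
  qed
  have cover: "\<exists>i<m. \<theta> \<in> {a i..b i} \<or> \<theta> \<in> {b i..a (Suc i)}" if "a 0 \<le> \<theta>" "\<theta> < a 0 + 2 * pi" for \<theta>
  proof -
    have "\<exists>i<k. \<theta> \<in> {a i..b i} \<or> \<theta> \<in> {b i..a (Suc i)}" if "\<theta> < a k" "k \<le> m" for k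
      using that
    proof (induction k)
      case 0
      then show ?case using \<open>a 0 \<le> \<theta>\<close> by simp
    next
      case (Suc k)
      show ?case
      proof (cases "\<theta> < a k")
        case True
        then show ?thesis using Suc less_Suc_eq by auto
      next
        case False
        then show ?thesis using Suc by (intro exI[of _ k]) auto
      qed
    qed
    then show ?thesis using that am by auto
  qed
  have arcC: "arc i \<subseteq> C" for i using Q_circle by (auto simp: arc_def)
  have segC: "seg p \<subseteq> C" if "p \<in> H" for p using path_circle that by blast
  have CU: "C = \<Union>\<T> \<union> (\<Union>p\<in>H. seg p)"
  proof
    show "\<Union>\<T> \<union> (\<Union>p\<in>H. seg p) \<subseteq> C" using arcC segC unfolding \<T>_def by blast
    show "C \<subseteq> \<Union>\<T> \<union> (\<Union>p\<in>H. seg p)"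
    proof
      fix x assume "x \<in> C"
      then obtain \<theta> where th: "a 0 \<le> \<theta>" "\<theta> < a 0 + 2 * pi" "x = Q \<theta>" using Q_onto by blast
      then obtain i where i: "i < m" "\<theta> \<in> {a i..b i} \<or> \<theta> \<in> {b i..a (Suc i)}" using cover by blast
      then have "x \<in> seg (xs ! i) \<or> x \<in> arc i" using th(3) segi[OF i(1)] by (auto simp: arc_def)
      then show "x \<in> \<Union>\<T> \<union> (\<Union>p\<in>H. seg p)" using xsH(1)[OF i(1)] i(1) by (auto simp: \<T>_def)
    qed
  qed
  have con: "connectedin X (arc i) \<and> closedin X (arc i)" for i
  proof
    show "connectedin X (arc i)" unfolding arc_def
      by (rule connectedin_continuous_map_image[OF Q_cont]) (auto simp: connectedin_iff_connected)
    show "closedin X (arc i)" unfolding arc_def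
      by (rule compactin_imp_closedin[OF X]) (auto intro!: image_compactin[OF _ Q_cont])
  qed
  have clos: "arc i \<subseteq> X closure_of (C - (\<Union>p\<in>H. seg p))" if "i < m" for i
  proof -
    have "{b i<..<a (Suc i)} \<noteq> {}" using baS[OF that] by auto
    then have "{b i..a (Suc i)} = euclideanreal closure_of {b i<..<a (Suc i)}"
      using baS[OF that] by (simp add: closure_greaterThanLessThan)
    then have "arc i \<subseteq> X closure_of (Q ` {b i<..<a (Suc i)})"
      unfolding arc_def using continuous_map_image_closure_subset[OF Q_cont] by metis
    moreover have "Q ` {b i<..<a (Suc i)} \<subseteq> C - (\<Union>p\<in>H. seg p)"
    proof clarify
      fix \<theta> assume th: "\<theta> \<in> {b i<..<a (Suc i)}"
      have "Q \<theta> \<notin> seg p" if p: "p \<in> H" for p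
      proof
        assume "Q \<theta> \<in> seg p"
        obtain j where j: "j < m" "seg p = Q ` {a j..b j}" using segs[OF p] by blast
        then obtain \<phi> where "\<phi> \<in> {a j..b j}" "Q \<theta> = Q \<phi>" using \<open>Q \<theta> \<in> seg p\<close> by auto
        then show False using th meet[OF \<open>i < m\<close> j(1), of \<theta> \<phi>] by auto
      qed
      then show "Q \<theta> \<in> C - (\<Union>p\<in>H. seg p)" using Q_circle by auto
    qed
    ultimately show ?thesis using closure_of_mono by blast
  qed
  have walk: "W = H" if W: "W \<subseteq> H" "W \<noteq> {}" "\<alpha> ` W \<subseteq> W" "\<forall>T\<in>\<T>. T \<inter> W \<noteq> {} \<longrightarrow> T \<inter> H \<subseteq> W" for W
  proof -
    have step: "xs ! nx i \<in> W" if "i < m" "xs ! i \<in> W" for i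
    proof -
      have "\<alpha> (xs ! i) \<in> W" using that W(3) by blast
      then have "arc i \<inter> W \<noteq> {}" using ends[OF that(1)] by blast
      then show ?thesis using W(4) arcH[OF that(1)] that(1) by (auto simp: \<T>_def)
    qed
    have up: "xs ! j \<in> W" if "i \<le> j" "j < m" "xs ! i \<in> W" for i j
      using that
    proof (induction j)
      case (Suc j)
      show ?case
      proof (cases "i = Suc j")
        case False
        then have "xs ! j \<in> W" using Suc by auto
        then show ?thesis using step[of j] Suc.prems by (auto simp: nx_def)
      qed (use Suc in simp)
    qed simp
    obtain p where "p \<in> W" using W by blast
    then obtain i where i: "i < m" "p = xs ! i \<or> p = \<alpha> (xs ! i)" using segs W(1) by blast
    then have "xs ! i \<in> W" using \<open>p \<in> W\<close> W(3) opp_opp[OF xsH(1)[OF i(1)]] by (metis image_subset_iff)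
    then have "xs ! (m - 1) \<in> W" using up[of i "m - 1"] i by auto
    then have "xs ! 0 \<in> W" using step[of "m - 1"] m0 by (auto simp: nx_def)
    then have all: "xs ! j \<in> W" if "j < m" for j using up that by blast
    have "H \<subseteq> W"
    proof
      fix q assume "q \<in> H"
      then obtain i where i: "i < m" "q = xs ! i \<or> q = \<alpha> (xs ! i)" using segs by blast
      then show "q \<in> W" using all W(3) by blast
    qed
    then show ?thesis using W(1) by blast
  qed
  have HT: "H \<subseteq> \<Union>\<T>"
  proof
    fix q assume "q \<in> H"
    then obtain i where i: "i < m" "q = xs ! i \<or> q = \<alpha> (xs ! i)" using segs by blast
    define k where "k = (if i = 0 then m - 1 else i - 1)"
    have "k < m" "nx k = i" using i m0 by (auto simp: k_def nx_def)
    then have "xs ! i \<in> arc k" using ends(2)[of k] by simp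
    then show "q \<in> \<Union>\<T>" using i ends(1)[OF i(1)] \<open>k < m\<close> by (auto simp: \<T>_def)
  qed
  have pw: "pairwise disjnt \<T>" unfolding pairwise_def disjnt_def \<T>_def using disj by blast
  have ex: "\<exists>p\<in>H. \<exists>q\<in>H. T \<inter> H = {p, q} \<and> c p \<noteq> c q" if T: "T \<in> \<T>" for T
  proof -
    obtain i where i: "i < m" "T = arc i" using T by (auto simp: \<T>_def)
    show ?thesis unfolding i(2) arcH[OF i(1)] using col[OF i(1)] opp[OF xsH(1)[OF i(1)]] xsH(1)[OF nx[OF i(1)]] by blast
  qed
  have TS: "T \<inter> seg p \<subseteq> H" if T: "T \<in> \<T>" and p: "p \<in> H" for T p
  proof -
    obtain i where i: "i < m" "T = arc i" using T by (auto simp: \<T>_def)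
    show ?thesis using arcseg[OF i(1) p] arcH[OF i(1)] i(2) by blast
  qed
  have conT: "connectedin X T \<and> closedin X T" if "T \<in> \<T>" for T using that con by (auto simp: \<T>_def)
  have closT: "T \<subseteq> X closure_of (C - (\<Union>p\<in>H. seg p))" if "T \<in> \<T>" for T
    using that clos unfolding \<T>_def by blast
  have "disc_arcs X D C H \<alpha> \<gamma> c \<T>"
    unfolding disc_arcs_def
  proof (intro conjI)
    show "finite \<T>" by (simp add: \<T>_def)
    show "\<forall>p\<in>H. c (\<alpha> p) \<noteq> c p" using c_opp by blast
    show "\<forall>T\<in>\<T>. connectedin X T \<and> closedin X T" using conT by blast
    show "\<forall>T\<in>\<T>. \<exists>p\<in>H. \<exists>q\<in>H. T \<inter> H = {p, q} \<and> c p \<noteq> c q" using ex by blast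
    show "\<forall>T\<in>\<T>. \<forall>p\<in>H. T \<inter> seg p \<subseteq> H" using TS by blast
    show "\<forall>T\<in>\<T>. T \<subseteq> X closure_of (C - (\<Union>p\<in>H. seg p))" using closT by blast
    show "\<forall>W. W \<subseteq> H \<longrightarrow> W \<noteq> {} \<longrightarrow> \<alpha> ` W \<subseteq> W \<longrightarrow> (\<forall>T\<in>\<T>. T \<inter> W \<noteq> {} \<longrightarrow> T \<inter> H \<subseteq> W) \<longrightarrow> W = H"
      using walk by blast
    show "\<forall>p\<in>H. \<forall>q\<in>H. q \<notin> {p, \<alpha> p} \<longrightarrow> c p \<noteq> c q \<longrightarrow> band X D \<gamma> p q" using band_of_arcs by blast
  qed (use pw HT CU in auto)
  then show ?thesis by blast
qed

end


lemma continuous_on_Arg2pi_off_1: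
  assumes "continuous_on S v" "\<And>t. t \<in> S \<Longrightarrow> norm (v t) = 1 \<and> v t \<noteq> (1 :: complex)"
  shows "continuous_on S (\<lambda>t. Arg2pi (v t))"
proof -
  have "continuous_on (v ` S) Arg2pi"
  proof (rule continuous_at_imp_continuous_on, clarify)
    fix t assume "t \<in> S"
    then have n: "norm (v t) = 1" "v t \<noteq> 1" using assms by auto
    have "v t \<notin> \<real>\<^sub>\<ge>\<^sub>0"
    proof
      assume "v t \<in> \<real>\<^sub>\<ge>\<^sub>0"
      then obtain r where "v t = of_real r" "0 \<le> r" by (rule nonneg_Reals_cases)
      then show False using n by auto
    qed
    then show "isCont Arg2pi (v t)" by (rule continuous_at_Arg2pi)
  qed
  then show ?thesis using continuous_on_compose2[OF _ assms(1)] by blast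
qed

context arcs_on_circle
begin

text \<open>A connected circle covered by finitely many disjoint closed arcs would consist of a single arc, but an arc
is contractible and the circle is not.\<close>

lemma ex_point_off_arcs:
  assumes g: "disc_param X D g" and C: "C = g ` sphere 0 1"
    and u: "\<And>p. p \<in> H \<Longrightarrow> continuous_on {0..1} (u p)"
      "\<And>p t. p \<in> H \<Longrightarrow> t \<in> {0..1} \<Longrightarrow> norm (u p t) = 1 \<and> g (u p t) = \<gamma> p t"
  shows "\<exists>z. norm z = 1 \<and> (\<forall>p\<in>H. z \<notin> u p ` {0..1})"
proof (rule ccontr)
  assume "\<not> ?thesis"
  then have cov: "sphere 0 1 \<subseteq> (\<Union>p\<in>H. u p ` {0..1})" by auto
  have gu: "g ` (u p ` {0..1}) = seg p" if "p \<in> H" for p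
    using u(2)[OF that] by (auto simp: image_image)
  have comp: "compact (u p ` {0..1})" if "p \<in> H" for p
    using u(1)[OF that] compact_continuous_image by blast
  have sub: "u p ` {0..1} \<subseteq> sphere 0 1" if "p \<in> H" for p using u(2)[OF that] by auto
  obtain p where p: "p \<in> H" using neH by blast
  define B where "B = (\<Union>q\<in>H - {p, \<alpha> p}. u q ` {0..1})"
  have eq: "u (\<alpha> p) ` {0..1} = u p ` {0..1}"
  proof -
    have "inj_on g (sphere 0 1)" using disc_paramD(2)[OF g] by (rule inj_on_subset) auto
    moreover have "g ` (u (\<alpha> p) ` {0..1}) = g ` (u p ` {0..1})" using gu p opp seg_opp by simp
    ultimately show ?thesis using sub p opp by (meson inj_on_image_eq_iff)
  qed
  have "closed B" unfolding B_def using finH comp by (intro closed_UN) (auto intro: compact_imp_closed)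
  moreover have "closed (u p ` {0..1})" using comp[OF p] compact_imp_closed by blast
  moreover have cB: "sphere 0 1 \<subseteq> u p ` {0..1} \<union> B"
  proof
    fix x assume "x \<in> sphere (0::complex) 1"
    then obtain q where q: "q \<in> H" "x \<in> u q ` {0..1}" using cov by blast
    consider "q = p" | "q = \<alpha> p" | "q \<in> H - {p, \<alpha> p}" using q(1) by blast
    then show "x \<in> u p ` {0..1} \<union> B" using q(2) eq unfolding B_def by cases auto
  qed
  moreover have "u p ` {0..1} \<inter> B = {}"
  proof -
    have "u p ` {0..1} \<inter> u q ` {0..1} = {}" if q: "q \<in> H - {p, \<alpha> p}" for q
    proof -
      have "g ` (u p ` {0..1}) \<inter> g ` (u q ` {0..1}) = {}"
        using path_disjoint[OF p, of q] q gu[OF p] gu[of q] by simp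
      then show ?thesis by blast
    qed
    then show ?thesis unfolding B_def by blast
  qed
  moreover have "connected (sphere (0::complex) 1)" by (rule connected_sphere) simp
  ultimately have "u p ` {0..1} \<inter> sphere 0 1 = {} \<or> B \<inter> sphere 0 1 = {}"
    using connected_closedD[of "sphere 0 1" "u p ` {0..1}" B] by blast
  moreover have "u p 0 \<in> u p ` {0..1} \<inter> sphere 0 1" using u(2)[OF p, of 0] by auto
  ultimately have "B \<inter> sphere 0 1 = {}" by blast
  then have whole: "u p ` {0..1} = sphere 0 1" using cB sub[OF p] by blast
  have "inj_on (u p) {0..1}"
  proof (rule inj_onI)
    fix s t :: real assume "s \<in> {0..1}" "t \<in> {0..1}" "u p s = u p t"
    moreover from this have "\<gamma> p s = \<gamma> p t" using u(2)[OF p] by metis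
    ultimately show "s = t" using path_inj[OF p] by (auto simp: inj_on_def)
  qed
  then have "{0..1::real} homeomorphic sphere (0::complex) 1"
    using homeomorphic_compact[OF _ u(1)[OF p] whole] by simp
  then have "contractible (sphere (0::complex) 1)"
    using homeomorphic_contractible_eq convex_imp_contractible[of "{0..1::real}"] by auto
  then show False by (simp add: contractible_sphere)
qed

theorem ex_disc_arcs_of_disc:
  assumes g: "disc_param X D g" and C: "C = g ` sphere 0 1"
  shows "\<exists>c \<T>. disc_arcs X D C H \<alpha> \<gamma> c \<T>"
proof -
  have CD: "C \<subseteq> D" unfolding C disc_paramD(3)[OF g, symmetric] by auto
  have "\<exists>u. continuous_on {0..1} u \<and> (\<forall>t\<in>{0..1}. norm (u t) = 1 \<and> g (u t) = \<gamma> p t)" if p: "p \<in> H" for p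
  proof -
    have "\<gamma> p ` {0..1} \<subseteq> D" using path_circle[OF p] CD by blast
    from disc_lift[OF X g path_cont[OF p] this]
    obtain u where u: "continuous_on {0..1} u" "\<forall>t\<in>{0..1}. norm (u t) \<le> 1 \<and> g (u t) = \<gamma> p t" by blast
    have "norm (u t) = 1" if t: "t \<in> {0..1}" for t
    proof -
      have "\<gamma> p t \<in> g ` sphere 0 1" using path_circle[OF p] C t by blast
      then obtain z where "norm z = 1" "\<gamma> p t = g z" by force
      then show ?thesis using u(2) t disc_param_eq_iff[OF g, of z "u t"] by auto
    qed
    then show ?thesis using u by blast
  qed
  then obtain u where u: "\<And>p. p \<in> H \<Longrightarrow> continuous_on {0..1} (u p)"
      "\<And>p t. p \<in> H \<Longrightarrow> t \<in> {0..1} \<Longrightarrow> norm (u p t) = 1 \<and> g (u p t) = \<gamma> p t"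
    by metis
  obtain z where z: "norm z = 1" "\<And>p. p \<in> H \<Longrightarrow> z \<notin> u p ` {0..1}"
    using ex_point_off_arcs[OF g C u] by blast
  have z0: "z \<noteq> 0" using z by auto
  define g' where "g' = (\<lambda>w. g (z * w))"
  define l where "l = (\<lambda>p t. Arg2pi (u p t / z))"
  have rot: "(\<lambda>w. z * w) ` cball 0 1 = cball 0 1" "(\<lambda>w. z * w) ` sphere 0 1 = sphere 0 1"
  proof -
    have *: "w = z * (w / z)" "norm (w / z) = norm w" for w using z z0 by (simp_all add: norm_divide)
    show "(\<lambda>w. z * w) ` cball 0 1 = cball 0 1"
    proof
      show "cball 0 1 \<subseteq> (\<lambda>w. z * w) ` cball 0 1"
      proof
        fix w assume "w \<in> cball (0::complex) 1"
        then show "w \<in> (\<lambda>w. z * w) ` cball 0 1" using * by (intro image_eqI[of _ _ "w / z"]) auto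
      qed
    qed (use z in \<open>auto simp: norm_mult\<close>)
    show "(\<lambda>w. z * w) ` sphere 0 1 = sphere 0 1"
    proof
      show "sphere 0 1 \<subseteq> (\<lambda>w. z * w) ` sphere 0 1"
      proof
        fix w assume "w \<in> sphere (0::complex) 1"
        then show "w \<in> (\<lambda>w. z * w) ` sphere 0 1" using * by (intro image_eqI[of _ _ "w / z"]) auto
      qed
    qed (use z in \<open>auto simp: norm_mult\<close>)
  qed
  have g': "disc_param X D g'"
    unfolding disc_param_def
  proof (intro conjI)
    show "continuous_map (top_of_set (cball 0 1)) X g'"
      unfolding g'_def using z by (intro continuous_map_disc_compose[OF g] continuous_intros) (auto simp: norm_mult)
    show "inj_on g' (cball 0 1)"
      using disc_param_eq_iff[OF g] z z0 by (auto simp: inj_on_def g'_def norm_mult)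
    show "g' ` cball 0 1 = D"
      using disc_paramD(3)[OF g] rot(1) unfolding g'_def by (metis image_image)
  qed
  have C': "C = g' ` sphere 0 1" unfolding C g'_def using rot(2) by (metis image_image)
  have v: "norm (u p t / z) = 1" "u p t / z \<noteq> 1" if "p \<in> H" "t \<in> {0..1}" for p t
    using u(2)[OF that] z(1) z(2)[OF that(1)] that(2) z0 by (auto simp: norm_divide)
  have lexp: "cis (l p t) = u p t / z" if "p \<in> H" "t \<in> {0..1}" for p t
    using complex_norm_eq_1_exp[of "u p t / z"] v[OF that] by (simp add: l_def cis_conv_exp)
  interpret lifted_arcs X C H \<alpha> \<gamma> D g' l
  proof
    show "continuous_on {0..1} (l p)" if "p \<in> H" for p
      unfolding l_def using u(1)[OF that] v[OF that] z0
      by (intro continuous_on_Arg2pi_off_1 continuous_intros) auto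
    show "0 < l p t \<and> l p t < 2 * pi" if "p \<in> H" "t \<in> {0..1}" for p t
    proof -
      have "l p t \<noteq> 0" using lexp[OF that] v[OF that] by auto
      moreover have "0 \<le> l p t" "l p t < 2 * pi" using Arg2pi[of "u p t / z"] by (auto simp: l_def)
      ultimately show ?thesis by simp
    qed
    show "g' (cis (l p t)) = \<gamma> p t" if "p \<in> H" "t \<in> {0..1}" for p t
      using u(2)[OF that] z0 by (simp add: g'_def lexp[OF that])
  qed (use g' C' in auto)
  show ?thesis using ex_disc_arcs by blast
qed

end

section \<open>Concatenation of bands\<close>

definition stack :: "(real \<times> real \<Rightarrow> 'a) \<Rightarrow> (real \<times> real \<Rightarrow> 'a) \<Rightarrow> real \<times> real \<Rightarrow> 'a" where
  "stack h k = (\<lambda>z. if fst z \<le> 1/2 then h (2 * fst z, snd z) else k (2 * fst z - 1, snd z))"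

lemma continuous_map_square_compose:
  assumes "continuous_map (top_of_set ({0..1} \<times> {0..1})) X (h :: real \<times> real \<Rightarrow> 'a)"
    and "continuous_on S f" "f ` S \<subseteq> {0..1} \<times> {0..1}"
  shows "continuous_map (top_of_set S) X (\<lambda>z. h (f z))"
proof -
  have "continuous_map (top_of_set S) (top_of_set ({0..1} \<times> {0..1})) f"
    using assms(2,3) by (auto simp: continuous_map_in_subtopology)
  from continuous_map_compose[OF this assms(1)] show ?thesis by (simp add: comp_def)
qed

lemma continuous_map_stack:
  assumes h: "continuous_map (top_of_set ({0..1} \<times> {0..1})) X h"
    and k: "continuous_map (top_of_set ({0..1} \<times> {0..1})) X k"
    and hk: "\<And>t. t \<in> {0..1} \<Longrightarrow> h (1, t) = k (0, t)"
  shows "continuous_map (top_of_set ({0..1} \<times> {0..1})) X (stack h k)"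
  unfolding stack_def
proof (rule continuous_map_cases_le)
  let ?S = "{0..1} \<times> {0..1} :: (real \<times> real) set"
  have "continuous_map (top_of_set {z \<in> ?S. fst z \<le> 1/2}) X (\<lambda>z. h (2 * fst z, snd z))"
    by (rule continuous_map_square_compose[OF h]) (auto intro!: continuous_intros)
  moreover have "?S \<inter> {z \<in> topspace (top_of_set ?S). fst z \<le> 1/2} = {z \<in> ?S. fst z \<le> 1/2}" by auto
  ultimately show "continuous_map (subtopology (top_of_set ?S) {z \<in> topspace (top_of_set ?S). fst z \<le> 1/2}) X (\<lambda>z. h (2 * fst z, snd z))"
    by (simp only: subtopology_subtopology)
  have "continuous_map (top_of_set {z \<in> ?S. 1/2 \<le> fst z}) X (\<lambda>z. k (2 * fst z - 1, snd z))"
    by (rule continuous_map_square_compose[OF k]) (auto intro!: continuous_intros)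
  moreover have "?S \<inter> {z \<in> topspace (top_of_set ?S). 1/2 \<le> fst z} = {z \<in> ?S. 1/2 \<le> fst z}" by auto
  ultimately show "continuous_map (subtopology (top_of_set ?S) {z \<in> topspace (top_of_set ?S). 1/2 \<le> fst z}) X (\<lambda>z. k (2 * fst z - 1, snd z))"
    by (simp only: subtopology_subtopology)
  show "h (2 * fst z, snd z) = k (2 * fst z - 1, snd z)" if "z \<in> topspace (top_of_set ?S)" "fst z = 1/2" for z
  proof -
    have "2 * fst z = 1" using that by simp
    then show ?thesis unfolding \<open>2 * fst z = 1\<close> using hk[of "snd z"] that by (simp add: mem_Times_iff)
  qed
qed (auto intro!: continuous_intros)

lemma stack_simps:
  "s \<le> 1/2 \<Longrightarrow> stack h k (s, t) = h (2 * s, t)"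
  "1/2 < s \<Longrightarrow> stack h k (s, t) = k (2 * s - 1, t)"
  by (auto simp: stack_def)

lemma band_mono: "band X Z \<gamma> p q \<Longrightarrow> Z \<subseteq> Z' \<Longrightarrow> band X Z' \<gamma> p q"
  unfolding band_def by (meson order_trans)

text \<open>The two strips may only meet in the common end, where the parametrizations agree.\<close>

lemma band_join:
  assumes "band X Z \<gamma> p q" "band X Z' \<gamma> q r" and ZZ: "Z \<inter> Z' \<subseteq> \<gamma> q ` {0..1}"
  shows "band X (Z \<union> Z') \<gamma> p r"
proof -
  let ?S = "{0..1} \<times> {0..1} :: (real \<times> real) set"
  obtain h where h: "continuous_map (top_of_set ?S) X h" "inj_on h ?S" "h ` ?S \<subseteq> Z"
      "\<And>t. t \<in> {0..1} \<Longrightarrow> h (0, t) = \<gamma> p t \<and> h (1, t) = \<gamma> q t"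
    using assms(1) by (auto simp: band_def)
  obtain k where k: "continuous_map (top_of_set ?S) X k" "inj_on k ?S" "k ` ?S \<subseteq> Z'"
      "\<And>t. t \<in> {0..1} \<Longrightarrow> k (0, t) = \<gamma> q t \<and> k (1, t) = \<gamma> r t"
    using assms(2) by (auto simp: band_def)
  have hinj: "h (a, b) = h (a', b') \<longleftrightarrow> a = a' \<and> b = b'"
    if "a \<in> {0..1}" "b \<in> {0..1}" "a' \<in> {0..1}" "b' \<in> {0..1}" for a b a' b'
    using inj_on_eq_iff[OF h(2), of "(a, b)" "(a', b')"] that by simp
  have kinj: "k (a, b) = k (a', b') \<longleftrightarrow> a = a' \<and> b = b'"
    if "a \<in> {0..1}" "b \<in> {0..1}" "a' \<in> {0..1}" "b' \<in> {0..1}" for a b a' b'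
    using inj_on_eq_iff[OF k(2), of "(a, b)" "(a', b')"] that by simp
  have con: "continuous_map (top_of_set ?S) X (stack h k)"
    by (rule continuous_map_stack[OF h(1) k(1)]) (use h(4) k(4) in auto)
  have sep: "stack h k (s, t) \<noteq> stack h k (s', t')"
    if b: "s \<in> {0..1}" "t \<in> {0..1}" "s' \<in> {0..1}" "t' \<in> {0..1}" and s: "s \<le> 1/2" "1/2 < s'" for s t s' t'
  proof
    assume "stack h k (s, t) = stack h k (s', t')"
    then have e: "h (2 * s, t) = k (2 * s' - 1, t')" using s by (simp add: stack_simps)
    have sq: "(2 * s, t) \<in> ?S" "(2 * s' - 1, t') \<in> ?S" using b s by auto
    then have "h (2 * s, t) \<in> Z \<inter> Z'" using e h(3) k(3) by (metis IntI image_subset_iff)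
    then obtain \<tau> where \<tau>: "\<tau> \<in> {0..1}" "h (2 * s, t) = \<gamma> q \<tau>" using ZZ by blast
    then have "k (2 * s' - 1, t') = k (0, \<tau>)" using e k(4) by simp
    then show False using kinj[of "2 * s' - 1" t' 0 \<tau>] sq \<tau>(1) s by auto
  qed
  have "inj_on (stack h k) ?S"
  proof (rule inj_onI, clarify)
    fix s t s' t' :: real assume b: "s \<in> {0..1}" "t \<in> {0..1}" "s' \<in> {0..1}" "t' \<in> {0..1}"
      and e: "stack h k (s, t) = stack h k (s', t')"
    consider "s \<le> 1/2" "s' \<le> 1/2" | "1/2 < s" "1/2 < s'" | "s \<le> 1/2" "1/2 < s'" | "1/2 < s" "s' \<le> 1/2" by linarith
    then show "s = s' \<and> t = t'"
    proof cases
      case 1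
      then show ?thesis using e b hinj[of "2 * s" t "2 * s'" t'] by (auto simp: stack_simps)
    next
      case 2
      then show ?thesis using e b kinj[of "2 * s - 1" t "2 * s' - 1" t'] by (auto simp: stack_simps)
    qed (use e sep[OF b] sep[OF b(3,4,1,2)] in auto)
  qed
  moreover have "stack h k ` ?S \<subseteq> Z \<union> Z'"
  proof clarify
    fix s t :: real assume b: "s \<in> {0..1}" "t \<in> {0..1}" "stack h k (s, t) \<notin> Z'"
    show "stack h k (s, t) \<in> Z"
    proof (cases "s \<le> 1/2")
      case True
      then have "(2 * s, t) \<in> ?S" using b by auto
      then show ?thesis using h(3) True by (auto simp: stack_simps)
    next
      case False
      then have "(2 * s - 1, t) \<in> ?S" using b by auto
      then have "k (2 * s - 1, t) \<in> Z'" using k(3) by blast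
      then show ?thesis using False b(3) by (auto simp: stack_simps)
    qed
  qed
  moreover have "\<forall>t\<in>{0..1}. stack h k (0, t) = \<gamma> p t \<and> stack h k (1, t) = \<gamma> r t"
    using h(4) k(4) by (auto simp: stack_def)
  ultimately show ?thesis using con unfolding band_def by blast
qed

text \<open>The second strip starts at the end of the first one with the opposite direction. Turning the second
strip over makes the strips fit there and introduces the half twist at its other end.\<close>

lemma moebius_band_of_bands:
  assumes "band X Z \<gamma> p q" "band X Z' \<gamma> q' p"
    and q': "\<And>t. t \<in> {0..1} \<Longrightarrow> \<gamma> q' t = \<gamma> q (1 - t)"
    and ZZ: "Z \<inter> Z' \<subseteq> \<gamma> p ` {0..1} \<union> \<gamma> q ` {0..1}"
  shows "\<exists>m. moebius_band_in X m"
proof -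
  let ?S = "{0..1} \<times> {0..1} :: (real \<times> real) set"
  obtain h where h: "continuous_map (top_of_set ?S) X h" "inj_on h ?S" "h ` ?S \<subseteq> Z"
      "\<And>t. t \<in> {0..1} \<Longrightarrow> h (0, t) = \<gamma> p t \<and> h (1, t) = \<gamma> q t"
    using assms(1) by (auto simp: band_def)
  obtain k where k: "continuous_map (top_of_set ?S) X k" "inj_on k ?S" "k ` ?S \<subseteq> Z'"
      "\<And>t. t \<in> {0..1} \<Longrightarrow> k (0, t) = \<gamma> q' t \<and> k (1, t) = \<gamma> p t"
    using assms(2) by (auto simp: band_def)
  define k' where "k' = (\<lambda>z. k (fst z, 1 - snd z))"
  have k'c: "continuous_map (top_of_set ?S) X k'"
    unfolding k'_def by (rule continuous_map_square_compose[OF k(1)]) (auto intro!: continuous_intros)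
  define m where "m = stack h k'"
  have hinj: "h (a, b) = h (a', b') \<longleftrightarrow> a = a' \<and> b = b'"
    if "a \<in> {0..1}" "b \<in> {0..1}" "a' \<in> {0..1}" "b' \<in> {0..1}" for a b a' b'
    using inj_on_eq_iff[OF h(2), of "(a, b)" "(a', b')"] that by simp
  have kinj: "k (a, b) = k (a', b') \<longleftrightarrow> a = a' \<and> b = b'"
    if "a \<in> {0..1}" "b \<in> {0..1}" "a' \<in> {0..1}" "b' \<in> {0..1}" for a b a' b'
    using inj_on_eq_iff[OF k(2), of "(a, b)" "(a', b')"] that by simp
  have con: "continuous_map (top_of_set ?S) X m"
    unfolding m_def
  proof (rule continuous_map_stack[OF h(1) k'c])
    fix t :: real assume t: "t \<in> {0..1}"
    then have t': "1 - t \<in> {0..1}" by auto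
    show "h (1, t) = k' (0, t)" using h(4)[OF t] k(4)[OF t'] q'[OF t'] by (simp add: k'_def)
  qed
  have ms: "m (s, t) = h (2 * s, t)" if "s \<le> 1/2" for s t using that by (simp add: m_def stack_simps)
  have ml: "m (s, t) = k (2 * s - 1, 1 - t)" if "1/2 < s" for s t using that by (simp add: m_def stack_simps k'_def)
  have mix: "m (s, t) = m (s', t') \<longleftrightarrow> s = 0 \<and> s' = 1 \<and> t' = 1 - t"
    if b: "s \<in> {0..1}" "t \<in> {0..1}" "s' \<in> {0..1}" "t' \<in> {0..1}" and s: "s \<le> 1/2" "1/2 < s'" for s t s' t'
  proof
    assume "m (s, t) = m (s', t')"
    then have e: "h (2 * s, t) = k (2 * s' - 1, 1 - t')" using s by (simp add: ms ml)
    have sq: "(2 * s, t) \<in> ?S" "(2 * s' - 1, 1 - t') \<in> ?S" using b s by auto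
    then have "h (2 * s, t) \<in> Z \<inter> Z'" using e h(3) k(3) by (metis IntI image_subset_iff)
    then consider \<tau> where "\<tau> \<in> {0..1}" "h (2 * s, t) = \<gamma> p \<tau>" | \<tau> where "\<tau> \<in> {0..1}" "h (2 * s, t) = \<gamma> q \<tau>"
      using ZZ by blast
    then show "s = 0 \<and> s' = 1 \<and> t' = 1 - t"
    proof cases
      case (1 \<tau>)
      then have "h (2 * s, t) = h (0, \<tau>)" "k (2 * s' - 1, 1 - t') = k (1, \<tau>)" using e h(4) k(4) by simp_all
      then have "2 * s = 0 \<and> t = \<tau>" "2 * s' - 1 = 1 \<and> 1 - t' = \<tau>"
        using hinj[of "2 * s" t 0 \<tau>] kinj[of "2 * s' - 1" "1 - t'" 1 \<tau>] sq 1(1) by auto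
      then show ?thesis by auto
    next
      case (2 \<tau>)
      then have \<tau>': "1 - \<tau> \<in> {0..1}" by auto
      have "k (0, 1 - \<tau>) = \<gamma> q \<tau>" using k(4)[OF \<tau>'] q'[OF \<tau>'] by simp
      then have "k (2 * s' - 1, 1 - t') = k (0, 1 - \<tau>)" using e 2 by simp
      then show ?thesis using kinj[of "2 * s' - 1" "1 - t'" 0 "1 - \<tau>"] sq \<tau>' s by auto
    qed
  next
    assume "s = 0 \<and> s' = 1 \<and> t' = 1 - t"
    then show "m (s, t) = m (s', t')" using h(4) k(4) b by (simp add: ms ml)
  qed
  have "m (s, t) = m (s', t') \<longleftrightarrow> (s = s' \<and> t = t') \<or> ({s, s'} = {0, 1} \<and> t' = 1 - t)"
    if b: "s \<in> {0..1}" "t \<in> {0..1}" "s' \<in> {0..1}" "t' \<in> {0..1}" for s t s' t'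
  proof -
    consider "s \<le> 1/2" "s' \<le> 1/2" | "1/2 < s" "1/2 < s'" | "s \<le> 1/2" "1/2 < s'" | "1/2 < s" "s' \<le> 1/2" by linarith
    then show ?thesis
    proof cases
      case 1
      then show ?thesis using b hinj[of "2 * s" t "2 * s'" t'] by (auto simp: ms doubleton_eq_iff)
    next
      case 2
      then show ?thesis using b kinj[of "2 * s - 1" "1 - t" "2 * s' - 1" "1 - t'"] by (auto simp: ml doubleton_eq_iff)
    next
      case 3
      then show ?thesis using mix[OF b] by (auto simp: doubleton_eq_iff)
    next
      case 4
      then show ?thesis using mix[OF b(3,4,1,2)] by (auto simp: doubleton_eq_iff eq_commute[of "m (s, t)"])
    qed
  qed
  then show ?thesis using con unfolding moebius_band_in_def by blast
qed

section \<open>Segments and rims in a ribbon graph\<close>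

context ribbon_graph
begin

abbreviation "segments \<equiv> attaching_segments X V E"
abbreviation "rim D \<equiv> surface_boundary (subtopology X D)"

lemma Hausdorff: "Hausdorff_space X"
  using surface by (simp add: surface_with_boundary_def)

lemma disc_param: "D \<in> V \<union> E \<Longrightarrow> \<exists>g. disc_param X D g"
  using disc_V disc_E ex_disc_param by blast

lemma rim_param: "disc_param X D g \<Longrightarrow> rim D = g ` sphere 0 1"
  by (rule surface_boundary_disc[OF Hausdorff])

lemma disc_props:
  assumes "D \<in> V \<union> E"
  shows "closedin X D" "connectedin X D" "rim D \<subseteq> D" "closedin X (rim D)" "connectedin X (rim D)" "rim D \<noteq> {}" "D \<noteq> {}" "D \<subseteq> topspace X"
proof -
  obtain g where g: "disc_param X D g" using disc_param[OF assms] by blast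
  note p = disc_paramD[OF g]
  have gs: "continuous_map (top_of_set (sphere 0 1)) X g"
    using continuous_map_from_subtopology_mono[OF p(1)] by auto
  have "compactin (top_of_set (cball (0::complex) 1)) (cball 0 1)" by (simp add: compactin_subtopology)
  from image_compactin[OF this p(1)] show "closedin X D" using compactin_imp_closedin[OF Hausdorff] p(3) by simp
  have "connectedin (top_of_set (cball (0::complex) 1)) (cball 0 1)" by (simp add: connectedin_subtopology convex_connected)
  from connectedin_continuous_map_image[OF p(1) this] show "connectedin X D" using p(3) by simp
  show "rim D \<subseteq> D" using rim_param[OF g] p(3) by auto
  have "compactin (top_of_set (sphere (0::complex) 1)) (sphere 0 1)" by (simp add: compactin_subtopology)
  from image_compactin[OF this gs] show "closedin X (rim D)" using compactin_imp_closedin[OF Hausdorff] rim_param[OF g] by simp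
  have "connectedin (top_of_set (sphere (0::complex) 1)) (sphere 0 1)" by (simp add: connectedin_subtopology connected_sphere)
  from connectedin_continuous_map_image[OF gs this] show "connectedin X (rim D)" using rim_param[OF g] by simp
  have "1 \<in> sphere (0::complex) 1" by simp
  then show "rim D \<noteq> {}" using rim_param[OF g] by blast
  then show "D \<noteq> {}" using \<open>rim D \<subseteq> D\<close> by blast
  show "D \<subseteq> topspace X" using p(4) .
qed

lemma vertex_unique: "v \<in> V \<Longrightarrow> v' \<in> V \<Longrightarrow> x \<in> v \<Longrightarrow> x \<in> v' \<Longrightarrow> v = v'"
  using disjoint_V unfolding pairwise_def disjnt_def by blast

lemma edge_unique: "e \<in> E \<Longrightarrow> e' \<in> E \<Longrightarrow> x \<in> e \<Longrightarrow> x \<in> e' \<Longrightarrow> e = e'"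
  using disjoint_E unfolding pairwise_def disjnt_def by blast

lemma Union_segments: "\<Union>segments = \<Union>V \<inter> \<Union>E"
proof -
  have "\<Union>V \<inter> \<Union>E \<subseteq> topspace X" using cover by blast
  then show ?thesis unfolding attaching_segments_def Union_connected_components_of by auto
qed

lemma segment_rims:
  assumes "s \<in> segments"
  shows "\<exists>v\<in>V. s \<subseteq> rim v" "\<exists>e\<in>E. s \<subseteq> rim e"
  using ex1_implies_ex[OF segment_vertex[OF assms]] ex1_implies_ex[OF segment_edge[OF assms]]
  unfolding Bex_def by this

lemma segments_disjoint: "s \<in> segments \<Longrightarrow> s' \<in> segments \<Longrightarrow> x \<in> s \<Longrightarrow> x \<in> s' \<Longrightarrow> s = s'"
  using connected_components_of_disjoint[of s "subtopology X (\<Union>V \<inter> \<Union>E)" s']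
  unfolding attaching_segments_def disjnt_iff by metis

text \<open>The segments are the connected components of the intersection of vertices and edges, and each lies on the rim of a single
vertex and a single edge. So vertices and edges meet only in their rims.\<close>

lemma meet_in_segment:
  assumes "v \<in> V" "e \<in> E" "x \<in> v" "x \<in> e"
  shows "\<exists>s\<in>segments. x \<in> s \<and> s \<subseteq> rim v \<and> s \<subseteq> rim e"
proof -
  have "x \<in> \<Union>segments" using assms Union_segments by auto
  then obtain s where s: "s \<in> segments" "x \<in> s" by blast
  obtain v' e' where *: "v' \<in> V" "s \<subseteq> rim v'" "e' \<in> E" "s \<subseteq> rim e'" using segment_rims[OF s(1)] by blast
  then have "x \<in> v'" "x \<in> e'" using s(2) disc_props(3)[of v'] disc_props(3)[of e'] by blast+
  then have "v' = v" "e' = e" using vertex_unique edge_unique assms * by blast+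
  then show ?thesis using s * by blast
qed

lemma segment_in_rim:
  assumes "s \<in> segments" "D \<in> V \<union> E" "x \<in> s" "x \<in> D" shows "s \<subseteq> rim D"
proof -
  obtain v e where *: "v \<in> V" "s \<subseteq> rim v" "e \<in> E" "s \<subseteq> rim e" using segment_rims[OF assms(1)] by blast
  then have "x \<in> v" "x \<in> e" using assms(3) disc_props(3)[of v] disc_props(3)[of e] by blast+
  then show ?thesis using assms vertex_unique[of D v x] edge_unique[of D e x] * by blast
qed

lemma finite_segments: "finite segments"
proof -
  have "segments \<subseteq> (\<Union>e\<in>E. {s \<in> segments. s \<subseteq> e})"
  proof
    fix s assume s: "s \<in> segments"
    then obtain e where "e \<in> E" "s \<subseteq> rim e" using segment_rims by blast
    then show "s \<in> (\<Union>e\<in>E. {s \<in> segments. s \<subseteq> e})" using s disc_props(3)[of e] by blast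
  qed
  moreover have "finite (\<Union>e\<in>E. {s \<in> segments. s \<subseteq> e})"
    using finite_E two_segments by (intro finite_UN_I) (auto intro!: card_ge_0_finite)
  ultimately show ?thesis by (rule finite_subset)
qed

lemma ex_segment_path:
  assumes "s \<in> segments"
  shows "\<exists>f. continuous_map (top_of_set {0..1::real}) X f \<and> inj_on f {0..1} \<and> f ` {0..1} = s"
proof -
  have s: "s \<subseteq> topspace X" "top_of_set {0..1::real} homeomorphic_space subtopology X s"
    using segment[OF assms] homeomorphic_space_sym by (auto simp: line_segment_in_def)
  then obtain f where f: "homeomorphic_map (top_of_set {0..1::real}) (subtopology X s) f"
    by (auto simp: homeomorphic_space)
  have "continuous_map (top_of_set {0..1}) X f"
    using homeomorphic_imp_continuous_map[OF f] continuous_map_into_fulltopology by blast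
  moreover have "inj_on f {0..1}" using homeomorphic_imp_injective_map[OF f] by simp
  moreover have "f ` {0..1} = s" using homeomorphic_imp_surjective_map[OF f] s(1) by auto
  ultimately show ?thesis by blast
qed

end

text \<open>\<open>H\<close> is the set of ends of the attaching segments, and \<open>\<gamma> p\<close> parametrizes the segment of the end \<open>p\<close> in the direction
away from \<open>p\<close>. Both parametrizations of a segment are derived from a single one.\<close>

locale ribbon_paths = ribbon_graph X V E
  for X :: "'a topology" and V E +
  fixes H :: "'a set" and \<alpha> :: "'a \<Rightarrow> 'a" and \<gamma> :: "'a \<Rightarrow> real \<Rightarrow> 'a"
  assumes fin_H: "finite H"
    and opp: "\<And>p. p \<in> H \<Longrightarrow> \<alpha> p \<in> H"
    and path_cont: "\<And>p. p \<in> H \<Longrightarrow> continuous_map (top_of_set {0..1}) X (\<gamma> p)"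
    and path_inj: "\<And>p. p \<in> H \<Longrightarrow> inj_on (\<gamma> p) {0..1}"
    and path_0: "\<And>p. p \<in> H \<Longrightarrow> \<gamma> p 0 = p"
    and path_opp: "\<And>p t. p \<in> H \<Longrightarrow> t \<in> {0..1} \<Longrightarrow> \<gamma> (\<alpha> p) t = \<gamma> p (1 - t)"
    and path_segment: "\<And>p. p \<in> H \<Longrightarrow> \<gamma> p ` {0..1} \<in> segments"
    and same_segment: "\<And>p q. p \<in> H \<Longrightarrow> q \<in> H \<Longrightarrow> \<gamma> p ` {0..1} = \<gamma> q ` {0..1} \<Longrightarrow> q \<in> {p, \<alpha> p}"
    and segment_path: "\<And>s. s \<in> segments \<Longrightarrow> \<exists>p\<in>H. \<gamma> p ` {0..1} = s"

lemma (in ribbon_graph) ex_directed_paths: "\<exists>H \<alpha> \<gamma>. ribbon_paths X V E H \<alpha> \<gamma>"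
proof -
  obtain f where f: "\<And>s. s \<in> segments \<Longrightarrow> continuous_map (top_of_set {0..1::real}) X (f s)"
    "\<And>s. s \<in> segments \<Longrightarrow> inj_on (f s) {0..1::real}" "\<And>s. s \<in> segments \<Longrightarrow> f s ` {0..1::real} = s"
    using ex_segment_path by metis
  define H where "H = (\<Union>s\<in>segments. {f s 0, f s 1})"
  define sg where "sg = (\<lambda>p. THE s. s \<in> segments \<and> p \<in> s)"
  have sg: "sg p = s" if "s \<in> segments" "p \<in> s" for p s
    unfolding sg_def using that segments_disjoint by (intro the_equality) auto
  define \<gamma> where "\<gamma> = (\<lambda>p t. if p = f (sg p) 0 then f (sg p) t else f (sg p) (1 - t))"
  define \<alpha> where "\<alpha> = (\<lambda>p. if p = f (sg p) 0 then f (sg p) 1 else f (sg p) 0)"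
  have ends: "f s 0 \<in> s" "f s 1 \<in> s" "f s 0 \<noteq> f s 1" if "s \<in> segments" for s
    using f(3)[OF that] inj_on_eq_iff[OF f(2)[OF that], of 0 1] by force+
  have g: "\<gamma> (f s 0) = f s" "\<gamma> (f s 1) = (\<lambda>t. f s (1 - t))" "\<alpha> (f s 0) = f s 1" "\<alpha> (f s 1) = f s 0"
    if "s \<in> segments" for s
    using ends[OF that] sg[OF that ends(1)[OF that]] sg[OF that ends(2)[OF that]] by (auto simp: \<gamma>_def \<alpha>_def fun_eq_iff)
  have rev: "continuous_map (top_of_set {0..1}) X (\<lambda>t. f s (1 - t))" "inj_on (\<lambda>t. f s (1 - t)) {0..1}"
    "(\<lambda>t. f s (1 - t)) ` {0..1} = s" if "s \<in> segments" for s
  proof -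
    have "continuous_map (top_of_set {0..1}) (top_of_set {0..1}) (\<lambda>t::real. 1 - t)"
      by (auto simp: continuous_map_in_subtopology intro!: continuous_intros)
    from continuous_map_compose[OF this f(1)[OF that]] show "continuous_map (top_of_set {0..1}) X (\<lambda>t. f s (1 - t))"
      by (simp add: comp_def)
    show "inj_on (\<lambda>t. f s (1 - t)) {0..1}"
      using inj_on_eq_iff[OF f(2)[OF that]] by (auto simp: inj_on_def)
    have "(\<lambda>t. f s (1 - t)) ` {0..1} = f s ` ((\<lambda>t. 1 - t) ` {0..1})" by (simp only: image_image)
    then show "(\<lambda>t. f s (1 - t)) ` {0..1} = s" using f(3)[OF that] by simp
  qed
  have im: "\<gamma> p ` {0..1} = s" if "s \<in> segments" "p \<in> {f s 0, f s 1}" for p s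
  proof -
    have "\<gamma> p = f s \<or> \<gamma> p = (\<lambda>t. f s (1 - t))" using that g by auto
    then show ?thesis using f(3)[OF that(1)] rev(3)[OF that(1)] by metis
  qed
  have all: "\<alpha> p \<in> H" "continuous_map (top_of_set {0..1}) X (\<gamma> p)" "inj_on (\<gamma> p) {0..1}" "\<gamma> p 0 = p"
      "\<And>t. t \<in> {0..1} \<Longrightarrow> \<gamma> (\<alpha> p) t = \<gamma> p (1 - t)" "\<gamma> p ` {0..1} \<in> segments" if "p \<in> H" for p
  proof -
    obtain s where s: "s \<in> segments" "p = f s 0 \<or> p = f s 1" using \<open>p \<in> H\<close> by (auto simp: H_def)
    have *: "f s 0 \<in> H" "f s 1 \<in> H" using s(1) by (auto simp: H_def)
    have "\<alpha> p \<in> H \<and> continuous_map (top_of_set {0..1}) X (\<gamma> p) \<and> inj_on (\<gamma> p) {0..1} \<and> \<gamma> p 0 = p \<and>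
      (\<forall>t\<in>{0..1}. \<gamma> (\<alpha> p) t = \<gamma> p (1 - t)) \<and> \<gamma> p ` {0..1} \<in> segments"
      using s(2)
    proof
      assume p: "p = f s 0"
      then show ?thesis using g[OF s(1)] f[OF s(1)] * s(1) by simp
    next
      assume p: "p = f s 1"
      then show ?thesis using g[OF s(1)] rev[OF s(1)] * s(1) by simp
    qed
    then show "\<alpha> p \<in> H" "continuous_map (top_of_set {0..1}) X (\<gamma> p)" "inj_on (\<gamma> p) {0..1}" "\<gamma> p 0 = p"
      "\<And>t. t \<in> {0..1} \<Longrightarrow> \<gamma> (\<alpha> p) t = \<gamma> p (1 - t)" "\<gamma> p ` {0..1} \<in> segments"
      by simp_all
  qed
  have same: "q \<in> {p, \<alpha> p}" if "p \<in> H" "q \<in> H" and e: "\<gamma> p ` {0..1} = \<gamma> q ` {0..1}" for p q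
  proof -
    obtain s s' where s: "s \<in> segments" "p \<in> {f s 0, f s 1}" "s' \<in> segments" "q \<in> {f s' 0, f s' 1}"
      using \<open>p \<in> H\<close> \<open>q \<in> H\<close> by (auto simp: H_def)
    then have "s = s'" using e im by metis
    then show "q \<in> {p, \<alpha> p}" using s g[OF s(1)] by auto
  qed
  have onto: "\<exists>p\<in>H. \<gamma> p ` {0..1} = s" if s: "s \<in> segments" for s
  proof -
    have "f s 0 \<in> H" using s by (auto simp: H_def)
    then show ?thesis using im[OF s, of "f s 0"] by blast
  qed
  have fin: "finite H" using finite_segments by (simp add: H_def)
  have "ribbon_paths X V E H \<alpha> \<gamma>"
    by unfold_locales (rule fin all same onto; assumption)+
  then show ?thesis by blast
qed

context ribbon_paths
begin

abbreviation "seg p \<equiv> \<gamma> p ` {0..1}"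

definition "ends D = {p \<in> H. p \<in> D}"

lemma in_seg: "p \<in> H \<Longrightarrow> p \<in> seg p"
  using path_0[of p] imageI[of 0 "{0..1}" "\<gamma> p"] by simp

lemma segs_disjoint: "p \<in> H \<Longrightarrow> q \<in> H \<Longrightarrow> x \<in> seg p \<Longrightarrow> x \<in> seg q \<Longrightarrow> q \<in> {p, \<alpha> p}"
  by (rule same_segment, assumption, assumption, rule segments_disjoint[OF path_segment path_segment])

lemma seg_rim: "p \<in> H \<Longrightarrow> D \<in> V \<union> E \<Longrightarrow> x \<in> seg p \<Longrightarrow> x \<in> D \<Longrightarrow> seg p \<subseteq> rim D"
  by (rule segment_in_rim[OF path_segment])

lemma ends_iff:
  assumes "D \<in> V \<union> E" shows "p \<in> ends D \<longleftrightarrow> p \<in> H \<and> seg p \<subseteq> rim D"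
proof (cases "p \<in> H")
  case True
  have "seg p \<subseteq> rim D" if "p \<in> D" using seg_rim[OF True assms in_seg[OF True] that] .
  moreover have "p \<in> D" if "seg p \<subseteq> rim D" using in_seg[OF True] that disc_props(3)[OF assms] by auto
  ultimately show ?thesis using True unfolding ends_def by auto
qed (simp add: ends_def)

lemma seg_opp: "p \<in> H \<Longrightarrow> seg (\<alpha> p) = seg p"
proof -
  assume p: "p \<in> H"
  have "seg (\<alpha> p) = (\<lambda>t. \<gamma> p (1 - t)) ` {0..1}" using path_opp[OF p] by (intro image_cong) auto
  also have "\<dots> = \<gamma> p ` ((\<lambda>t. 1 - t) ` {0..1})" by (simp only: image_image)
  finally show ?thesis by simp
qed

lemma ends_opp: "D \<in> V \<union> E \<Longrightarrow> p \<in> ends D \<Longrightarrow> \<alpha> p \<in> ends D"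
  using ends_iff opp seg_opp by simp

lemma arcs_on_rim:
  assumes "D \<in> V \<union> E" "ends D \<noteq> {}"
  shows "arcs_on_circle X (rim D) (ends D) \<alpha> \<gamma>"
proof
  show "finite (ends D)" using fin_H by (simp add: ends_def)
  show "\<gamma> p ` {0..1} \<subseteq> rim D" if "p \<in> ends D" for p using ends_iff[OF assms(1)] that by blast
  show "\<gamma> p ` {0..1} \<inter> \<gamma> q ` {0..1} = {}" if "p \<in> ends D" "q \<in> ends D" "q \<notin> {p, \<alpha> p}" for p q
  proof -
    have "p \<in> H" "q \<in> H" using that by (auto simp: ends_def)
    then show ?thesis using segs_disjoint[of p q] that(3) by blast
  qed
qed (use Hausdorff assms(2) ends_opp[OF assms(1)] path_cont path_inj path_0 path_opp in \<open>auto simp: ends_def\<close>)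

lemma ex_rim_arcs:
  assumes "D \<in> V \<union> E" "ends D \<noteq> {}"
  shows "\<exists>c \<T>. disc_arcs X D (rim D) (ends D) \<alpha> \<gamma> c \<T>"
proof -
  obtain g where g: "disc_param X D g" using disc_param[OF assms(1)] by blast
  show ?thesis by (rule arcs_on_circle.ex_disc_arcs_of_disc[OF arcs_on_rim[OF assms] g rim_param[OF g]])
qed

end

section \<open>The three matchings of a ribbon graph\<close>

locale ribbon_arcs = ribbon_paths X V E H \<alpha> \<gamma>
  for X :: "'a topology" and V E H \<alpha> \<gamma> +
  fixes c :: "'a set \<Rightarrow> 'a \<Rightarrow> bool" and \<T> :: "'a set \<Rightarrow> 'a set set"
  assumes rim_arcs: "\<And>D. D \<in> V \<union> E \<Longrightarrow> ends D \<noteq> {} \<Longrightarrow> disc_arcs X D (rim D) (ends D) \<alpha> \<gamma> (c D) (\<T> D)"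
begin

lemma rim_arcsD:
  assumes "D \<in> V \<union> E" "p \<in> ends D"
  shows "finite (\<T> D)" "pairwise disjnt (\<T> D)" "ends D \<subseteq> \<Union>(\<T> D)"
    "\<And>q. q \<in> ends D \<Longrightarrow> c D (\<alpha> q) \<noteq> c D q"
    "\<And>T. T \<in> \<T> D \<Longrightarrow> connectedin X T" "\<And>T. T \<in> \<T> D \<Longrightarrow> closedin X T"
    "\<And>T. T \<in> \<T> D \<Longrightarrow> \<exists>q\<in>ends D. \<exists>r\<in>ends D. T \<inter> ends D = {q, r} \<and> c D q \<noteq> c D r"
    "\<And>T q. T \<in> \<T> D \<Longrightarrow> q \<in> ends D \<Longrightarrow> T \<inter> seg q \<subseteq> ends D"
    "rim D = \<Union>(\<T> D) \<union> (\<Union>q\<in>ends D. seg q)"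
    "\<And>T. T \<in> \<T> D \<Longrightarrow> T \<subseteq> X closure_of (rim D - (\<Union>q\<in>ends D. seg q))"
    "\<And>W. W \<subseteq> ends D \<Longrightarrow> W \<noteq> {} \<Longrightarrow> \<alpha> ` W \<subseteq> W \<Longrightarrow> (\<And>T. T \<in> \<T> D \<Longrightarrow> T \<inter> W \<noteq> {} \<Longrightarrow> T \<inter> ends D \<subseteq> W) \<Longrightarrow> W = ends D"
    "\<And>q r. q \<in> ends D \<Longrightarrow> r \<in> ends D \<Longrightarrow> r \<notin> {q, \<alpha> q} \<Longrightarrow> c D q \<noteq> c D r \<Longrightarrow> band X D \<gamma> q r"
proof -
  have "ends D \<noteq> {}" using assms(2) by blast
  note d = rim_arcs[OF assms(1) this, unfolded disc_arcs_def]
  show "finite (\<T> D)" "pairwise disjnt (\<T> D)" "ends D \<subseteq> \<Union>(\<T> D)"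
    "\<And>q. q \<in> ends D \<Longrightarrow> c D (\<alpha> q) \<noteq> c D q"
    "\<And>T. T \<in> \<T> D \<Longrightarrow> connectedin X T" "\<And>T. T \<in> \<T> D \<Longrightarrow> closedin X T"
    "\<And>T. T \<in> \<T> D \<Longrightarrow> \<exists>q\<in>ends D. \<exists>r\<in>ends D. T \<inter> ends D = {q, r} \<and> c D q \<noteq> c D r"
    "\<And>T q. T \<in> \<T> D \<Longrightarrow> q \<in> ends D \<Longrightarrow> T \<inter> seg q \<subseteq> ends D"
    "rim D = \<Union>(\<T> D) \<union> (\<Union>q\<in>ends D. seg q)"
    "\<And>T. T \<in> \<T> D \<Longrightarrow> T \<subseteq> X closure_of (rim D - (\<Union>q\<in>ends D. seg q))"
    using d by meson+
  show "\<And>W. W \<subseteq> ends D \<Longrightarrow> W \<noteq> {} \<Longrightarrow> \<alpha> ` W \<subseteq> W \<Longrightarrow> (\<And>T. T \<in> \<T> D \<Longrightarrow> T \<inter> W \<noteq> {} \<Longrightarrow> T \<inter> ends D \<subseteq> W) \<Longrightarrow> W = ends D"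
    using d by meson
  show "\<And>q r. q \<in> ends D \<Longrightarrow> r \<in> ends D \<Longrightarrow> r \<notin> {q, \<alpha> q} \<Longrightarrow> c D q \<noteq> c D r \<Longrightarrow> band X D \<gamma> q r"
    using d by meson
qed

definition "side D p = (THE T. T \<in> \<T> D \<and> p \<in> T)"
definition "partner D p = (THE q. q \<noteq> p \<and> q \<in> side D p \<inter> ends D)"

lemma side_eq:
  assumes "D \<in> V \<union> E" "p \<in> ends D" "T \<in> \<T> D" "x \<in> T" "x \<in> ends D"
  shows "side D x = T"
  unfolding side_def using assms(3-5) rim_arcsD(2)[OF assms(1,2)]
  by (intro the_equality) (auto simp: pairwise_def disjnt_def)

lemma side:
  assumes "D \<in> V \<union> E" "p \<in> ends D"
  shows "side D p \<in> \<T> D" "p \<in> side D p"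
proof -
  obtain T where "T \<in> \<T> D" "p \<in> T" using rim_arcsD(3)[OF assms] assms(2) by blast
  then show "side D p \<in> \<T> D" "p \<in> side D p" using side_eq[OF assms _ _ assms(2)] by auto
qed

lemma partner:
  assumes "D \<in> V \<union> E" "p \<in> ends D"
  shows "side D p \<inter> ends D = {p, partner D p}" "partner D p \<noteq> p" "partner D p \<in> ends D"
    "c D (partner D p) \<noteq> c D p" "side D (partner D p) = side D p" "partner D (partner D p) = p"
proof -
  note A = side[OF assms]
  obtain q r where qr: "side D p \<inter> ends D = {q, r}" "c D q \<noteq> c D r"
    using rim_arcsD(7)[OF assms A(1)] by blast
  then have "p \<in> {q, r}" using A(2) assms(2) by blast
  then obtain s where s: "side D p \<inter> ends D = {p, s}" "c D s \<noteq> c D p" using qr by (metis insert_commute empty_iff insert_iff)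
  have "s \<noteq> p" using s(2) by auto
  have ps: "partner D p = s" unfolding partner_def s(1) using \<open>s \<noteq> p\<close> by (intro the_equality) auto
  then show "side D p \<inter> ends D = {p, partner D p}" "partner D p \<noteq> p" "c D (partner D p) \<noteq> c D p" using s \<open>s \<noteq> p\<close> by auto
  have se: "s \<in> ends D" "s \<in> side D p" using s(1) by auto
  then show "partner D p \<in> ends D" using ps by simp
  have as: "side D s = side D p" using side_eq[OF assms A(1) se(2,1)] .
  then show "side D (partner D p) = side D p" using ps by simp
  have "partner D s = p" unfolding partner_def as s(1) using \<open>s \<noteq> p\<close> by (intro the_equality) auto
  then show "partner D (partner D p) = p" using ps by simp
qed

definition "vert x = (THE v. v \<in> V \<and> x \<in> v)"
definition "edge x = (THE e. e \<in> E \<and> x \<in> e)"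

lemma vert_eq: "v \<in> V \<Longrightarrow> x \<in> v \<Longrightarrow> vert x = v"
  unfolding vert_def using vertex_unique by (intro the_equality) auto

lemma edge_eq: "e \<in> E \<Longrightarrow> x \<in> e \<Longrightarrow> edge x = e"
  unfolding edge_def using edge_unique by (intro the_equality) auto

lemma vert: "p \<in> H \<Longrightarrow> vert p \<in> V" "p \<in> H \<Longrightarrow> p \<in> ends (vert p)"
  and edge: "p \<in> H \<Longrightarrow> edge p \<in> E" "p \<in> H \<Longrightarrow> p \<in> ends (edge p)"
proof -
  assume p: "p \<in> H"
  obtain v e where *: "v \<in> V" "seg p \<subseteq> rim v" "e \<in> E" "seg p \<subseteq> rim e"
    using segment_rims[OF path_segment[OF p]] by blast
  then have "p \<in> v" "p \<in> e" using in_seg[OF p] disc_props(3)[of v] disc_props(3)[of e] by auto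
  then show "vert p \<in> V" "p \<in> ends (vert p)" "edge p \<in> E" "p \<in> ends (edge p)"
    using vert_eq[OF *(1)] edge_eq[OF *(3)] * p by (auto simp: ends_def)
qed

lemma ends_vert: "v \<in> V \<Longrightarrow> p \<in> ends v \<Longrightarrow> vert p = v" "e \<in> E \<Longrightarrow> p \<in> ends e \<Longrightarrow> edge p = e"
  using vert_eq edge_eq by (auto simp: ends_def)

lemma ends_H: "p \<in> ends D \<Longrightarrow> p \<in> H" by (simp add: ends_def)

lemma seg_in: "p \<in> H \<Longrightarrow> seg p \<subseteq> vert p" "p \<in> H \<Longrightarrow> seg p \<subseteq> edge p"
  using ends_iff[of "vert p" p] ends_iff[of "edge p" p] vert[of p] edge[of p] disc_props(3)[of "vert p"] disc_props(3)[of "edge p"]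
  by auto

lemma side_in: "D \<in> V \<union> E \<Longrightarrow> p \<in> ends D \<Longrightarrow> T \<in> \<T> D \<Longrightarrow> T \<subseteq> rim D"
  using rim_arcsD(9) by blast

lemma meet_in_seg:
  assumes "v \<in> V" "e \<in> E" "x \<in> v" "x \<in> e"
  shows "\<exists>r\<in>ends v \<inter> ends e. x \<in> seg r"
proof -
  obtain s where s: "s \<in> segments" "x \<in> s" "s \<subseteq> rim v" "s \<subseteq> rim e" using meet_in_segment[OF assms] by blast
  obtain r where r: "r \<in> H" "seg r = s" using segment_path[OF s(1)] by blast
  then have "r \<in> ends v" "r \<in> ends e" using s(3,4) ends_iff[of v r] ends_iff[of e r] assms(1,2) by simp_all
  then show ?thesis using r(2) s(2) by auto
qed

definition "\<tau> p = partner (vert p) p"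
definition "\<beta> p = partner (edge p) p"

lemma opp_opp: "p \<in> H \<Longrightarrow> \<alpha> (\<alpha> p) = p"
proof -
  assume p: "p \<in> H"
  have "\<gamma> (\<alpha> p) 1 = p" using path_opp[OF p, of 1] path_0[OF p] by simp
  moreover have "\<gamma> (\<alpha> (\<alpha> p)) 0 = \<gamma> (\<alpha> p) 1" using path_opp[OF opp[OF p], of 0] by simp
  ultimately show ?thesis using path_0[OF opp[OF opp[OF p]]] by simp
qed

lemma opp_neq: "p \<in> H \<Longrightarrow> \<alpha> p \<noteq> p"
  using rim_arcsD(4)[of "vert p" p p] vert[of p] by auto

lemma opp_vert: "p \<in> H \<Longrightarrow> vert (\<alpha> p) = vert p" "p \<in> H \<Longrightarrow> edge (\<alpha> p) = edge p"
proof -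
  assume p: "p \<in> H"
  show "vert (\<alpha> p) = vert p"
    by (rule ends_vert(1)[OF vert(1)[OF p] ends_opp[OF _ vert(2)[OF p]]]) (simp add: vert(1)[OF p])
  show "edge (\<alpha> p) = edge p"
    by (rule ends_vert(2)[OF edge(1)[OF p] ends_opp[OF _ edge(2)[OF p]]]) (simp add: edge(1)[OF p])
qed

lemma \<tau>_vert: "p \<in> H \<Longrightarrow> vert (\<tau> p) = vert p" and \<tau>_H: "p \<in> H \<Longrightarrow> \<tau> p \<in> H"
proof -
  assume p: "p \<in> H"
  have t: "\<tau> p \<in> ends (vert p)" using partner(3)[of "vert p" p] vert[OF p] by (simp add: \<tau>_def)
  show "vert (\<tau> p) = vert p" by (rule ends_vert(1)[OF vert(1)[OF p] t])
  show "\<tau> p \<in> H" by (rule ends_H[OF t])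
qed

lemma \<beta>_edge: "p \<in> H \<Longrightarrow> edge (\<beta> p) = edge p" and \<beta>_H: "p \<in> H \<Longrightarrow> \<beta> p \<in> H"
proof -
  assume p: "p \<in> H"
  have t: "\<beta> p \<in> ends (edge p)" using partner(3)[of "edge p" p] edge[OF p] by (simp add: \<beta>_def)
  show "edge (\<beta> p) = edge p" by (rule ends_vert(2)[OF edge(1)[OF p] t])
  show "\<beta> p \<in> H" by (rule ends_H[OF t])
qed

lemma matching_\<tau>: "matching_on H \<tau>"
  unfolding matching_on_def
proof (intro ballI conjI)
  fix p assume p: "p \<in> H"
  have D: "vert p \<in> V \<union> E" using vert(1)[OF p] by simp
  show "\<tau> p \<in> H" by (rule \<tau>_H[OF p])
  show "\<tau> (\<tau> p) = p" using partner(6)[OF D vert(2)[OF p]] \<tau>_vert[OF p] by (simp add: \<tau>_def)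
  show "\<tau> p \<noteq> p" using partner(2)[OF D vert(2)[OF p]] by (simp add: \<tau>_def)
qed

lemma matching_\<beta>: "matching_on H \<beta>"
  unfolding matching_on_def
proof (intro ballI conjI)
  fix p assume p: "p \<in> H"
  have D: "edge p \<in> V \<union> E" using edge(1)[OF p] by simp
  show "\<beta> p \<in> H" by (rule \<beta>_H[OF p])
  show "\<beta> (\<beta> p) = p" using partner(6)[OF D edge(2)[OF p]] \<beta>_edge[OF p] by (simp add: \<beta>_def)
  show "\<beta> p \<noteq> p" using partner(2)[OF D edge(2)[OF p]] by (simp add: \<beta>_def)
qed

lemma matching_\<alpha>: "matching_on H \<alpha>"
  unfolding matching_on_def using opp opp_opp opp_neq by blast

text \<open>An edge has exactly two segments.\<close>

lemma ends_edge:
  assumes e: "e \<in> E"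
  shows "\<exists>p q. ends e = {p, \<alpha> p, q, \<alpha> q} \<and> q \<notin> {p, \<alpha> p}"
proof -
  have "card {s \<in> segments. s \<subseteq> e} = 2" by (rule two_segments[OF e])
  then obtain s s' where s: "{s \<in> segments. s \<subseteq> e} = {s, s'}" "s \<noteq> s'" by (meson card_2_iff)
  then have "s \<in> segments" "s' \<in> segments" "s \<subseteq> e" "s' \<subseteq> e" by blast+
  obtain p where p: "p \<in> H" "seg p = s" using segment_path[OF \<open>s \<in> segments\<close>] by blast
  obtain q where q: "q \<in> H" "seg q = s'" using segment_path[OF \<open>s' \<in> segments\<close>] by blast
  note pq = p q
  have "p \<in> e" "q \<in> e" using pq in_seg[OF p(1)] in_seg[OF q(1)] \<open>s \<subseteq> e\<close> \<open>s' \<subseteq> e\<close> by blast+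
  then have pe: "p \<in> ends e" "q \<in> ends e" using pq(1,3) by (simp_all add: ends_def)
  have eE: "e \<in> V \<union> E" using e by simp
  have "q \<notin> {p, \<alpha> p}" using pq(2,4) s(2) seg_opp[OF pq(1)] by blast
  moreover have "ends e \<subseteq> {p, \<alpha> p, q, \<alpha> q}"
  proof
    fix r assume r: "r \<in> ends e"
    then have rH: "r \<in> H" by (rule ends_H)
    have "seg r \<subseteq> rim e" using ends_iff[OF eE, of r] r by simp
    then have "seg r \<in> {s \<in> segments. s \<subseteq> e}"
      using path_segment[OF rH] disc_props(3)[OF eE] by (simp only: mem_Collect_eq) (metis subset_trans)
    then have "seg r \<in> {s, s'}" by (simp only: s(1))
    then have "seg r = s \<or> seg r = s'" by (simp only: insert_iff empty_iff simp_thms)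
    then show "r \<in> {p, \<alpha> p, q, \<alpha> q}"
    proof
      assume "seg r = s"
      then have "r \<in> {p, \<alpha> p}" by (intro same_segment[OF pq(1) rH]) (simp only: pq(2))
      then show ?thesis by blast
    next
      assume "seg r = s'"
      then have "r \<in> {q, \<alpha> q}" by (intro same_segment[OF pq(3) rH]) (simp only: pq(4))
      then show ?thesis by blast
    qed
  qed
  moreover have "{p, \<alpha> p, q, \<alpha> q} \<subseteq> ends e" using pe ends_opp[OF eE pe(1)] ends_opp[OF eE pe(2)] by simp
  ultimately show ?thesis by (metis subset_antisym)
qed

text \<open>A free side of an edge that led back to the segment where it starts would, together with this segment, be
the whole circle of the edge, leaving no place for the second segment.\<close>

lemma \<beta>_neq_opp: "p \<in> H \<Longrightarrow> \<beta> p \<noteq> \<alpha> p"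
proof
  assume p: "p \<in> H" and "\<beta> p = \<alpha> p"
  define e where "e = edge p"
  have e: "e \<in> E" "p \<in> ends e" using edge[OF p] by (auto simp: e_def)
  then have D: "e \<in> V \<union> E" by simp
  have pb: "partner e p = \<alpha> p" using \<open>\<beta> p = \<alpha> p\<close> by (simp add: \<beta>_def e_def)
  have "{p, \<alpha> p} = ends e"
  proof (rule rim_arcsD(11)[OF D e(2)])
    show "{p, \<alpha> p} \<subseteq> ends e" using e(2) ends_opp[OF D] by blast
    show "\<alpha> ` {p, \<alpha> p} \<subseteq> {p, \<alpha> p}" using opp_opp[OF p] by auto
    fix T assume T: "T \<in> \<T> e" "T \<inter> {p, \<alpha> p} \<noteq> {}"
    then have "side e p = T \<or> side e (\<alpha> p) = T" using side_eq[OF D e(2) T(1)] e(2) ends_opp[OF D e(2)] by blast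
    then have "T = side e p" using partner(5)[OF D e(2)] pb by auto
    then show "T \<inter> ends e \<subseteq> {p, \<alpha> p}" using partner(1)[OF D e(2)] pb by auto
  qed simp
  moreover obtain q r where qr: "ends e = {q, \<alpha> q, r, \<alpha> r}" "r \<notin> {q, \<alpha> q}" using ends_edge[OF e(1)] by blast
  ultimately have sub: "{q, \<alpha> q, r} \<subseteq> {p, \<alpha> p}" by blast
  have "q \<in> H" using qr(1) ends_H[of q e] by blast
  then have "card {q, \<alpha> q, r} = 3" using qr(2) opp_neq[of q] by auto
  moreover have "card {q, \<alpha> q, r} \<le> card {p, \<alpha> p}" by (rule card_mono[OF _ sub]) simp
  moreover have "card {p, \<alpha> p} \<le> 2" by (simp add: card_insert_if)
  ultimately show False by linarith
qed

lemma ends_edge_eq: "p \<in> H \<Longrightarrow> ends (edge p) = {p, \<alpha> p, \<beta> p, \<alpha> (\<beta> p)}"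
proof -
  assume p: "p \<in> H"
  obtain q r where qr: "ends (edge p) = {q, \<alpha> q, r, \<alpha> r}" using ends_edge[OF edge(1)[OF p]] by blast
  have qrH: "q \<in> H" "r \<in> H" using qr ends_H by blast+
  have b: "\<beta> p \<in> ends (edge p)" using partner(3)[of "edge p" p] edge[OF p] by (simp add: \<beta>_def)
  have "p \<in> {q, \<alpha> q, r, \<alpha> r}" "\<beta> p \<in> {q, \<alpha> q, r, \<alpha> r}" using edge(2)[OF p] b qr by auto
  moreover have "\<beta> p \<notin> {p, \<alpha> p}" using \<beta>_neq_opp[OF p] matching_onD(3)[OF matching_\<beta> p] by auto
  ultimately show ?thesis unfolding qr using opp_opp[OF qrH(1)] opp_opp[OF qrH(2)] by auto
qed

lemma \<beta>_opp: "p \<in> H \<Longrightarrow> \<beta> (\<alpha> p) = \<alpha> (\<beta> p)"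
proof -
  assume p: "p \<in> H"
  have ap: "\<alpha> p \<in> H" using opp[OF p] .
  have "\<beta> (\<alpha> p) \<in> ends (edge p)"
    using partner(3)[of "edge p" "\<alpha> p"] edge[OF ap] opp_vert(2)[OF p] by (simp add: \<beta>_def)
  then have "\<beta> (\<alpha> p) \<in> {p, \<alpha> p, \<beta> p, \<alpha> (\<beta> p)}" using ends_edge_eq[OF p] by simp
  moreover have "\<beta> (\<alpha> p) \<noteq> \<alpha> p" using matching_onD(3)[OF matching_\<beta> ap] .
  moreover have "\<beta> (\<alpha> p) \<noteq> p" using \<beta>_neq_opp[OF ap] opp_opp[OF p] by simp
  moreover have "\<beta> (\<alpha> p) \<noteq> \<beta> p" using matching_onD(2)[OF matching_\<beta>] ap p opp_neq[OF p] by metis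
  ultimately show ?thesis by blast
qed

text \<open>A vertex without edges has no ends on its circle. A point picked from the circle represents it among the
points to be counted.\<close>

definition "isolated = {v \<in> V. ends v = {}}"
definition "pick v = (SOME x. x \<in> rim v)"
definition "G = H \<union> pick ` isolated"

lemma pick: "v \<in> V \<Longrightarrow> pick v \<in> rim v" "v \<in> V \<Longrightarrow> pick v \<in> v" "v \<in> V \<Longrightarrow> vert (pick v) = v"
proof -
  assume v: "v \<in> V"
  show 1: "pick v \<in> rim v" unfolding pick_def using disc_props(6)[of v] v by (simp add: some_in_eq)
  show 2: "pick v \<in> v" using 1 disc_props(3)[of v] v by auto
  show "vert (pick v) = v" using vert_eq[OF v 2] .
qed

lemma pick_not_H: "v \<in> isolated \<Longrightarrow> pick v \<notin> H"
  using pick(2)[of v] by (auto simp: isolated_def ends_def)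

lemma finite_G: "finite G"
  using fin_H finite_V by (auto simp: G_def isolated_def)

sublocale edge_matchings H G \<tau> \<alpha> \<beta> edge
proof
  show "y \<in> {x, \<alpha> x, \<beta> x, \<alpha> (\<beta> x)}" if "x \<in> H" "y \<in> H" "edge x = edge y" for x y
    using ends_edge_eq[OF that(1)] edge(2)[OF that(2)] that(3) by simp
  show "\<alpha> x \<noteq> \<beta> x" if "x \<in> H" for x using \<beta>_neq_opp[OF that] by simp
qed (use finite_G matching_\<tau> matching_\<alpha> matching_\<beta> opp_vert \<beta>_edge \<beta>_opp in \<open>auto simp: G_def\<close>)

lemma edge_image: "edge ` H = E"
proof
  show "edge ` H \<subseteq> E" using edge(1) by blast
  show "E \<subseteq> edge ` H"
  proof
    fix e assume e: "e \<in> E"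
    then obtain p where "p \<in> ends e" using ends_edge by blast
    then show "e \<in> edge ` H" using ends_vert(2)[OF e] ends_H by blast
  qed
qed

section \<open>Components of the surface\<close>

lemma G_cases:
  assumes "p \<in> G"
  obtains "p \<in> H" "vert p \<in> V" "p \<in> ends (vert p)" "edge p \<in> E"
  | "p \<notin> H" "vert p \<in> V" "ends (vert p) = {}" "p = pick (vert p)" "p \<in> vert p"
proof (cases "p \<in> H")
  case True
  then show ?thesis using that(1) vert[OF True] edge[OF True] by blast
next
  case False
  then obtain v where v: "v \<in> isolated" "p = pick v" using assms by (auto simp: G_def)
  then have vV: "v \<in> V" "ends v = {}" by (auto simp: isolated_def)
  show ?thesis using that(2) False pick(2)[OF vV(1)] pick(3)[OF vV(1)] v(2) vV by simp
qed

lemma vert_in: "p \<in> G \<Longrightarrow> p \<in> vert p" "p \<in> G \<Longrightarrow> vert p \<in> V"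
  by (erule G_cases; simp add: ends_def)+

text \<open>Going around the circle of \<open>D\<close> one passes through all its ends.\<close>

lemma closed_under_matchings:
  assumes D: "D \<in> V \<union> E" and p: "p \<in> W" and W: "W \<subseteq> ends D"
    and a: "\<And>x. x \<in> W \<Longrightarrow> \<alpha> x \<in> W" and t: "\<And>x. x \<in> W \<Longrightarrow> partner D x \<in> W"
  shows "W = ends D"
proof (rule rim_arcsD(11)[OF D])
  show pD: "p \<in> ends D" using p W by blast
  show "\<alpha> ` W \<subseteq> W" using a by blast
  fix T assume T: "T \<in> \<T> D" "T \<inter> W \<noteq> {}"
  then obtain x where x: "x \<in> T" "x \<in> W" by blast
  then have xD: "x \<in> ends D" using W by blast
  have "side D x = T" by (rule side_eq[OF D pD T(1) x(1) xD])
  then have "T \<inter> ends D = {x, partner D x}" using partner(1)[OF D xD] by simp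
  then show "T \<inter> ends D \<subseteq> W" using x(2) t[OF x(2)] by simp
qed (use p W in auto)

lemma full_link_step:
  assumes "p \<in> H"
  shows "(p, \<tau> p) \<in> full_link" "(p, \<alpha> p) \<in> full_link" "(p, \<beta> p) \<in> full_link"
  using assms by (auto simp: full_link_def matched_def)

lemma full_link_vert:
  assumes p: "p \<in> H" and q: "q \<in> ends (vert p)"
  shows "(p, q) \<in> full_link\<^sup>*"
proof -
  have D: "vert p \<in> V \<union> E" using vert(1)[OF p] by simp
  let ?W = "{r \<in> ends (vert p). (p, r) \<in> full_link\<^sup>*}"
  have "?W = ends (vert p)"
  proof (rule closed_under_matchings[OF D])
    show "p \<in> ?W" using vert(2)[OF p] by simp
    fix x assume x: "x \<in> ?W"
    then have xe: "x \<in> ends (vert p)" and px: "(p, x) \<in> full_link\<^sup>*" by blast+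
    have xH: "x \<in> H" by (rule ends_H[OF xe])
    have vx: "vert x = vert p" by (rule ends_vert(1)[OF vert(1)[OF p] xe])
    show "\<alpha> x \<in> ?W" using ends_opp[OF D xe] rtrancl_into_rtrancl[OF px full_link_step(2)[OF xH]] by simp
    show "partner (vert p) x \<in> ?W"
      using partner(3)[OF D xe] rtrancl_into_rtrancl[OF px full_link_step(1)[OF xH]] vx by (simp add: \<tau>_def)
  qed simp
  then show ?thesis using q by blast
qed

lemma full_link_edge:
  assumes p: "p \<in> H" and q: "q \<in> ends (edge p)"
  shows "(p, q) \<in> full_link\<^sup>*"
proof -
  have "(p, \<alpha> p) \<in> full_link\<^sup>*" "(p, \<beta> p) \<in> full_link\<^sup>*" using full_link_step[OF p] by blast+
  moreover have "(p, \<alpha> (\<beta> p)) \<in> full_link\<^sup>*"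
    using rtrancl_into_rtrancl[OF \<open>(p, \<beta> p) \<in> full_link\<^sup>*\<close> full_link_step(2)[OF \<beta>_H[OF p]]] .
  ultimately show ?thesis using q ends_edge_eq[OF p] by auto
qed

lemma sym_full_link: "sym full_link"
  unfolding full_link_def by (intro sym_Un sym_matched matching_\<tau> matching_\<alpha> matching_\<beta>)

lemma sym_link: "sym (link A)"
  unfolding link_def by (intro sym_Un sym_matched matching_\<tau> mate)

lemma edge_not_at_isolated:
  assumes "v \<in> V" "ends v = {}" "e \<in> E" shows "v \<inter> e = {}"
  using meet_in_seg[OF assms(1,3)] assms(2) by blast

text \<open>The pieces are the isolated vertices and, for each end, the vertex and the edge on which it lies. When two pieces meet, one
comes from the end of the one to the end of the other by going around the circles of vertices and edges.\<close>

theorem num_components_eq: "num_components X = num_parts"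
  unfolding num_components_def num_parts_def
proof (rule card_connected_components_of_pieces[where P = "\<lambda>p. vert p \<union> (if p \<in> H then edge p else {})"])
  let ?P = "\<lambda>p. vert p \<union> (if p \<in> H then edge p else {})"
  show "finite G" by (rule finite_G)
  show "closedin X (?P p)" if "p \<in> G" for p
    using that by (cases rule: G_cases) (use disc_props(1) in auto)
  show "connectedin X (?P p)" if "p \<in> G" for p
    using that
  proof (cases rule: G_cases)
    case 1
    have "p \<in> vert p \<inter> edge p" using 1 edge(2) by (auto simp: ends_def)
    then show ?thesis using 1 disc_props(2) by (auto intro!: connectedin_Un)
  next
    case 2
    then show ?thesis using disc_props(2) by auto
  qed
  show "?P p \<noteq> {}" if "p \<in> G" for p using vert_in[OF that] by blast
  show "topspace X = (\<Union>p\<in>G. ?P p)"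
  proof
    show "(\<Union>p\<in>G. ?P p) \<subseteq> topspace X"
    proof (rule UN_least)
      fix p assume "p \<in> G"
      then show "?P p \<subseteq> topspace X"
        by (cases rule: G_cases) (use disc_props(8) in auto)
    qed
    show "topspace X \<subseteq> (\<Union>p\<in>G. ?P p)"
    proof
      fix x assume "x \<in> topspace X"
      then consider v where "v \<in> V" "x \<in> v" | e where "e \<in> E" "x \<in> e" using cover by blast
      then show "x \<in> (\<Union>p\<in>G. ?P p)"
      proof cases
        case (1 v)
        show ?thesis
        proof (cases "ends v = {}")
          case True
          then have "pick v \<in> G" "vert (pick v) = v" using 1 pick(3)[OF 1(1)] by (auto simp: G_def isolated_def)
          then show ?thesis using 1 by auto
        next
          case False
          then obtain p where p: "p \<in> ends v" by blast
          then have "p \<in> G" "vert p = v" using ends_vert(1)[OF 1(1) p] ends_H[OF p] by (auto simp: G_def)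
          then show ?thesis using 1 by auto
        qed
      next
        case (2 e)
        obtain p where p: "p \<in> ends e" using ends_edge[OF 2(1)] by blast
        then have "p \<in> G" "p \<in> H" "edge p = e" using ends_vert(2)[OF 2(1) p] ends_H[OF p] by (auto simp: G_def)
        then show ?thesis using 2 by auto
      qed
    qed
  qed
  show "sym full_link" by (rule sym_full_link)
  show "i \<in> G \<and> j \<in> G \<and> ?P i \<inter> ?P j \<noteq> {}" if ij: "(i, j) \<in> full_link" for i j
  proof -
    have i: "i \<in> H" and j: "j = \<tau> i \<or> j = \<alpha> i \<or> j = \<beta> i" using ij by (auto simp: full_link_def matched_def)
    have jH: "j \<in> H" using j \<tau>_H[OF i] opp[OF i] \<beta>_H[OF i] by auto
    have G: "i \<in> G" "j \<in> G" using i jH by (auto simp: G_def)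
    have "vert j = vert i \<or> edge j = edge i" using j \<tau>_vert[OF i] opp_vert[OF i] \<beta>_edge[OF i] by auto
    moreover have "i \<in> vert i" "i \<in> edge i" using vert(2)[OF i] edge(2)[OF i] by (auto simp: ends_def)
    ultimately show ?thesis using G i jH by auto
  qed
  show "(i, j) \<in> full_link\<^sup>*" if i: "i \<in> G" and j: "j \<in> G" and ij: "?P i \<inter> ?P j \<noteq> {}" for i j
    using i
  proof (cases rule: G_cases)
    case i1: 1
    show ?thesis using j
    proof (cases rule: G_cases)
      case j1: 1
      from ij i1 j1 obtain x where x: "x \<in> vert i \<or> x \<in> edge i" "x \<in> vert j \<or> x \<in> edge j" by auto
      have vv: "(i, j) \<in> full_link\<^sup>*" if "vert i = vert j" using full_link_vert[OF i1(1), of j] j1 that by simp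
      have ee: "(i, j) \<in> full_link\<^sup>*" if "edge i = edge j" using full_link_edge[OF i1(1), of j] edge(2)[OF j1(1)] that by simp
      consider "x \<in> vert i" "x \<in> vert j" | "x \<in> edge i" "x \<in> edge j" | "x \<in> vert i" "x \<in> edge j" | "x \<in> edge i" "x \<in> vert j"
        using x by blast
      then show ?thesis
      proof cases
        case 1
        then show ?thesis using vv vertex_unique[OF i1(2) j1(2)] by blast
      next
        case 2
        then show ?thesis using ee edge_unique[OF i1(4) j1(4)] by blast
      next
        case 3
        then obtain r where "r \<in> ends (vert i)" "r \<in> ends (edge j)" using meet_in_seg[OF i1(2) j1(4)] by blast
        then have "(i, r) \<in> full_link\<^sup>*" "(j, r) \<in> full_link\<^sup>*"
          using full_link_vert[OF i1(1)] full_link_edge[OF j1(1)] by blast+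
        then show ?thesis using sym_rtranclD[OF sym_full_link] rtrancl_trans by metis
      next
        case 4
        then obtain r where "r \<in> ends (vert j)" "r \<in> ends (edge i)" using meet_in_seg[OF j1(2) i1(4)] by blast
        then have "(j, r) \<in> full_link\<^sup>*" "(i, r) \<in> full_link\<^sup>*"
          using full_link_vert[OF j1(1)] full_link_edge[OF i1(1)] by blast+
        then show ?thesis using sym_rtranclD[OF sym_full_link] rtrancl_trans by metis
      qed
    next
      case j2: 2
      have "vert i \<noteq> vert j" using i1 j2 by auto
      then have "vert i \<inter> vert j = {}" using vertex_unique[OF i1(2) j2(2)] by blast
      moreover have "vert j \<inter> edge i = {}" using edge_not_at_isolated[OF j2(2,3) i1(4)] .
      ultimately show ?thesis using ij i1 j2 by auto
    qed
  next
    case i2: 2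
    show ?thesis using j
    proof (cases rule: G_cases)
      case j1: 1
      have "vert i \<noteq> vert j" using i2 j1 by auto
      then have "vert i \<inter> vert j = {}" using vertex_unique[OF i2(2) j1(2)] by blast
      moreover have "vert i \<inter> edge j = {}" using edge_not_at_isolated[OF i2(2,3) j1(4)] .
      ultimately show ?thesis using ij i2 j1 by auto
    next
      case j2: 2
      then have "vert i = vert j" using vertex_unique[OF i2(2) j2(2)] ij i2 by auto
      then have "i = j" using i2(4) j2(4) by metis
      then show ?thesis by simp
    qed
  qed
qed

section \<open>The boundary of a spanning subsurface\<close>

definition "rim_part v = (if ends v = {} then rim v else \<Union>(\<T> v))"
text \<open>The part of the boundary of \<open>(V, A)\<close> that continues an arc of a vertex at the end \<open>p\<close>.\<close>

definition "strip A p = (if edge p \<in> A then side (edge p) p else seg p)"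
definition "frontier_of_sub A = (\<Union>v\<in>V. rim_part v) \<union> (\<Union>p\<in>H. strip A p)"

abbreviation "sub A \<equiv> \<Union>V \<union> \<Union>A"

lemma sub_closed:
  assumes "A \<subseteq> E" "W \<subseteq> V \<union> A" shows "closedin X (\<Union>W)"
proof (rule closedin_Union)
  show "finite W" using assms finite_V finite_E by (meson finite_UnI finite_subset)
  show "closedin X D" if "D \<in> W" for D using that assms disc_props(1)[of D] by blast
qed

lemma sub_topspace: "A \<subseteq> E \<Longrightarrow> sub A \<subseteq> topspace X" using cover by blast

text \<open>A point that lies in only one of the discs has a neighbourhood inside this disc, because the other
discs have a closed union.\<close>

lemma planar_off_others:
  assumes A: "A \<subseteq> E" and D: "D \<in> V \<union> A" and x: "x \<in> D" "\<And>D'. D' \<in> V \<union> A \<Longrightarrow> x \<in> D' \<Longrightarrow> D' = D"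
  shows "x \<in> surface_boundary (spanning_subsurface X V A) \<longleftrightarrow> x \<in> rim D"
proof -
  let ?Y = "spanning_subsurface X V A"
  have DVE: "D \<in> V \<union> E" using D A by blast
  have tY: "topspace ?Y = sub A" using sub_topspace[OF A] by (auto simp: spanning_subsurface_def)
  let ?R = "\<Union>(V \<union> A - {D})"
  define U where "U = sub A - ?R"
  have "closedin X ?R" by (rule sub_closed[OF A]) blast
  then have "closedin ?Y (sub A \<inter> ?R)" unfolding spanning_subsurface_def by (metis Int_commute closedin_subtopology)
  then have "openin ?Y (topspace ?Y - sub A \<inter> ?R)" by blast
  moreover have "topspace ?Y - sub A \<inter> ?R = U" unfolding tY U_def by blast
  ultimately have oU: "openin ?Y U" by simp
  have UD: "U \<subseteq> D" unfolding U_def by blast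
  have xU: "x \<in> U" unfolding U_def using x D by blast
  have DS: "D \<subseteq> sub A" using D by blast
  have "subtopology ?Y D = subtopology X D"
    unfolding spanning_subsurface_def subtopology_subtopology using DS by (simp add: inf_absorb2)
  then have "planar_at ?Y x \<longleftrightarrow> planar_at (subtopology X D) x" using planar_at_local[OF oU UD xU] by simp
  moreover have "x \<in> topspace ?Y" "x \<in> topspace (subtopology X D)" using x(1) DS tY disc_props(8)[OF DVE] by auto
  ultimately show ?thesis unfolding surface_boundary_eq by simp
qed

lemma open_segment_not_boundary:
  assumes p: "p \<in> H" and x: "x \<in> seg p" "x \<notin> {p, \<alpha> p}" and e: "edge p \<in> A" and A: "A \<subseteq> E"
  shows "x \<notin> surface_boundary (spanning_subsurface X V A)"
proof -
  let ?v = "vert p" and ?e = "edge p"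
  have D: "?v \<in> V \<union> E" "?e \<in> V \<union> E" using vert(1)[OF p] edge(1)[OF p] by auto
  obtain gD gF where g: "disc_param X ?v gD" "disc_param X ?e gF" using disc_param[OF D(1)] disc_param[OF D(2)] by blast
  obtain t where t: "t \<in> {0..1}" "x = \<gamma> p t" using x(1) by blast
  have "t \<noteq> 0" using x(2) t path_0[OF p] by auto
  moreover have "t \<noteq> 1" using x(2) t path_opp[OF p, of 0] path_0[OF opp[OF p]] by auto
  ultimately have t01: "0 < t" "t < 1" using t(1) by auto
  have rv: "rim ?v = gD ` sphere 0 1" "rim ?e = gF ` sphere 0 1" using rim_param g by auto
  have s: "seg p \<subseteq> rim ?v" "seg p \<subseteq> rim ?e" using ends_iff[OF D(1), of p] ends_iff[OF D(2), of p] vert(2)[OF p] edge(2)[OF p] by auto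
  have int: "?v \<inter> ?e \<subseteq> rim ?v" "?v \<inter> ?e \<subseteq> rim ?e"
    using meet_in_segment[OF vert(1)[OF p] edge(1)[OF p]] by blast+
  have ball: "g ` ball 0 1 \<inter> g ` sphere 0 1 = {}" "g ` ball 0 1 \<subseteq> B" if "disc_param X B g" for g B
  proof -
    show "g ` ball 0 1 \<inter> g ` sphere 0 1 = {}"
    proof (rule ccontr)
      assume "g ` ball 0 1 \<inter> g ` sphere 0 1 \<noteq> {}"
      then obtain z w where "z \<in> ball 0 1" "w \<in> sphere 0 1" "g z = g w" by blast
      then show False using disc_param_eq_iff[OF that, of z w] by auto
    qed
    show "g ` ball 0 1 \<subseteq> B" using disc_paramD(3)[OF that] ball_subset_cball by blast
  qed
  have i1: "gD ` ball 0 1 \<inter> ?e = {}" using ball[OF g(1)] int(1) rv(1) by blast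
  have i2: "gF ` ball 0 1 \<inter> ?v = {}" using ball[OF g(2)] int(2) rv(2) by blast
  from seam_point_planar[OF surface g path_cont[OF p] path_inj[OF p] s[unfolded rv] i1 i2 t01]
  obtain U where U: "\<gamma> p t \<in> U" "U \<subseteq> ?v \<union> ?e" "planar_nbhd X U" by blast
  have US: "U \<subseteq> sub A" using U(2) vert(1)[OF p] e by blast
  then have "planar_nbhd (spanning_subsurface X V A) U"
    using U(3) unfolding planar_nbhd_def spanning_subsurface_def subtopology_subtopology
    by (metis inf.absorb2 inf.orderE openin_subtopology_Int)
  then show ?thesis using U(1) t(2) unfolding surface_boundary_eq planar_at_def by blast
qed

text \<open>Points of a complementary arc other than its ends lie in only one of the discs. The ends belong to the boundary because
the boundary is closed; no neighbourhood of an end has to be examined.\<close>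

lemma side_closure:
  assumes A: "A \<subseteq> E" and D: "D \<in> V \<union> A" and T: "T \<in> \<T> D" and ne: "p \<in> ends D"
  shows "T \<subseteq> surface_boundary (spanning_subsurface X V A)"
proof -
  let ?Y = "spanning_subsurface X V A"
  have DVE: "D \<in> V \<union> E" using D A by blast
  have "rim D - (\<Union>q\<in>ends D. seg q) \<subseteq> surface_boundary ?Y"
  proof
    fix x assume x: "x \<in> rim D - (\<Union>q\<in>ends D. seg q)"
    then have xD: "x \<in> D" using disc_props(3)[OF DVE] by blast
    have "D' = D" if D': "D' \<in> V \<union> A" "x \<in> D'" for D'
    proof (rule ccontr)
      assume "D' \<noteq> D"
      then consider "D \<in> V" "D' \<in> E" | "D \<in> E" "D' \<in> V"
        using D D' A vertex_unique[of D D' x] edge_unique[of D D' x] xD by blast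
      then show False
      proof cases
        case 1
        then show False using meet_in_seg[OF 1 xD D'(2)] x by blast
      next
        case 2
        then show False using meet_in_seg[OF 2(2,1) D'(2) xD] x by blast
      qed
    qed
    then show "x \<in> surface_boundary ?Y" using planar_off_others[OF A D xD] x by blast
  qed
  moreover have "closedin X (surface_boundary ?Y)"
  proof -
    have "closedin X (sub A)" using sub_closed[OF A, of "V \<union> A"] by simp
    then show ?thesis using closedin_surface_boundary[of ?Y] unfolding spanning_subsurface_def
      using closedin_trans_full by blast
  qed
  ultimately have "X closure_of (rim D - (\<Union>q\<in>ends D. seg q)) \<subseteq> surface_boundary ?Y"
    by (rule closure_of_minimal)
  then show ?thesis using rim_arcsD(10)[OF DVE ne T] by blast
qed

text \<open>A point in just one vertex or edge is on the boundary if and only if it is on the rim there. A point in two of them lies on a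
segment of an edge in \<open>A\<close>, and of such a segment only the two ends remain on the boundary.\<close>

theorem surface_boundary_sub:
  assumes A: "A \<subseteq> E"
  shows "surface_boundary (spanning_subsurface X V A) = frontier_of_sub A"
proof
  let ?Y = "spanning_subsurface X V A"
  show "frontier_of_sub A \<subseteq> surface_boundary ?Y"
  proof -
    have "rim_part v \<subseteq> surface_boundary ?Y" if v: "v \<in> V" for v
    proof (cases "ends v = {}")
      case True
      have "x \<in> surface_boundary ?Y" if x: "x \<in> rim v" for x
      proof -
        have xv: "x \<in> v" using x disc_props(3)[of v] v by blast
        have "D' = v" if D': "D' \<in> V \<union> A" "x \<in> D'" for D'
          using D' edge_not_at_isolated[OF v True] vertex_unique[OF _ v D'(2) xv] A xv by blast
        then show ?thesis using planar_off_others[OF A _ xv] v x by blast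
      qed
      then show ?thesis using True by (auto simp: rim_part_def)
    next
      case False
      then obtain p where p: "p \<in> ends v" by blast
      have "T \<subseteq> surface_boundary ?Y" if "T \<in> \<T> v" for T using side_closure[OF A _ that p] v by blast
      then show ?thesis using False unfolding rim_part_def by auto
    qed
    moreover have "strip A p \<subseteq> surface_boundary ?Y" if p: "p \<in> H" for p
    proof (cases "edge p \<in> A")
      case True
      have D: "edge p \<in> V \<union> E" using edge(1)[OF p] by simp
      have "side (edge p) p \<subseteq> surface_boundary ?Y"
        using side_closure[OF A _ side(1)[OF D edge(2)[OF p]] edge(2)[OF p]] True by blast
      then show ?thesis using True by (simp add: strip_def)
    next
      case False
      have "x \<in> surface_boundary ?Y" if x: "x \<in> seg p" for x
      proof -
        have xv: "x \<in> vert p" and xe: "x \<in> edge p" using seg_in[OF p] x by blast+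
        have "D' = vert p" if D': "D' \<in> V \<union> A" "x \<in> D'" for D'
          using D' vertex_unique[OF _ vert(1)[OF p] D'(2) xv] edge_unique[OF _ edge(1)[OF p] D'(2) xe] A False by blast
        moreover have "seg p \<subseteq> rim (vert p)" using ends_iff[of "vert p" p] vert[OF p] by simp
        ultimately show ?thesis using planar_off_others[OF A _ xv] vert(1)[OF p] x by blast
      qed
      then show ?thesis using False by (auto simp: strip_def)
    qed
    ultimately show ?thesis unfolding frontier_of_sub_def by blast
  qed
  show "surface_boundary ?Y \<subseteq> frontier_of_sub A"
  proof
    fix x assume xb: "x \<in> surface_boundary ?Y"
    then have "x \<in> sub A" unfolding surface_boundary_eq spanning_subsurface_def by auto
    have in_strip: "x \<in> frontier_of_sub A" if "p \<in> H" "x \<in> strip A p" for p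
      using that unfolding frontier_of_sub_def by blast
    have in_side: "x \<in> frontier_of_sub A" if v: "v \<in> V" "p \<in> ends v" "T \<in> \<T> v" "x \<in> T" for v p T
    proof -
      have "ends v \<noteq> {}" using v(2) by blast
      then have "x \<in> rim_part v" using v unfolding rim_part_def by auto
      then show ?thesis using v(1) unfolding frontier_of_sub_def by blast
    qed
    show "x \<in> frontier_of_sub A"
    proof (cases "x \<in> \<Union>V")
      case True
      then obtain v where v: "v \<in> V" "x \<in> v" by blast
      have on_seg: "x \<in> frontier_of_sub A" if p: "p \<in> ends v" "x \<in> seg p" for p
      proof -
        have pH: "p \<in> H" by (rule ends_H[OF p(1)])
        show ?thesis
        proof (cases "edge p \<in> A")
          case False
          then show ?thesis using in_strip[OF pH] p(2) by (simp add: strip_def)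
        next
          case True
          have "x \<in> {p, \<alpha> p}" using open_segment_not_boundary[OF pH p(2) _ True A] xb by blast
          then have xe: "x \<in> ends v" using p(1) ends_opp[of v p] v(1) by auto
          then have "x \<in> side v x" "side v x \<in> \<T> v" using side[of v x] v(1) by auto
          then show ?thesis using in_side[OF v(1) xe] by blast
        qed
      qed
      show ?thesis
      proof (cases "\<exists>e\<in>A. x \<in> e")
        case True
        then obtain e where "e \<in> A" "x \<in> e" by blast
        then obtain r where "r \<in> ends v" "x \<in> seg r" using meet_in_seg[OF v(1) _ v(2)] A by blast
        then show ?thesis by (rule on_seg)
      next
        case False
        have "D' = v" if D': "D' \<in> V \<union> A" "x \<in> D'" for D'
          using D' vertex_unique[OF _ v(1) D'(2) v(2)] False by blast
        then have xr: "x \<in> rim v" using planar_off_others[OF A _ v(2)] v(1) xb by blast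
        show ?thesis
        proof (cases "ends v = {}")
          case True
          then have "x \<in> rim_part v" using xr by (simp add: rim_part_def)
          then show ?thesis using v(1) unfolding frontier_of_sub_def by blast
        next
          case False
          then obtain p where p: "p \<in> ends v" by blast
          have "rim v = \<Union>(\<T> v) \<union> (\<Union>q\<in>ends v. seg q)" using rim_arcsD(9)[OF _ p] v(1) by simp
          then consider T where "T \<in> \<T> v" "x \<in> T" | q where "q \<in> ends v" "x \<in> seg q" using xr by blast
          then show ?thesis
          proof cases
            case (1 T)
            then show ?thesis by (rule in_side[OF v(1) p])
          next
            case (2 q)
            then show ?thesis by (rule on_seg)
          qed
        qed
      qed
    next
      case False
      then obtain e where e: "e \<in> A" "x \<in> e" using \<open>x \<in> sub A\<close> by blast
      then have eE: "e \<in> E" "e \<in> V \<union> E" using A by auto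
      have "D' = e" if D': "D' \<in> V \<union> A" "x \<in> D'" for D'
        using D' edge_unique[OF _ eE(1) D'(2) e(2)] False A by blast
      then have xr: "x \<in> rim e" using planar_off_others[OF A _ e(2)] e(1) xb by blast
      obtain p where p: "p \<in> ends e" using ends_edge[OF eE(1)] by blast
      have "x \<notin> seg q" if "q \<in> ends e" for q using seg_in(1)[OF ends_H[OF that]] vert(1)[OF ends_H[OF that]] False by blast
      then obtain T where T: "T \<in> \<T> e" "x \<in> T" using rim_arcsD(9)[OF eE(2) p] xr by blast
      obtain q where q: "q \<in> ends e" "q \<in> T" using rim_arcsD(7)[OF eE(2) p T(1)] by blast
      have "side e q = T" by (rule side_eq[OF eE(2) p T(1) q(2,1)])
      moreover have "edge q = e" by (rule ends_vert(2)[OF eE(1) q(1)])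
      ultimately have "x \<in> strip A q" using T(2) e(1) by (simp add: strip_def)
      then show ?thesis by (rule in_strip[OF ends_H[OF q(1)]])
    qed
  qed
qed

lemma vside:
  assumes p: "p \<in> H"
  shows "side (vert p) p \<in> \<T> (vert p)" "p \<in> side (vert p) p" "side (vert p) p \<subseteq> vert p"
    "side (vert p) p \<inter> H = {p, \<tau> p}" "side (vert (\<tau> p)) (\<tau> p) = side (vert p) p"
proof -
  have D: "vert p \<in> V \<union> E" using vert(1)[OF p] by simp
  show 1: "side (vert p) p \<in> \<T> (vert p)" "p \<in> side (vert p) p" using side[OF D vert(2)[OF p]] .
  show 2: "side (vert p) p \<subseteq> vert p" using side_in[OF D vert(2)[OF p] 1(1)] disc_props(3)[OF D] by blast
  then have "side (vert p) p \<inter> H = side (vert p) p \<inter> ends (vert p)" by (auto simp: ends_def)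
  then show "side (vert p) p \<inter> H = {p, \<tau> p}" using partner(1)[OF D vert(2)[OF p]] by (simp add: \<tau>_def)
  show "side (vert (\<tau> p)) (\<tau> p) = side (vert p) p"
    using partner(5)[OF D vert(2)[OF p]] \<tau>_vert[OF p] by (simp add: \<tau>_def)
qed

lemma eside:
  assumes p: "p \<in> H"
  shows "side (edge p) p \<in> \<T> (edge p)" "p \<in> side (edge p) p" "side (edge p) p \<subseteq> edge p"
    "side (edge p) p \<inter> H = {p, \<beta> p}" "side (edge (\<beta> p)) (\<beta> p) = side (edge p) p"
proof -
  have D: "edge p \<in> V \<union> E" using edge(1)[OF p] by simp
  show 1: "side (edge p) p \<in> \<T> (edge p)" "p \<in> side (edge p) p" using side[OF D edge(2)[OF p]] .
  show 2: "side (edge p) p \<subseteq> edge p" using side_in[OF D edge(2)[OF p] 1(1)] disc_props(3)[OF D] by blast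
  then have "side (edge p) p \<inter> H = side (edge p) p \<inter> ends (edge p)" by (auto simp: ends_def)
  then show "side (edge p) p \<inter> H = {p, \<beta> p}" using partner(1)[OF D edge(2)[OF p]] by (simp add: \<beta>_def)
  show "side (edge (\<beta> p)) (\<beta> p) = side (edge p) p"
    using partner(5)[OF D edge(2)[OF p]] \<beta>_edge[OF p] by (simp add: \<beta>_def)
qed

lemma seg_H: "p \<in> H \<Longrightarrow> seg p \<inter> H = {p, \<alpha> p}"
proof -
  assume p: "p \<in> H"
  have "q \<in> {p, \<alpha> p}" if "q \<in> H" "q \<in> seg p" for q
    by (rule segs_disjoint[OF p that(1) that(2) in_seg[OF that(1)]])
  moreover have "\<alpha> p \<in> seg p" using in_seg[OF opp[OF p]] seg_opp[OF p] by simp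
  ultimately show ?thesis using p opp[OF p] in_seg[OF p] by blast
qed

lemma closed_connected_seg: "p \<in> H \<Longrightarrow> closedin X (seg p)" "p \<in> H \<Longrightarrow> connectedin X (seg p)"
proof -
  assume p: "p \<in> H"
  have "compactin (top_of_set {0..1::real}) {0..1}" by (simp add: compactin_subtopology)
  from image_compactin[OF this path_cont[OF p]] show "closedin X (seg p)" using compactin_imp_closedin[OF Hausdorff] by blast
  have "connectedin (top_of_set {0..1::real}) {0..1}" by (simp add: connectedin_subtopology)
  from connectedin_continuous_map_image[OF path_cont[OF p] this] show "connectedin X (seg p)" .
qed

lemma strip:
  assumes p: "p \<in> H"
  shows "closedin X (strip A p)" "connectedin X (strip A p)" "p \<in> strip A p" "strip A p \<subseteq> edge p"
    "strip A p \<inter> H = {p, mate A p}" "strip A (mate A p) = strip A p"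
proof -
  have D: "edge p \<in> V \<union> E" using edge(1)[OF p] by simp
  note s = eside[OF p]
  show "closedin X (strip A p)" "connectedin X (strip A p)" "p \<in> strip A p" "strip A p \<subseteq> edge p"
    using rim_arcsD(6)[OF D edge(2)[OF p] s(1)] rim_arcsD(5)[OF D edge(2)[OF p] s(1)] s(2,3)
      closed_connected_seg[OF p] in_seg[OF p] seg_in(2)[OF p] by (simp_all add: strip_def)
  show "strip A p \<inter> H = {p, mate A p}" using s(4) seg_H[OF p] by (simp add: strip_def mate_def)
  show "strip A (mate A p) = strip A p"
    using s(5) seg_opp[OF p] \<beta>_edge[OF p] opp_vert(2)[OF p] by (simp add: strip_def mate_def)
qed

text \<open>A vertex and an edge meet only in segments, and a complementary arc of a vertex meets a segment only in ends.\<close>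

lemma vside_strip_meet:
  assumes p: "p \<in> H" and q: "q \<in> H" and x: "x \<in> side (vert p) p" "x \<in> strip A q"
  shows "x \<in> H"
proof -
  have D: "vert p \<in> V \<union> E" using vert(1)[OF p] by simp
  have xv: "x \<in> vert p" and xe: "x \<in> edge q" using x vside(3)[OF p] strip(4)[OF q] by blast+
  obtain r where r: "r \<in> ends (vert p)" "x \<in> seg r" using meet_in_seg[OF vert(1)[OF p] edge(1)[OF q] xv xe] by blast
  have "x \<in> ends (vert p)" using rim_arcsD(8)[OF D vert(2)[OF p] vside(1)[OF p] r(1)] x(1) r(2) by blast
  then show ?thesis by (rule ends_H)
qed

lemma link_step: "p \<in> H \<Longrightarrow> (p, \<tau> p) \<in> link A" "p \<in> H \<Longrightarrow> (p, mate A p) \<in> link A"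
  by (auto simp: link_def matched_def)

text \<open>Apart from the circles of isolated vertices, the boundary is covered by connected closed pieces, one at each end \<open>p\<close>: the arc of the vertex and the part of the edge
that meet in \<open>p\<close>. Since arcs and edge parts meet only in ends, two pieces intersect only if their ends are linked.\<close>

theorem num_boundary_components_eq:
  assumes A: "A \<subseteq> E"
  shows "num_boundary_components X V A = cycles A"
proof -
  let ?F = "frontier_of_sub A"
  let ?Z = "subtopology X ?F"
  let ?P = "\<lambda>p. if p \<in> H then side (vert p) p \<union> strip A p else rim (vert p)"
  have F: "?F \<subseteq> sub A"
    using surface_boundary_sub[OF A] unfolding surface_boundary_eq spanning_subsurface_def by auto
  have FX: "?F \<subseteq> topspace X" using F sub_topspace[OF A] by blast
  have bc: "boundary_components (spanning_subsurface X V A) = connected_components_of ?Z"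
    unfolding boundary_components_def surface_boundary_sub[OF A]
    unfolding spanning_subsurface_def subtopology_subtopology using F by (simp add: inf_absorb2)
  have cov: "?F = (\<Union>p\<in>G. ?P p)"
  proof
    show "?F \<subseteq> (\<Union>p\<in>G. ?P p)"
    proof
      fix x assume "x \<in> ?F"
      then consider v where "v \<in> V" "x \<in> rim_part v" | p where "p \<in> H" "x \<in> strip A p"
        unfolding frontier_of_sub_def by blast
      then show "x \<in> (\<Union>p\<in>G. ?P p)"
      proof cases
        case (1 v)
        show ?thesis
        proof (cases "ends v = {}")
          case True
          then have "v \<in> isolated" using 1 by (simp add: isolated_def)
          then have "pick v \<in> G" "pick v \<notin> H" "vert (pick v) = v" using pick_not_H pick(3)[OF 1(1)] by (auto simp: G_def)
          moreover have "x \<in> rim v" using 1 True by (simp add: rim_part_def)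
          ultimately show ?thesis by (intro UN_I[of "pick v"]) auto
        next
          case False
          then obtain T where T: "T \<in> \<T> v" "x \<in> T" using 1 by (auto simp: rim_part_def)
          obtain p where p: "p \<in> ends v" using False by blast
          have D: "v \<in> V \<union> E" using 1 by simp
          obtain q where q: "q \<in> ends v" "q \<in> T" using rim_arcsD(7)[OF D p T(1)] by blast
          have "side v q = T" by (rule side_eq[OF D p T(1) q(2,1)])
          moreover have "vert q = v" by (rule ends_vert(1)[OF 1(1) q(1)])
          moreover have "q \<in> H" "q \<in> G" using ends_H[OF q(1)] by (auto simp: G_def)
          ultimately show ?thesis using T(2) by auto
        qed
      next
        case (2 p)
        then have "p \<in> G" by (simp add: G_def)
        then show ?thesis using 2 by auto
      qed
    qed
    show "(\<Union>p\<in>G. ?P p) \<subseteq> ?F"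
    proof (rule UN_least)
      fix p assume "p \<in> G"
      then show "?P p \<subseteq> ?F"
      proof (cases rule: G_cases)
        case 1
        have "ends (vert p) \<noteq> {}" using 1 by blast
        then have "side (vert p) p \<subseteq> rim_part (vert p)" using vside(1)[OF 1(1)] by (auto simp: rim_part_def)
        then show ?thesis using 1 unfolding frontier_of_sub_def by auto
      next
        case 2
        then have "rim (vert p) = rim_part (vert p)" by (simp add: rim_part_def)
        then show ?thesis using 2 unfolding frontier_of_sub_def by auto
      qed
    qed
  qed
  have cc: "closedin X (?P p) \<and> connectedin X (?P p) \<and> p \<in> ?P p" if "p \<in> G" for p
    using that
  proof (cases rule: G_cases)
    case 1
    have D: "vert p \<in> V \<union> E" using 1 by simp
    note s = vside[OF 1(1)] and t = strip[OF 1(1), of A]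
    have "closedin X (side (vert p) p)" "connectedin X (side (vert p) p)"
      using rim_arcsD(5,6)[OF D 1(3) s(1)] by blast+
    moreover have "side (vert p) p \<inter> strip A p \<noteq> {}" using s(2) t(3) by blast
    ultimately show ?thesis using s(2) t 1(1) by (simp add: connectedin_Un closedin_Un)
  next
    case 2
    have D: "vert p \<in> V \<union> E" using 2 by simp
    show ?thesis using disc_props(4,5)[OF D] 2 pick(1)[OF 2(2)] by simp
  qed
  have "card (connected_components_of ?Z) = card (classes (link A) G)"
  proof (rule card_connected_components_of_pieces[where P = ?P])
    show "finite G" by (rule finite_G)
    show "sym (link A)" by (rule sym_link)
    fix i assume i: "i \<in> G"
    have sub: "?P i \<subseteq> ?F" using cov i by blast
    show "closedin ?Z (?P i)" using cc[OF i] sub by (intro closedin_subset_topspace) auto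
    show "connectedin ?Z (?P i)" using cc[OF i] sub by (simp add: connectedin_subtopology)
    show "?P i \<noteq> {}" using cc[OF i] by blast
  next
    show "topspace ?Z = (\<Union>p\<in>G. ?P p)" using cov FX by auto
  next
    fix i j assume ij: "(i, j) \<in> link A"
    then have i: "i \<in> H" and j: "j = \<tau> i \<or> j = mate A i" by (auto simp: link_def matched_def)
    have jH: "j \<in> H" using j \<tau>_H[OF i] matching_onD(1)[OF mate i] by auto
    have "side (vert j) j = side (vert i) i \<or> strip A j = strip A i" using j vside(5)[OF i] strip(6)[OF i, of A] by auto
    then have "?P i \<inter> ?P j \<noteq> {}" using i jH vside(2)[OF i] strip(3)[OF i, of A] by auto
    then show "i \<in> G \<and> j \<in> G \<and> ?P i \<inter> ?P j \<noteq> {}" using i jH by (simp add: G_def)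
  next
    fix i j assume i: "i \<in> G" and j: "j \<in> G" and ij: "?P i \<inter> ?P j \<noteq> {}"
    have from_H: "(p, x) \<in> (link A)\<^sup>*" if p: "p \<in> H" "x \<in> H" "x \<in> side (vert p) p \<or> x \<in> strip A p" for p x
    proof -
      have "x \<in> {p, \<tau> p, mate A p}" using that vside(4)[OF p(1)] strip(5)[OF p(1), of A] by blast
      then show ?thesis using link_step[OF p(1)] by auto
    qed
    have through: "(p, q) \<in> (link A)\<^sup>*"
      if p: "p \<in> H" "q \<in> H" and x: "x \<in> H" "x \<in> side (vert p) p \<or> x \<in> strip A p" "x \<in> side (vert q) q \<or> x \<in> strip A q" for p q x
      using from_H[OF p(1) x(1,2)] sym_rtranclD[OF sym_link from_H[OF p(2) x(1,3)]] by (rule rtrancl_trans)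
    have apart: "?P p \<inter> ?P q = {}" if p: "p \<in> H" and q: "q \<in> G" "q \<notin> H" for p q
    proof -
      have q': "vert q \<in> V" "ends (vert q) = {}" using q(1) by (cases rule: G_cases; use q(2) in simp)+
      have "vert q \<noteq> vert p" using q'(2) vert(2)[OF p] by auto
      then have "vert q \<inter> vert p = {}" using vertex_unique[OF q'(1) vert(1)[OF p]] by blast
      moreover have "vert q \<inter> edge p = {}" by (rule edge_not_at_isolated[OF q' edge(1)[OF p]])
      moreover have "rim (vert q) \<subseteq> vert q" using disc_props(3)[of "vert q"] q'(1) by simp
      moreover have "?P p \<subseteq> vert p \<union> edge p" using vside(3)[OF p] strip(4)[OF p, of A] p by auto
      moreover have "?P q = rim (vert q)" using q(2) by simp
      ultimately show ?thesis by blast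
    qed
    consider "i \<in> H" "j \<in> H" | "i \<in> H" "j \<notin> H" | "i \<notin> H" "j \<in> H" | "i \<notin> H" "j \<notin> H" by blast
    then show "(i, j) \<in> (link A)\<^sup>*"
    proof cases
      case 1
      then obtain x where x: "x \<in> side (vert i) i \<or> x \<in> strip A i" "x \<in> side (vert j) j \<or> x \<in> strip A j"
        using ij by auto
      consider "x \<in> side (vert i) i" "x \<in> side (vert j) j" | "x \<in> strip A i" "x \<in> strip A j"
        | "x \<in> side (vert i) i" "x \<in> strip A j" | "x \<in> strip A i" "x \<in> side (vert j) j" using x by blast
      then show ?thesis
      proof cases
        case sv: 1
        have "vert i = vert j"
          by (rule vertex_unique[OF vert(1)[OF 1(1)] vert(1)[OF 1(2)]]) (use sv vside(3)[OF 1(1)] vside(3)[OF 1(2)] in blast)+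
        moreover have "pairwise disjnt (\<T> (vert i))" using rim_arcsD(2)[of "vert i" i] vert[OF 1(1)] by simp
        ultimately have "side (vert i) i = side (vert j) j"
          using vside(1)[OF 1(1)] vside(1)[OF 1(2)] sv unfolding pairwise_def disjnt_def by (metis IntI empty_iff)
        then show ?thesis using through[OF 1 1(2)] vside(2)[OF 1(2)] by simp
      next
        case sv: 2
        have ee: "edge i = edge j"
          by (rule edge_unique[OF edge(1)[OF 1(1)] edge(1)[OF 1(2)]]) (use sv strip(4)[OF 1(1), of A] strip(4)[OF 1(2), of A] in blast)+
        show ?thesis
        proof (cases "edge i \<in> A")
          case True
          have "pairwise disjnt (\<T> (edge i))" using rim_arcsD(2)[of "edge i" i] edge[OF 1(1)] by simp
          then have "side (edge i) i = side (edge j) j"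
            using eside(1)[OF 1(1)] eside(1)[OF 1(2)] sv True ee unfolding pairwise_def disjnt_def strip_def by (metis IntI empty_iff)
          then have "strip A i = strip A j" using True ee by (simp add: strip_def)
          then show ?thesis using through[OF 1 1(2)] strip(3)[OF 1(2), of A] by simp
        next
          case False
          then have "x \<in> seg i" "x \<in> seg j" using sv ee by (simp_all add: strip_def)
          then have "j \<in> {i, \<alpha> i}" by (rule segs_disjoint[OF 1])
          then show ?thesis using link_step(2)[OF 1(1), of A] False by (auto simp: mate_def)
        qed
      next
        case sv: 3
        show ?thesis by (rule through[OF 1 vside_strip_meet[OF 1 sv]]) (use sv in blast)+
      next
        case sv: 4
        show ?thesis by (rule through[OF 1 vside_strip_meet[OF 1(2,1) sv(2,1)]]) (use sv in blast)+
      qed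
    next
      case 2
      then show ?thesis using apart[OF 2(1) j 2(2)] ij by blast
    next
      case 3
      then show ?thesis using apart[OF 3(2) i 3(1)] ij by blast
    next
      case 4
      have iv: "vert i \<in> V" "i = pick (vert i)" using i by (cases rule: G_cases; use 4 in simp)+
      have jv: "vert j \<in> V" "j = pick (vert j)" using j by (cases rule: G_cases; use 4 in simp)+
      have "rim (vert i) \<subseteq> vert i" "rim (vert j) \<subseteq> vert j"
        using disc_props(3)[of "vert i"] disc_props(3)[of "vert j"] iv(1) jv(1) by simp_all
      moreover obtain x where "x \<in> rim (vert i)" "x \<in> rim (vert j)" using ij 4 by auto
      ultimately have "vert i = vert j" using vertex_unique[OF iv(1) jv(1)] by blast
      then have "i = j" using iv(2) jv(2) by metis
      then show ?thesis by simp
    qed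
  qed
  then show ?thesis unfolding num_boundary_components_def bc cycles_def .
qed

text \<open>Each vertex is oriented by its own parametrization, so that this colouring alternates around the vertices but
not necessarily along the edges.\<close>

section \<open>Orientability and alternating colourings\<close>

definition "base_colour p = c (vert p) p"

lemma base_colour:
  assumes p: "p \<in> H"
  shows "base_colour (\<alpha> p) \<noteq> base_colour p" "base_colour (\<tau> p) \<noteq> base_colour p"
proof -
  have D: "vert p \<in> V \<union> E" using vert(1)[OF p] by simp
  show "base_colour (\<alpha> p) \<noteq> base_colour p"
    using rim_arcsD(4)[OF D vert(2)[OF p] vert(2)[OF p]] opp_vert(1)[OF p] by (simp add: base_colour_def)
  show "base_colour (\<tau> p) \<noteq> base_colour p"
    using partner(4)[OF D vert(2)[OF p]] \<tau>_vert[OF p] by (simp add: base_colour_def \<tau>_def)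
qed

lemma vertex_band:
  assumes p: "p \<in> H" and q: "q \<in> H" "vert q = vert p" "q \<notin> {p, \<alpha> p}" "base_colour p \<noteq> base_colour q"
  shows "band X (vert p) \<gamma> p q"
  using rim_arcsD(12)[of "vert p" p p q] vert[OF p] vert(2)[OF q(1)] q by (simp add: base_colour_def)

lemma edge_band:
  assumes p: "p \<in> H" shows "band X (edge p) \<gamma> p (\<beta> p)"
proof -
  have D: "edge p \<in> V \<union> E" using edge(1)[OF p] by simp
  have "c (edge p) p \<noteq> c (edge p) (\<beta> p)" using partner(4)[OF D edge(2)[OF p]] by (simp add: \<beta>_def)
  moreover have "\<beta> p \<in> ends (edge p)" using partner(3)[OF D edge(2)[OF p]] by (simp add: \<beta>_def)
  moreover have "\<beta> p \<notin> {p, \<alpha> p}" using \<beta>_neq_opp[OF p] matching_onD(3)[OF matching_\<beta> p] by auto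
  ultimately show ?thesis using rim_arcsD(12)[OF D edge(2)[OF p] edge(2)[OF p]] by simp
qed

definition "block L F l = \<Union>{v \<in> V. L v = l} \<union> \<Union>{e \<in> F. \<exists>p\<in>ends e. L (vert p) = l}"

text \<open>The labelling \<open>L\<close> groups the vertices into blocks that are closed under the edges in \<open>F\<close>, and the colouring \<open>d\<close> orients each
block. Bands through a block between segments of edges outside \<open>F\<close> record that the block is
connected, in a form that survives the merging of blocks and spares any search for simple closed walks.\<close>

definition "oriented_blocks F d L \<longleftrightarrow>
   (\<forall>p\<in>H. d (\<alpha> p) \<noteq> d p \<and> d (\<tau> p) \<noteq> d p) \<and>
   (\<forall>p\<in>H. edge p \<in> F \<longrightarrow> d (\<beta> p) \<noteq> d p \<and> L (vert (\<beta> p)) = L (vert p)) \<and>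
   (\<forall>p\<in>H. \<forall>q\<in>H. edge p \<notin> F \<longrightarrow> edge q \<notin> F \<longrightarrow> q \<notin> {p, \<alpha> p} \<longrightarrow> d p \<noteq> d q \<longrightarrow> L (vert p) = L (vert q) \<longrightarrow>
      band X (block L F (L (vert p))) \<gamma> p q)" for d :: "'a \<Rightarrow> bool" and L :: "'a set \<Rightarrow> 'a set"

lemma oriented_blocks_empty: "oriented_blocks {} base_colour id"
  unfolding oriented_blocks_def
proof (intro conjI ballI impI)
  fix p q assume *: "p \<in> H" "q \<in> H" "q \<notin> {p, \<alpha> p}" "base_colour p \<noteq> base_colour q" "id (vert p) = id (vert q)"
  have "band X (vert p) \<gamma> p q" using vertex_band[OF *(1,2) _ *(3,4)] *(5) by simp
  then show "band X (block id {} (id (vert p))) \<gamma> p q"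
    by (rule band_mono) (use vert(1)[OF *(1)] in \<open>auto simp: block_def\<close>)
qed (use base_colour in auto)

lemma block_meet_edge:
  assumes F: "F \<subseteq> E" and e: "e \<in> E" "e \<notin> F" and x: "x \<in> block L F l" "x \<in> e"
  shows "\<exists>r\<in>ends e. L (vert r) = l \<and> x \<in> seg r"
proof -
  consider v where "v \<in> V" "L v = l" "x \<in> v" | e' where "e' \<in> F" "x \<in> e'" using x(1) unfolding block_def by blast
  then show ?thesis
  proof cases
    case (1 v)
    obtain r where r: "r \<in> ends v" "r \<in> ends e" "x \<in> seg r" using meet_in_seg[OF 1(1) e(1) 1(3) x(2)] by blast
    then show ?thesis using ends_vert(1)[OF 1(1) r(1)] 1(2) by blast
  next
    case (2 e')
    then show ?thesis using edge_unique[of e' e x] F e x(2) by blast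
  qed
qed


lemma oriented_blocksD:
  assumes "oriented_blocks F d L"
  shows "p \<in> H \<Longrightarrow> d (\<alpha> p) \<noteq> d p" "p \<in> H \<Longrightarrow> d (\<tau> p) \<noteq> d p"
    "p \<in> H \<Longrightarrow> edge p \<in> F \<Longrightarrow> d (\<beta> p) \<noteq> d p" "p \<in> H \<Longrightarrow> edge p \<in> F \<Longrightarrow> L (vert (\<beta> p)) = L (vert p)"
    "p \<in> H \<Longrightarrow> q \<in> H \<Longrightarrow> edge p \<notin> F \<Longrightarrow> edge q \<notin> F \<Longrightarrow> q \<notin> {p, \<alpha> p} \<Longrightarrow> d p \<noteq> d q \<Longrightarrow> L (vert p) = L (vert q) \<Longrightarrow>
      band X (block L F (L (vert p))) \<gamma> p q"
  using assms unfolding oriented_blocks_def by meson+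

lemma edge_ends:
  assumes "e \<in> E" "p \<in> ends e"
  shows "p \<in> H" "edge p = e" "ends e = {p, \<alpha> p, \<beta> p, \<alpha> (\<beta> p)}" "\<beta> p \<in> ends e" "\<alpha> p \<in> ends e" "\<beta> (\<beta> p) = p"
    "\<beta> (\<alpha> p) = \<alpha> (\<beta> p)" "\<beta> p \<notin> {p, \<alpha> p}" "\<alpha> (\<beta> p) \<notin> {p, \<alpha> p}" "\<beta> p \<in> H" "\<alpha> p \<in> H" "\<alpha> (\<beta> p) \<in> H"
proof -
  show p: "p \<in> H" by (rule ends_H[OF assms(2)])
  show e: "edge p = e" by (rule ends_vert(2)[OF assms])
  show en: "ends e = {p, \<alpha> p, \<beta> p, \<alpha> (\<beta> p)}" using ends_edge_eq[OF p] e by simp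
  then show "\<beta> p \<in> ends e" "\<alpha> p \<in> ends e" by blast+
  show bb: "\<beta> (\<beta> p) = p" by (rule matching_onD(2)[OF matching_\<beta> p])
  show "\<beta> (\<alpha> p) = \<alpha> (\<beta> p)" by (rule \<beta>_opp[OF p])
  show nb: "\<beta> p \<notin> {p, \<alpha> p}" using \<beta>_neq_opp[OF p] matching_onD(3)[OF matching_\<beta> p] by auto
  show bH: "\<beta> p \<in> H" "\<alpha> p \<in> H" by (rule \<beta>_H[OF p], rule opp[OF p])
  then show "\<alpha> (\<beta> p) \<in> H" using opp by blast
  show "\<alpha> (\<beta> p) \<notin> {p, \<alpha> p}" using nb opp_opp[OF bH(1)] opp_opp[OF p] by auto
qed

lemma block_disjoint:
  assumes ob: "oriented_blocks F d L" and F: "F \<subseteq> E" and ll: "l \<noteq> l'"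
  shows "block L F l \<inter> block L F l' = {}"
proof -
  have lab: "L (vert r) = L (vert p)" if e: "e \<in> F" and p: "p \<in> ends e" "r \<in> ends e" for e p r
  proof -
    have eE: "e \<in> E" using e F by blast
    note en = edge_ends[OF eE p(1)]
    have "L (vert (\<beta> p)) = L (vert p)" using oriented_blocksD(4)[OF ob en(1)] en(2) e by simp
    then show ?thesis using p(2) en(3) opp_vert(1)[OF en(1)] opp_vert(1)[OF en(10)] by auto
  qed
  have ve: False if h: "v \<in> V" "L v = a" "x \<in> v" "e \<in> F" "p \<in> ends e" "L (vert p) = b" "x \<in> e" "a \<noteq> b" for v a x e p b
  proof -
    have "e \<in> E" using h(4) F by blast
    then obtain r where r: "r \<in> ends v" "r \<in> ends e" using meet_in_seg[OF h(1) _ h(3,7)] by blast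
    have "L (vert r) = b" using lab[OF h(4,5) r(2)] h(6) by simp
    moreover have "L (vert r) = a" using ends_vert(1)[OF h(1) r(1)] h(2) by simp
    ultimately show False using h(8) by simp
  qed
  show ?thesis
  proof (rule ccontr)
    assume "\<not> ?thesis"
    then obtain x where x: "x \<in> block L F l" "x \<in> block L F l'" by blast
    consider v where "v \<in> V" "L v = l" "x \<in> v" | e p where "e \<in> F" "p \<in> ends e" "L (vert p) = l" "x \<in> e"
      using x(1) unfolding block_def by blast
    then show False
    proof cases
      case (1 v)
      consider v' where "v' \<in> V" "L v' = l'" "x \<in> v'" | e p where "e \<in> F" "p \<in> ends e" "L (vert p) = l'" "x \<in> e"
        using x(2) unfolding block_def by blast
      then show False
      proof cases
        case (1 v')
        then show False using vertex_unique[OF \<open>v \<in> V\<close> 1(1) \<open>x \<in> v\<close> 1(3)] \<open>L v = l\<close> ll by blast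
      next
        case (2 e p)
        then show False using ve[OF 1 2] ll by blast
      qed
    next
      case (2 e p)
      consider v' where "v' \<in> V" "L v' = l'" "x \<in> v'" | e' p' where "e' \<in> F" "p' \<in> ends e'" "L (vert p') = l'" "x \<in> e'"
        using x(2) unfolding block_def by blast
      then show False
      proof cases
        case (1 v')
        then show False using ve[OF 1 2] ll by blast
      next
        case (2 e' p')
        then have "e' = e" using edge_unique[of e' e x] F \<open>e \<in> F\<close> \<open>x \<in> e\<close> by blast
        then show False using lab[OF \<open>e \<in> F\<close> \<open>p \<in> ends e\<close>, of p'] 2 \<open>L (vert p) = l\<close> ll by simp
      qed
    qed
  qed
qed

text \<open>The band runs from \<open>x\<close> through the first block to the new edge, along this edge, and through the second block to \<open>y\<close>.\<close>

lemma bridge: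
  assumes ob: "oriented_blocks F d L" and F: "F \<subseteq> E" and e: "e \<in> E" "e \<notin> F" and p: "p \<in> ends e"
    and dp: "d (\<beta> p) \<noteq> d p" and Lp: "L (vert (\<beta> p)) \<noteq> L (vert p)"
    and x: "x \<in> H" "edge x \<notin> insert e F" "L (vert x) = L (vert p)"
    and y: "y \<in> H" "edge y \<notin> insert e F" "L (vert y) = L (vert (\<beta> p))" and xy: "d x \<noteq> d y"
  shows "band X (block L F (L (vert p)) \<union> e \<union> block L F (L (vert (\<beta> p)))) \<gamma> x y"
proof -
  note en = edge_ends[OF e(1) p]
  let ?B = "block L F (L (vert p))" and ?B' = "block L F (L (vert (\<beta> p)))"
  \<comment> \<open>Of the two directions of the segment at \<open>p\<close>, only the one coloured differently from \<open>x\<close> is the end of a band from \<open>x\<close>.\<close>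
  define r where "r = (if d p \<noteq> d x then p else \<alpha> p)"
  have da: "d (\<alpha> p) \<noteq> d p" "d (\<alpha> (\<beta> p)) \<noteq> d (\<beta> p)" using oriented_blocksD(1)[OF ob] en by auto
  have r: "r \<in> ends e" "d r \<noteq> d x" "d (\<beta> r) \<noteq> d r" "vert r = vert p" "vert (\<beta> r) = vert (\<beta> p)" "seg r = seg p" "seg (\<beta> r) = seg (\<beta> p)"
    using p en da dp opp_vert(1)[OF en(1)] opp_vert(1)[OF en(10)] seg_opp[OF en(1)] seg_opp[OF en(10)] by (auto simp: r_def)
  note rn = edge_ends[OF e(1) r(1)]
  have rb: "edge (\<beta> r) = e" using \<beta>_edge[OF rn(1)] rn(2) by simp
  have ex: "edge x \<noteq> e" "edge x \<notin> F" "edge y \<noteq> e" "edge y \<notin> F" using x y by auto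
  have "r \<noteq> x" "r \<noteq> \<alpha> x" using rn(2) ex(1) opp_vert(2)[OF x(1)] by auto
  then have 1: "band X ?B \<gamma> x r"
    using oriented_blocksD(5)[OF ob x(1) rn(1) ex(2) _ _ r(2)[symmetric]] rn(2) e(2) x(3) r(4) by simp
  have 2: "band X e \<gamma> r (\<beta> r)" using edge_band[OF rn(1)] rn(2) by simp
  have "y \<noteq> \<beta> r" "y \<noteq> \<alpha> (\<beta> r)" using rb ex(3) opp_vert(2)[OF rn(10)] by auto
  moreover have "d (\<beta> r) \<noteq> d y" using r(2,3) xy by auto
  ultimately have 3: "band X ?B' \<gamma> (\<beta> r) y"
    using oriented_blocksD(5)[OF ob rn(10) y(1) _ ex(4)] rb e(2) y(3) r(5) by simp
  have Be: "block L F l \<inter> e \<subseteq> (\<Union>s\<in>{s \<in> ends e. L (vert s) = l}. seg s)" for l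
  proof
    fix z assume "z \<in> block L F l \<inter> e"
    then obtain s where "s \<in> ends e" "L (vert s) = l" "z \<in> seg s" using block_meet_edge[OF F e, of z L l] by auto
    then show "z \<in> (\<Union>s\<in>{s \<in> ends e. L (vert s) = l}. seg s)" by (intro UN_I[of s]) simp_all
  qed
  have lab: "L (vert s) = L (vert p) \<and> seg s = seg p \<or> L (vert s) = L (vert (\<beta> p)) \<and> seg s = seg (\<beta> p)" if s: "s \<in> ends e" for s
  proof -
    consider "s = p" | "s = \<alpha> p" | "s = \<beta> p" | "s = \<alpha> (\<beta> p)" using s unfolding en(3) by blast
    then show ?thesis
      using opp_vert(1)[OF en(1)] opp_vert(1)[OF en(10)] seg_opp[OF en(1)] seg_opp[OF en(10)] by cases simp_all
  qed
  have m1: "?B \<inter> e \<subseteq> seg r" unfolding r(6)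
  proof
    fix z assume "z \<in> ?B \<inter> e"
    then obtain s where s: "s \<in> ends e" "L (vert s) = L (vert p)" "z \<in> seg s" using Be[of "L (vert p)"] by blast
    then have "seg s = seg p" using lab[OF s(1)] Lp by simp
    then show "z \<in> seg p" using s(3) by simp
  qed
  have m2: "?B' \<inter> e \<subseteq> seg (\<beta> r)" unfolding r(7)
  proof
    fix z assume "z \<in> ?B' \<inter> e"
    then obtain s where s: "s \<in> ends e" "L (vert s) = L (vert (\<beta> p))" "z \<in> seg s" using Be[of "L (vert (\<beta> p))"] by blast
    then have "seg s = seg (\<beta> p)" using lab[OF s(1)] Lp by simp
    then show "z \<in> seg (\<beta> p)" using s(3) by simp
  qed
  have m3: "?B \<inter> ?B' = {}" by (rule block_disjoint[OF ob F Lp[symmetric]])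
  have 12: "band X (?B \<union> e) \<gamma> x (\<beta> r)" by (rule band_join[OF 1 2 m1])
  show ?thesis by (rule band_join[OF 12 3]) (use m2 m3 in blast)
qed

lemma block_mono: "F \<subseteq> F' \<Longrightarrow> (\<And>v. L v = l \<Longrightarrow> L' v = l') \<Longrightarrow> block L F l \<subseteq> block L' F' l'"
  unfolding block_def by blast

text \<open>If the new edge joins two blocks, reversing one of them makes the colouring alternate along the edge, and the
blocks merge. If it has both ends in one block and the colouring fails to alternate along it, then a band through
the block from one end of the edge to the other closes up with the edge to a Moebius band.\<close>

lemma oriented_blocks_insert:
  assumes ob: "oriented_blocks F d L" and F: "F \<subseteq> E" and e: "e \<in> E" "e \<notin> F" and or: "orientable_surface X"
  shows "\<exists>d L. oriented_blocks (insert e F) d L"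
proof -
  obtain p where p: "p \<in> ends e" using ends_edge[OF e(1)] by blast
  note en = edge_ends[OF e(1) p]
  have eb: "edge (\<beta> p) = e" "edge (\<alpha> (\<beta> p)) = e" using \<beta>_edge[OF en(1)] opp_vert(2)[OF en(10)] en(2) by simp_all
  have over_e: "d' (\<beta> r) \<noteq> d' r \<and> L' (vert (\<beta> r)) = L' (vert r)"
    if d': "\<And>r. r \<in> H \<Longrightarrow> d' (\<alpha> r) \<noteq> d' r" "d' (\<beta> p) \<noteq> d' p" "L' (vert (\<beta> p)) = L' (vert p)" and r: "r \<in> H" "edge r = e"
    for d' :: "'a \<Rightarrow> bool" and L' :: "'a set \<Rightarrow> 'a set" and r
  proof -
    have "r \<in> ends e" using edge(2)[OF r(1)] r(2) by simp
    then consider "r = p" | "r = \<alpha> p" | "r = \<beta> p" | "r = \<alpha> (\<beta> p)" unfolding en(3) by blast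
    then show ?thesis
      using d'(1)[OF en(1)] d'(1)[OF en(10)] d'(2,3) en(6,7) \<beta>_opp[OF en(10)] opp_vert(1)[OF en(1)] opp_vert(1)[OF en(10)]
      by cases auto
  qed
  show ?thesis
  proof (cases "L (vert (\<beta> p)) = L (vert p)")
    case True
    have dp: "d (\<beta> p) \<noteq> d p"
    proof
      assume same: "d (\<beta> p) = d p"
      let ?q = "\<alpha> (\<beta> p)" and ?B = "block L F (L (vert p))"
      have "d p \<noteq> d ?q" using same oriented_blocksD(1)[OF ob en(10)] by simp
      moreover have "L (vert p) = L (vert ?q)" using True opp_vert(1)[OF en(10)] by simp
      ultimately have 1: "band X ?B \<gamma> p ?q"
        using oriented_blocksD(5)[OF ob en(1) en(12) _ _ en(9)] en(2) eb(2) e(2) by simp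
      have 2: "band X e \<gamma> (\<beta> p) p" using edge_band[OF en(10)] eb(1) en(6) by simp
      have 3: "\<gamma> (\<beta> p) t = \<gamma> ?q (1 - t)" if "t \<in> {0..1}" for t
        using path_opp[OF en(10), of "1 - t"] that by simp
      have 4: "?B \<inter> e \<subseteq> seg p \<union> seg ?q"
      proof
        fix z assume "z \<in> ?B \<inter> e"
        then obtain r where r: "r \<in> ends e" "z \<in> seg r" using block_meet_edge[OF F e, of z L "L (vert p)"] by auto
        from r(1) consider "r = p" | "r = \<alpha> p" | "r = \<beta> p" | "r = ?q" unfolding en(3) by blast
        then have "seg r = seg p \<or> seg r = seg ?q"
          using seg_opp[OF en(1)] seg_opp[OF en(10)] by cases simp_all
        then show "z \<in> seg p \<union> seg ?q" using r(2) by blast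
      qed
      show False using moebius_band_of_bands[OF 1 2 3 4] or unfolding orientable_surface_def by blast
    qed
    have "oriented_blocks (insert e F) d L"
      unfolding oriented_blocks_def
    proof (intro conjI ballI impI)
      fix r assume r: "r \<in> H"
      show "d (\<alpha> r) \<noteq> d r" "d (\<tau> r) \<noteq> d r" using oriented_blocksD(1,2)[OF ob r] by blast+
      assume "edge r \<in> insert e F"
      then show "d (\<beta> r) \<noteq> d r" "L (vert (\<beta> r)) = L (vert r)"
        using over_e[OF oriented_blocksD(1)[OF ob] dp True r] oriented_blocksD(3,4)[OF ob r] by blast+
    next
      fix x y assume "x \<in> H" "y \<in> H" "edge x \<notin> insert e F" "edge y \<notin> insert e F" "y \<notin> {x, \<alpha> x}" "d x \<noteq> d y" "L (vert x) = L (vert y)"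
      then have "band X (block L F (L (vert x))) \<gamma> x y" using oriented_blocksD(5)[OF ob] by blast
      then show "band X (block L (insert e F) (L (vert x))) \<gamma> x y"
        by (rule band_mono) (rule block_mono, auto)
    qed
    then show ?thesis by blast
  next
    case False
    let ?l = "L (vert p)" and ?l' = "L (vert (\<beta> p))"
    \<comment> \<open>The block at \<open>\<beta> p\<close> is reversed if the colouring fails to alternate along the new edge.\<close>
    define d' where "d' = (\<lambda>x. if d (\<beta> p) = d p \<and> L (vert x) = ?l' then \<not> d x else d x)"
    have d'p: "d' (\<beta> p) \<noteq> d' p" using False by (auto simp: d'_def)
    have ob': "oriented_blocks F d' L"
      unfolding oriented_blocks_def
    proof (intro conjI ballI impI)
      fix r assume r: "r \<in> H"
      show "d' (\<alpha> r) \<noteq> d' r" "d' (\<tau> r) \<noteq> d' r"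
        using oriented_blocksD(1,2)[OF ob r] opp_vert(1)[OF r] \<tau>_vert[OF r] by (auto simp: d'_def)
      assume "edge r \<in> F"
      then show "d' (\<beta> r) \<noteq> d' r" "L (vert (\<beta> r)) = L (vert r)"
        using oriented_blocksD(3,4)[OF ob r] by (auto simp: d'_def)
    next
      fix x y assume *: "x \<in> H" "y \<in> H" "edge x \<notin> F" "edge y \<notin> F" "y \<notin> {x, \<alpha> x}" "d' x \<noteq> d' y" "L (vert x) = L (vert y)"
      then have "d x \<noteq> d y" by (auto simp: d'_def split: if_splits)
      then show "band X (block L F (L (vert x))) \<gamma> x y" using oriented_blocksD(5)[OF ob] * by blast
    qed
    define L' where "L' = (\<lambda>v. if L v = ?l' then ?l else L v)"
    have L'p: "L' (vert (\<beta> p)) = L' (vert p)" by (simp add: L'_def)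
    have bl: "block L F l \<subseteq> block L' (insert e F) (if l = ?l' then ?l else l)" for l
      by (rule block_mono) (auto simp: L'_def)
    have whole: "block L F ?l \<union> e \<union> block L F ?l' \<subseteq> block L' (insert e F) ?l"
    proof -
      have "e \<subseteq> block L' (insert e F) ?l" using p False unfolding block_def L'_def by auto
      then show ?thesis using bl[of ?l] bl[of ?l'] False by auto
    qed
    have "oriented_blocks (insert e F) d' L'"
      unfolding oriented_blocks_def
    proof (intro conjI ballI impI)
      fix r assume r: "r \<in> H"
      show "d' (\<alpha> r) \<noteq> d' r" "d' (\<tau> r) \<noteq> d' r" using oriented_blocksD(1,2)[OF ob' r] by blast+
      assume er: "edge r \<in> insert e F"
      have "d' (\<beta> r) \<noteq> d' r \<and> L' (vert (\<beta> r)) = L' (vert r)"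
      proof (cases "edge r = e")
        case True
        show ?thesis by (rule over_e[OF oriented_blocksD(1)[OF ob'] d'p L'p r True])
      next
        case False
        then show ?thesis using oriented_blocksD(3,4)[OF ob' r] er by (simp add: L'_def)
      qed
      then show "d' (\<beta> r) \<noteq> d' r" "L' (vert (\<beta> r)) = L' (vert r)" by blast+
    next
      fix x y assume xy: "x \<in> H" "y \<in> H" "edge x \<notin> insert e F" "edge y \<notin> insert e F" "y \<notin> {x, \<alpha> x}" "d' x \<noteq> d' y" "L' (vert x) = L' (vert y)"
      show "band X (block L' (insert e F) (L' (vert x))) \<gamma> x y"
      proof (cases "L (vert x) = L (vert y)")
        case True
        then have "band X (block L F (L (vert x))) \<gamma> x y" using oriented_blocksD(5)[OF ob' xy(1,2)] xy by blast
        then show ?thesis by (rule band_mono) (use bl[of "L (vert x)"] in \<open>simp add: L'_def\<close>)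
      next
        case ne: False
        then have lx: "L' (vert x) = ?l" using xy(7) by (auto simp: L'_def split: if_splits)
        from ne consider "L (vert x) = ?l" "L (vert y) = ?l'" | "L (vert x) = ?l'" "L (vert y) = ?l"
          using xy(7) by (auto simp: L'_def split: if_splits)
        then have "band X (block L F ?l \<union> e \<union> block L F ?l') \<gamma> x y"
        proof cases
          case 1
          show ?thesis by (rule bridge[OF ob' F e p d'p False xy(1,3) 1(1) xy(2,4) 1(2) xy(6)])
        next
          case 2
          have "band X (block L F (L (vert (\<beta> p))) \<union> e \<union> block L F (L (vert (\<beta> (\<beta> p))))) \<gamma> x y"
            by (rule bridge[OF ob' F e en(4)]) (use d'p False xy 2 en(6) in auto)
          then show ?thesis unfolding en(6) by (simp only: Un_ac)
        qed
        then show ?thesis unfolding lx by (rule band_mono[OF _ whole])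
      qed
    qed
    then show ?thesis by blast
  qed
qed

theorem ex_alternating_colouring:
  assumes "orientable_surface X"
  shows "\<exists>d :: 'a \<Rightarrow> bool. \<forall>p\<in>H. d (\<tau> p) \<noteq> d p \<and> d (\<alpha> p) \<noteq> d p \<and> d (\<beta> p) \<noteq> d p"
proof -
  have "\<exists>d L. oriented_blocks F d L" if "finite F" "F \<subseteq> E" for F
    using that
  proof (induction F)
    case empty
    then show ?case using oriented_blocks_empty by blast
  next
    case (insert e F)
    then obtain d L where "oriented_blocks F d L" by blast
    then show ?case using oriented_blocks_insert[OF _ _ _ _ assms] insert by blast
  qed
  then obtain d L where ob: "oriented_blocks E d L" using finite_E by blast
  have "d (\<tau> p) \<noteq> d p \<and> d (\<alpha> p) \<noteq> d p \<and> d (\<beta> p) \<noteq> d p" if "p \<in> H" for p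
    using oriented_blocksD(1-3)[OF ob that] edge(1)[OF that] by blast
  then show ?thesis by blast
qed

end

section \<open>The delta-matroids\<close>

lemma (in ribbon_graph) ex_ribbon_arcs: "\<exists>H \<alpha> \<gamma> c \<T>. ribbon_arcs X V E H \<alpha> \<gamma> c \<T>"
proof -
  obtain H \<alpha> \<gamma> where "ribbon_paths X V E H \<alpha> \<gamma>" using ex_directed_paths by blast
  then interpret ribbon_paths X V E H \<alpha> \<gamma> .
  have "\<exists>c \<T>. \<forall>D. D \<in> V \<union> E \<and> ends D \<noteq> {} \<longrightarrow> disc_arcs X D (rim D) (ends D) \<alpha> \<gamma> (c D) (\<T> D)"
    using ex_rim_arcs by metis
  then obtain c \<T> where "\<And>D. D \<in> V \<union> E \<Longrightarrow> ends D \<noteq> {} \<Longrightarrow> disc_arcs X D (rim D) (ends D) \<alpha> \<gamma> (c D) (\<T> D)"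
    by blast
  then have "ribbon_arcs X V E H \<alpha> \<gamma> c \<T>" by unfold_locales
  then show ?thesis by blast
qed

theorem theorem4p4:
  fixes X :: "'a topology" and V E :: "'a set set" and n :: nat
  assumes "ribbon_graph X V E"
  shows "delta_matroid (D_le X V E n) \<and>
    (E \<noteq> {} \<longrightarrow> orientable_surface X \<longrightarrow> delta_matroid (D_eq X V E 1))"
proof -
  interpret ribbon_graph X V E by (rule assms)
  obtain H \<alpha> \<gamma> c \<T> where "ribbon_arcs X V E H \<alpha> \<gamma> c \<T>" using ex_ribbon_arcs by blast
  then interpret ribbon_arcs X V E H \<alpha> \<gamma> c \<T> .
  have le: "feasible_le X V E n = {A. A \<subseteq> E \<and> cycles A \<le> num_parts + n}"
    unfolding feasible_le_def using num_boundary_components_eq num_components_eq by auto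
  have eq: "feasible_eq X V E 1 = {A. A \<subseteq> E \<and> cycles A = num_parts + 1}"
    unfolding feasible_eq_def using num_boundary_components_eq num_components_eq by auto
  have sub: "sym_diff A {u, v} \<subseteq> E" if "A \<subseteq> E" "B \<subseteq> E" "u \<in> sym_diff A B" "v \<in> sym_diff A B" for A B u v
    using that by blast
  have "delta_matroid (D_le X V E n)"
    unfolding delta_matroid_def is_set_system_def proper_def symmetric_exchange_def D_le_def fst_conv snd_conv le
  proof (intro conjI ballI)
    obtain A where "A \<subseteq> E" "cycles A = num_parts" using ex_quasi_tree unfolding edge_image by blast
    then show "{A. A \<subseteq> E \<and> cycles A \<le> num_parts + n} \<noteq> {}" by auto
    fix A B u assume A: "A \<in> {A. A \<subseteq> E \<and> cycles A \<le> num_parts + n}" and B: "B \<in> {A. A \<subseteq> E \<and> cycles A \<le> num_parts + n}"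
      and u: "u \<in> sym_diff A B"
    then have AB: "A \<subseteq> E" "B \<subseteq> E" "cycles A \<le> num_parts + n" "cycles B \<le> num_parts + n" by simp_all
    from exchange_le[unfolded edge_image, OF AB u]
    obtain v where v: "v \<in> sym_diff A B" "cycles (sym_diff A {u, v}) \<le> num_parts + n" by (rule bexE)
    have "sym_diff A {u, v} \<in> {A. A \<subseteq> E \<and> cycles A \<le> num_parts + n}"
      using sub[OF AB(1,2) u v(1)] v(2) by simp
    then show "\<exists>v\<in>sym_diff A B. sym_diff A {u, v} \<in> {A. A \<subseteq> E \<and> cycles A \<le> num_parts + n}"
      using v(1) by (rule bexI)
  qed (use finite_E in auto)
  moreover have "delta_matroid (D_eq X V E 1)" if "E \<noteq> {}" and or: "orientable_surface X"
  proof -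
    obtain d :: "'a \<Rightarrow> bool" where d: "\<And>p. p \<in> H \<Longrightarrow> d (\<tau> p) \<noteq> d p" "\<And>p. p \<in> H \<Longrightarrow> d (\<alpha> p) \<noteq> d p" "\<And>p. p \<in> H \<Longrightarrow> d (\<beta> p) \<noteq> d p"
      using ex_alternating_colouring[OF or] by blast
    have "H \<noteq> {}" using that(1) edge_image by blast
    show ?thesis
      unfolding delta_matroid_def is_set_system_def proper_def symmetric_exchange_def D_eq_def fst_conv snd_conv eq
    proof (intro conjI ballI)
      obtain A where "A \<subseteq> E" "cycles A = num_parts + 1"
        using ex_next_to_quasi_tree[where c = d, OF \<open>H \<noteq> {}\<close> d] unfolding edge_image by blast
      then show "{A. A \<subseteq> E \<and> cycles A = num_parts + 1} \<noteq> {}" by auto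
      fix A B u assume A: "A \<in> {A. A \<subseteq> E \<and> cycles A = num_parts + 1}" and B: "B \<in> {A. A \<subseteq> E \<and> cycles A = num_parts + 1}"
        and u: "u \<in> sym_diff A B"
      then have AB: "A \<subseteq> E" "B \<subseteq> E" "cycles A = num_parts + 1" "cycles B = num_parts + 1" by simp_all
      from exchange_eq[where c = d, unfolded edge_image, OF AB u d]
      obtain v where v: "v \<in> sym_diff A B" "cycles (sym_diff A {u, v}) = num_parts + 1" by (rule bexE)
      have "sym_diff A {u, v} \<in> {A. A \<subseteq> E \<and> cycles A = num_parts + 1}"
        using sub[OF AB(1,2) u v(1)] v(2) by simp
      then show "\<exists>v\<in>sym_diff A B. sym_diff A {u, v} \<in> {A. A \<subseteq> E \<and> cycles A = num_parts + 1}"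
        using v(1) by (rule bexI)
    qed (use finite_E in auto)
  qed
  ultimately show ?thesis by blast
qed

end
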